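(* Let $V:\mathbb{R}^3\to\mathbb{C}$ be a measurable function for which there exist $a\in(0,1)$ and $b\in\mathbb{R}$ such that, for all $\psi\in H^2(\mathbb{R}^3)$, $$\int_{\mathbb{R}^3}|V||\psi|^2\le a\int_{\mathbb{R}^3}|\Delta\psi|^2+b\int_{\mathbb{R}^3}|\psi|^2 .$$ Then $$\sigma_{\mathrm p}(H_V)\subset\left\{\lambda\in\mathbb{C}:\ |\lambda|\le\left(\sup_{\psi\in H^1(\mathbb{R}^3),\ \psi\ne0}\frac{\int_{\mathbb{R}^3}|V||\psi|^2}{\int_{\mathbb{R}^3}|\nabla\psi|^2}\right)^2\right\},$$ where $H_V=\Delta^2\dot{+}V$ in $L^2(\mathbb{R}^3)$.
   Context: The supremum is taken in $[0,+\infty]$. The operator $H_V=\Delta^2\dot{+}V$ is the m-sectorial operator in $L^2(\mathbb{R}^3)$ associated, via the representation theorem, with the closed sectorial form $h_V(\varphi,\psi)=\int_{\mathbb{R}^3}\overline{\Delta\varphi}\,\Delta\psi+\int_{\mathbb{R}^3}V\,\overline{\varphi}\,\psi$ with form domain $H^2(\mathbb{R}^3)$. That is, $\psi\in H^2(\mathbb{R}^3)$ belongs to the domain of $H_V$ with $H_V\psi=f\in L^2(\mathbb{R}^3)$ if and only if $h_V(\varphi,\psi)=\int_{\mathbb{R}^3}\overline{\varphi}f$ for all $\varphi\in H^2(\mathbb{R}^3)$. The point spectrum $\sigma_{\mathrm p}(H_V)$ is the set of all eigenvalues $\lambda\in\mathbb{C}$ of $H_V$ (including those lying in $[0,+\infty)$).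 *)

theory Defs
  imports "HOL-Analysis.Analysis"
begin

text \<open>
  Elements of \<open>L\<^sup>2\<close> are represented by Lebesgue measurable functions rather than by classes of
  functions modulo null sets. Accordingly \<open>\<psi> \<noteq> 0\<close> is rendered as \<open>\<not> (AE x in lebesgue. \<psi> x = 0)\<close>.
\<close>

definition L2 :: "('a::euclidean_space \<Rightarrow> complex) set" where
  "L2 = {f. f \<in> borel_measurable lebesgue \<and> integrable lebesgue (\<lambda>x. (cmod (f x))\<^sup>2)}"

primrec Ck :: "nat \<Rightarrow> ('a::euclidean_space \<Rightarrow> complex) \<Rightarrow> bool" where
  "Ck 0 f \<longleftrightarrow> continuous_on UNIV f"
| "Ck (Suc k) f \<longleftrightarrow> (\<forall>x. f differentiable (at x)) \<and>
     (\<forall>b\<in>Basis. Ck k (\<lambda>x. frechet_derivative f (at x) b))"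

definition test_functions :: "('a::euclidean_space \<Rightarrow> complex) set" where
  "test_functions = {\<phi>. (\<forall>k. Ck k \<phi>) \<and> compact (closure {x. \<phi> x \<noteq> 0})}"

text \<open>
  \<open>is_weak_deriv b f g\<close>: the distributional derivative of \<open>f\<close> in the direction \<open>b\<close> is \<open>g\<close>.
  It is only used for \<open>f\<close>, \<open>g\<close> in \<open>L\<^sup>2\<close>, where both integrals converge.
\<close>

definition is_weak_deriv ::
  "'a::euclidean_space \<Rightarrow> ('a \<Rightarrow> complex) \<Rightarrow> ('a \<Rightarrow> complex) \<Rightarrow> bool" where
  "is_weak_deriv b f g \<longleftrightarrow> (\<forall>\<phi>\<in>test_functions.
     (LINT x|lebesgue. f x * frechet_derivative \<phi> (at x) b) = - (LINT x|lebesgue. g x * \<phi> x))"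

text \<open>\<open>Sobolev k\<close> is \<open>H\<^sup>k = W\<^bsup>k,2\<^esup>\<close> on the whole space.\<close>

primrec Sobolev :: "nat \<Rightarrow> ('a::euclidean_space \<Rightarrow> complex) set" where
  "Sobolev 0 = L2"
| "Sobolev (Suc k) = {f \<in> L2. \<forall>b\<in>Basis. \<exists>g\<in>Sobolev k. is_weak_deriv b f g}"

text \<open>
  A weak derivative is determined up to a null set only; \<open>weak_deriv\<close> picks a representative.
\<close>

definition weak_deriv :: "'a::euclidean_space \<Rightarrow> ('a \<Rightarrow> complex) \<Rightarrow> 'a \<Rightarrow> complex" where
  "weak_deriv b f = (SOME g. g \<in> L2 \<and> is_weak_deriv b f g)"

definition grad_norm_sq :: "('a::euclidean_space \<Rightarrow> complex) \<Rightarrow> 'a \<Rightarrow> real" where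
  "grad_norm_sq f x = (\<Sum>b\<in>Basis. (cmod (weak_deriv b f x))\<^sup>2)"

definition laplacian :: "('a::euclidean_space \<Rightarrow> complex) \<Rightarrow> 'a \<Rightarrow> complex" where
  "laplacian f x = (\<Sum>b\<in>Basis. weak_deriv b (weak_deriv b f) x)"

definition form_h ::
  "('a::euclidean_space \<Rightarrow> complex) \<Rightarrow> ('a \<Rightarrow> complex) \<Rightarrow> ('a \<Rightarrow> complex) \<Rightarrow> complex" where
  "form_h V \<phi> \<psi> = (LINT x|lebesgue. cnj (laplacian \<phi> x) * laplacian \<psi> x)
     + (LINT x|lebesgue. V x * cnj (\<phi> x) * \<psi> x)"

text \<open>The operator \<open>\<Delta>\<^sup>2 + V\<close> (form sum), given by its graph.\<close>

definition H_op ::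
  "('a::euclidean_space \<Rightarrow> complex) \<Rightarrow> (('a \<Rightarrow> complex) \<times> ('a \<Rightarrow> complex)) set" where
  "H_op V = {(\<psi>, f). \<psi> \<in> Sobolev 2 \<and> f \<in> L2 \<and>
     (\<forall>\<phi>\<in>Sobolev 2. form_h V \<phi> \<psi> = (LINT x|lebesgue. cnj (\<phi> x) * f x))}"

definition point_spectrum ::
  "(('a::euclidean_space \<Rightarrow> complex) \<times> ('a \<Rightarrow> complex)) set \<Rightarrow> complex set" where
  "point_spectrum T = {\<mu>. \<exists>\<psi>. \<not> (AE x in lebesgue. \<psi> x = 0) \<and> (\<psi>, \<lambda>x. \<mu> * \<psi> x) \<in> T}"

end

theory Submission
  imports Defs
begin

text \<open>
  Write \<open>\<mu> = z\<^sup>2 \<noteq> 0\<close> for an eigenvalue, with eigenfunction \<open>\<psi>\<close>. Since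
  \<open>\<Delta>\<^sup>2 - z\<^sup>2 = (- \<Delta> - z) (- \<Delta> + z)\<close>, the functions \<open>f\<^sub>\<plusminus> = \<plusminus> z \<psi> - \<Delta> \<psi>\<close> satisfy
  \<open>(- \<Delta> \<minusplus> z) f\<^sub>\<plusminus> = - V \<psi>\<close>, and \<open>f\<^sub>+ - f\<^sub>- = 2 z \<psi>\<close>. In dimension three the kernel of
  \<open>(- \<Delta> + \<zeta>\<^sup>2)\<^sup>-\<^sup>1\<close> is \<open>exp (- \<zeta> r) / (4 \<pi> r)\<close>, which for \<open>Re \<zeta> \<ge> 0\<close> is bounded in modulus by the
  Newtonian kernel. With \<open>g = |V| |\<psi>|\<close> and \<open>N g\<close> its Newtonian potential this gives
  \<open>|z| |\<psi>| \<le> N g\<close> almost everywhere.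

  Let \<open>S\<close> be the supremum in the theorem and \<open>A = \<integral> |V| |\<psi>|\<^sup>2\<close>. The energy identity
  \<open>\<integral> |\<nabla> N w|\<^sup>2 = \<integral> w N w\<close> and the definition of \<open>S\<close> give \<open>\<integral> |V| (N w)\<^sup>2 \<le> S \<integral> w N w\<close>, and
  Cauchy-Schwarz then gives \<open>(\<integral> g N w)\<^sup>2 \<le> A S \<integral> w N w\<close>. For \<open>w = g\<close> this reads
  \<open>\<integral> g N g \<le> A S\<close>. Together, \<open>|z| A = \<integral> g |z| |\<psi>| \<le> \<integral> g N g \<le> A S\<close>. If \<open>A = 0\<close>, then \<open>g = 0\<close> and the
  pointwise bound forces \<open>\<psi> = 0\<close>; otherwise \<open>|z| \<le> S\<close>, that is \<open>|\<mu>| \<le> S\<^sup>2\<close>.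

  Three devices make this rigorous for weak derivatives and for all \<open>\<mu>\<close>, including those in the
  spectrum of \<open>\<Delta>\<^sup>2\<close>.

  \<^item> The distance \<open>r\<close> is replaced by \<open>s = sqrt (r\<^sup>2 + d\<^sup>2)\<close>. Then \<open>exp (- \<zeta> s) / s\<close> is smooth, and
    \<open>- \<Delta> + \<zeta>\<^sup>2\<close> maps it to the explicit function
    \<open>d\<^sup>2 exp (- \<zeta> s) (3 / s\<^sup>5 + 3 \<zeta> / s\<^sup>4 + \<zeta>\<^sup>2 / s\<^sup>3)\<close>, a multiple of an approximation of the
    identity as \<open>d\<close> tends to \<open>0\<close> (\<open>laplacian_ker\<close>, \<open>rho_approximates_identity\<close>). Every integration
    by parts thus has a smooth, rapidly decaying factor (\<open>weak_deriv_pairing\<close>).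

  \<^item> A root \<open>\<zeta>\<close> of \<open>\<zeta>\<^sup>2 = - z\<close> may be purely imaginary, in which case the kernel does not decay. It is
    replaced by \<open>\<zeta> + t\<close>; the resulting error is \<open>O(t)\<close> times the \<open>L\<^sup>2\<close> norm \<open>O(t\<^sup>-\<^sup>1\<^sup>/\<^sup>2)\<close> of the kernel
    (\<open>resolvent_error\<close>), and \<open>t = d\<close> tends to \<open>0\<close>.

  \<^item> The mollified inequality is integrated over boxes before the limit is taken
    (\<open>box_integral_le_epot\<close>); Lebesgue differentiation over boxes turns it into a pointwise one
    (\<open>eigenfunction_le_epot\<close>).

  The energy inequality is \<open>pot_energy\<close>, and its consequence \<open>\<integral> g N g \<le> A S\<close> is \<open>epot_energy\<close>.
\<close>


section \<open>Calculus of smooth functions\<close>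

abbreviation pd :: "'a::euclidean_space \<Rightarrow> ('a \<Rightarrow> complex) \<Rightarrow> 'a \<Rightarrow> complex" where
  "pd b f \<equiv> \<lambda>x. frechet_derivative f (at x) b"

lemma pd_eq: "(f has_derivative D) (at x) \<Longrightarrow> pd b f x = D b"
  using frechet_derivative_at by metis

lemma Ck_imp_continuous: "Ck k f \<Longrightarrow> continuous_on UNIV f"
  by (cases k) (auto intro!: continuous_at_imp_continuous_on differentiable_imp_continuous_within)

lemma Ck_SucD: "Ck (Suc k) f \<Longrightarrow> Ck k f"
proof (induction k arbitrary: f)
  case 0
  then show ?case using Ck_imp_continuous[OF 0] by simp
next
  case (Suc k)
  then show ?case by (metis Ck.simps(2))
qed

text \<open>
  The directional derivatives of any family of derivatives witness one further degree of
  differentiability. All smoothness proofs are inductions on the degree through this rule.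
\<close>

lemma Ck_SucI:
  assumes "\<And>x. (f has_derivative D x) (at x)" and "\<And>b. b \<in> Basis \<Longrightarrow> Ck k (\<lambda>x. D x b)"
  shows "Ck (Suc k) f"
proof -
  have "pd b f = (\<lambda>x. D x b)" for b
    using pd_eq[OF assms(1)] by auto
  with assms show ?thesis by (auto simp: differentiable_def)
qed

lemma Ck_has_derivative: "Ck (Suc k) f \<Longrightarrow> (f has_derivative frechet_derivative f (at x)) (at x)"
  using frechet_derivative_works by auto

lemma Ck_const: "Ck k (\<lambda>x. c)"
proof (induction k arbitrary: c)
  case (Suc k)
  show ?case by (rule Ck_SucI[where D="\<lambda>_ _. 0"]) (use Suc in auto)
qed simp

lemma Ck_add: "Ck k f \<Longrightarrow> Ck k g \<Longrightarrow> Ck k (\<lambda>x. f x + g x)"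
proof (induction k arbitrary: f g)
  case (Suc k)
  show ?case
    by (rule Ck_SucI[OF has_derivative_add[OF Ck_has_derivative[OF Suc.prems(1)]
            Ck_has_derivative[OF Suc.prems(2)]]])
       (use Suc in auto)
qed (auto intro: continuous_intros)

lemma Ck_mult: "Ck k f \<Longrightarrow> Ck k g \<Longrightarrow> Ck k (\<lambda>x. f x * g x)"
proof (induction k arbitrary: f g)
  case (Suc k)
  show ?case
    by (rule Ck_SucI[OF has_derivative_mult[OF Ck_has_derivative[OF Suc.prems(1)]
            Ck_has_derivative[OF Suc.prems(2)]]])
       (use Suc Ck_SucD in \<open>auto intro!: Ck_add Suc.IH\<close>)
qed (auto intro: continuous_intros)

lemma Ck_prod: "(\<And>i. i \<in> I \<Longrightarrow> Ck k (f i)) \<Longrightarrow> Ck k (\<lambda>x. \<Prod>i\<in>I. f i x)"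
  by (induction I rule: infinite_finite_induct) (auto intro: Ck_const Ck_mult)

lemma Ck_inner: "Ck k (\<lambda>x. of_real (x \<bullet> b))"
proof (cases k)
  case (Suc j)
  show ?thesis unfolding Suc
    by (rule Ck_SucI[where D="\<lambda>_ h. of_real (h \<bullet> b)"])
       (auto intro!: derivative_eq_intros Ck_const)
qed (auto intro: continuous_intros)

lemma Ck_affine: "Ck k f \<Longrightarrow> Ck k (\<lambda>x. f (c *\<^sub>R x + a))"
proof (induction k arbitrary: f)
  case 0
  then show ?case by (auto intro!: continuous_on_compose2[of UNIV f] continuous_intros)
next
  case (Suc k)
  have "((\<lambda>x. f (c *\<^sub>R x + a)) has_derivative (\<lambda>h. c *\<^sub>R frechet_derivative f (at (c *\<^sub>R x + a)) h)) (at x)" for x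
  proof -
    have 1: "((\<lambda>x. c *\<^sub>R x + a) has_derivative (\<lambda>h. c *\<^sub>R h)) (at x)"
      by (auto intro!: derivative_eq_intros)
    have 2: "(f has_derivative frechet_derivative f (at (c *\<^sub>R x + a))) (at (c *\<^sub>R x + a))"
      using Ck_has_derivative[OF Suc.prems] .
    have "linear (frechet_derivative f (at (c *\<^sub>R x + a)))"
      using 2 has_derivative_linear by blast
    then show ?thesis
      using has_derivative_compose[OF 1 2] by (simp add: linear_cmul)
  qed
  moreover have "Ck k (\<lambda>x. c *\<^sub>R frechet_derivative f (at (c *\<^sub>R x + a)) b)" if "b \<in> Basis" for b
    unfolding scaleR_conv_of_real
    using Suc.prems that by (intro Ck_mult Ck_const Suc.IH[of "pd b f"]) auto
  ultimately show ?case by (rule Ck_SucI)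
qed

lemma pd_affine:
  assumes "f differentiable (at (c *\<^sub>R x + a))"
  shows "pd b (\<lambda>x. f (c *\<^sub>R x + a)) x = c *\<^sub>R pd b f (c *\<^sub>R x + a)"
proof -
  have 1: "((\<lambda>x. c *\<^sub>R x + a) has_derivative (\<lambda>h. c *\<^sub>R h)) (at x)"
    by (auto intro!: derivative_eq_intros)
  have 2: "(f has_derivative frechet_derivative f (at (c *\<^sub>R x + a))) (at (c *\<^sub>R x + a))"
    using assms frechet_derivative_works by blast
  have "linear (frechet_derivative f (at (c *\<^sub>R x + a)))"
    using 2 has_derivative_linear by blast
  then show ?thesis
    using pd_eq[OF has_derivative_compose[OF 1 2]] by (simp add: linear_cmul)
qed

section \<open>Test functions\<close>

text \<open>
  The family \<open>p (1 / t) exp (- 1 / t)\<close>, indexed by polynomials and continued by \<open>0\<close> to \<open>t \<le> 0\<close>, is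
  closed under differentiation, so that smoothness follows by induction for all members at once.
\<close>

definition bump1 :: "real poly \<Rightarrow> real \<Rightarrow> complex" where
  "bump1 p t = (if t \<le> 0 then 0 else of_real (poly p (1 / t) * exp (- (1 / t))))"

lemma poly_exp_tendsto_0: "((\<lambda>t::real. poly p t * exp (- t)) \<longlongrightarrow> 0) at_top"
proof -
  have "((\<lambda>t. \<Sum>i\<le>degree p. coeff p i * (t ^ i / exp t)) \<longlongrightarrow> (\<Sum>i\<le>degree p. coeff p i * 0)) at_top"
    by (intro tendsto_intros tendsto_power_div_exp_0)
  moreover have "poly p t * exp (- t) = (\<Sum>i\<le>degree p. coeff p i * (t ^ i / exp t))" for t
    unfolding poly_altdef sum_distrib_right by (intro sum.cong) (auto simp: exp_minus divide_inverse)
  ultimately show ?thesis by simp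
qed

text \<open>
  With \<open>u = 1 / t\<close> the derivative of \<open>p u exp (- u)\<close> is \<open>u\<^sup>2 (p u - p' u) exp (- u)\<close>. At \<open>t = 0\<close> it is
  the decay of \<open>u p u exp (- u)\<close> that counts.
\<close>

lemma bump1_has_vector_derivative:
  "(bump1 p has_vector_derivative bump1 (monom 1 2 * (p - pderiv p)) t) (at t)"
proof -
  let ?q = "monom 1 2 * (p - pderiv p)"
  consider "t < 0" | "t = 0" | "t > 0" by linarith
  then show ?thesis
  proof cases
    case 1
    have "((\<lambda>_. 0) has_vector_derivative bump1 ?q t) (at t)"
      using 1 by (simp add: bump1_def)
    then show ?thesis
      by (rule has_vector_derivative_transform_within_open[of _ _ _ "{..<0}"])
         (use 1 in \<open>auto simp: bump1_def\<close>)
  next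
    case 3
    have "((\<lambda>t. poly p (1 / t) * exp (- (1 / t))) has_real_derivative
        poly ?q (1/t) * exp (- (1/t))) (at t)"
      using 3 by (auto intro!: derivative_eq_intros poly_DERIV[THEN DERIV_chain2]
        simp: poly_monom field_simps power2_eq_square)
    then have "((\<lambda>t. of_real (poly p (1 / t) * exp (- (1 / t))) :: complex) has_vector_derivative
        of_real (poly ?q (1/t) * exp (- (1/t)))) (at t)"
      by (rule has_vector_derivative_of_real)
    then have "((\<lambda>t. of_real (poly p (1 / t) * exp (- (1 / t))) :: complex) has_vector_derivative
        bump1 ?q t) (at t)" using 3 by (simp add: bump1_def)
    then show ?thesis
      by (rule has_vector_derivative_transform_within_open[of _ _ _ "{0<..}"])
         (use 3 in \<open>auto simp: bump1_def\<close>)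
  next
    case 2
    have lim: "((\<lambda>h. poly (pCons 0 p) (1/h) * exp (- (1/h))) \<longlongrightarrow> 0) (at_right (0::real))"
      using filterlim_compose[OF poly_exp_tendsto_0[of "pCons 0 p"] filterlim_inverse_at_top_right]
      by (simp add: inverse_eq_divide)
    have "((\<lambda>h. bump1 p h /\<^sub>R h) \<longlongrightarrow> 0) (at_right 0)"
    proof (rule Lim_transform_eventually)
      show "((\<lambda>h. of_real (poly (pCons 0 p) (1/h) * exp (- (1/h))) :: complex) \<longlongrightarrow> 0) (at_right 0)"
        using tendsto_of_real[OF lim, where 'a=complex] by (simp only: of_real_0)
      show "\<forall>\<^sub>F x in at_right 0. complex_of_real (poly (pCons 0 p) (1 / x) * exp (- (1 / x))) = bump1 p x /\<^sub>R x"
        unfolding eventually_at_right_field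
        by (rule exI[of _ 1]) (auto simp: bump1_def scaleR_conv_of_real field_simps)
    qed
    moreover have "((\<lambda>h. bump1 p h /\<^sub>R h) \<longlongrightarrow> 0) (at_left 0)"
      by (rule Lim_transform_eventually[of "\<lambda>_. 0"])
         (auto simp: bump1_def eventually_at_left_field intro!: exI[of _ "-1"])
    ultimately have "((\<lambda>h. bump1 p h /\<^sub>R h) \<longlongrightarrow> 0) (at 0)"
      using filterlim_split_at_real by blast
    then have "((\<lambda>h. (1 / norm h) *\<^sub>R bump1 p h) \<longlongrightarrow> 0) (at 0)"
      by (rule Lim_null_comparison[OF always_eventually, rotated, OF tendsto_norm_zero])
         (simp add: divide_inverse)
    then have "(bump1 p has_vector_derivative 0) (at 0)"
      unfolding has_vector_derivative_def has_derivative_at2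
      by (simp add: bump1_def[of p 0] bounded_linear_zero)
    with 2 show ?thesis by (simp add: bump1_def)
  qed
qed

lemma Ck_bump1: "Ck k (\<lambda>x. bump1 p (c * (x \<bullet> e) + d))"
proof (induction k arbitrary: p)
  case 0
  have "continuous_on UNIV (bump1 p)"
    by (intro continuous_at_imp_continuous_on ballI
        has_vector_derivative_continuous[OF bump1_has_vector_derivative])
  then show ?case
    by (auto intro!: continuous_on_compose2[of UNIV "bump1 p"] continuous_intros)
next
  case (Suc k)
  let ?q = "monom 1 2 * (p - pderiv p)"
  have "((\<lambda>x. bump1 p (c * (x \<bullet> e) + d)) has_derivative
      (\<lambda>h. (c * (h \<bullet> e)) *\<^sub>R bump1 ?q (c * (x \<bullet> e) + d))) (at x)" for x
  proof -
    have 1: "((\<lambda>x. c * (x \<bullet> e) + d) has_derivative (\<lambda>h. c * (h \<bullet> e))) (at x)"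
      by (auto intro!: derivative_eq_intros)
    show ?thesis
      using has_derivative_compose[OF 1 bump1_has_vector_derivative[of p "c * (x \<bullet> e) + d",
        unfolded has_vector_derivative_def]] .
  qed
  then show ?case
    by (rule Ck_SucI) (use Suc in \<open>auto simp: scaleR_conv_of_real intro!: Ck_mult Ck_const\<close>)
qed

definition box_bump :: "real \<Rightarrow> 'a::euclidean_space \<Rightarrow> 'a \<Rightarrow> 'a \<Rightarrow> complex" where
  "box_bump n l u x = (\<Prod>c\<in>Basis. bump1 1 (n * (x \<bullet> c) + - n * (l \<bullet> c)) * bump1 1 (- n * (x \<bullet> c) + n * (u \<bullet> c)))"

lemma Ck_box_bump: "Ck k (box_bump n l u)"
  unfolding box_bump_def[abs_def] by (intro Ck_prod Ck_mult Ck_bump1)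

lemma box_bump_eq_0:
  assumes "n > 0" "x \<notin> box l u"
  shows "box_bump n l u x = 0"
proof -
  obtain c where c: "c \<in> Basis" "x \<bullet> c \<le> l \<bullet> c \<or> u \<bullet> c \<le> x \<bullet> c"
    using assms(2) by (auto simp: mem_box not_less)
  then have "bump1 1 (n * (x \<bullet> c) + - n * (l \<bullet> c)) * bump1 1 (- n * (x \<bullet> c) + n * (u \<bullet> c)) = 0"
    using assms(1) by (auto simp: bump1_def)
  then show ?thesis unfolding box_bump_def using c(1) by (intro prod_zero) auto
qed

lemma box_bump_test_function:
  assumes "n > 0"
  shows "box_bump n l u \<in> test_functions"
proof -
  have "closure {x. box_bump n l u x \<noteq> 0} \<subseteq> cbox l u"
    using box_bump_eq_0[OF assms, of _ l u] box_subset_cbox by (intro closure_minimal) auto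
  then have "bounded (closure {x. box_bump n l u x \<noteq> 0})"
    using bounded_cbox bounded_subset by blast
  then show ?thesis
    using Ck_box_bump by (auto simp: test_functions_def compact_eq_bounded_closed)
qed

lemma cmod_bump1_1_le: "cmod (bump1 1 t) \<le> 1"
  by (auto simp: bump1_def)

lemma cmod_box_bump_le: "cmod (box_bump n l u x) \<le> 1"
  unfolding box_bump_def prod_norm[symmetric]
  by (intro prod_le_1) (auto simp: norm_mult intro!: mult_le_one cmod_bump1_1_le)

lemma bump1_scaled_tendsto: "t > 0 \<Longrightarrow> (\<lambda>n. bump1 1 (real (Suc n) * t)) \<longlonglongrightarrow> 1"
proof -
  assume t: "t > 0"
  have "(\<lambda>n. of_real (exp (- (inverse (real (Suc n)) * (1 / t)))) :: complex) \<longlonglongrightarrow> of_real (exp (- (0 * (1/t))))"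
    by (intro tendsto_intros LIMSEQ_inverse_real_of_nat)
  moreover have "bump1 1 (real (Suc n) * t) = of_real (exp (- (inverse (real (Suc n)) * (1 / t))))" for n
    using mult_pos_pos[OF _ t, of "real (Suc n)"] t by (auto simp: bump1_def field_simps not_le[symmetric])
  ultimately show ?thesis by (simp del: of_nat_Suc)
qed

text \<open>
  Test functions that increase to the indicator of a box: they transport statements about test
  functions to statements about integrals over boxes.
\<close>

lemma box_bump_tendsto: "(\<lambda>n. box_bump (real (Suc n)) l u x) \<longlonglongrightarrow> indicator (box l u) x"
proof (cases "x \<in> box l u")
  case True
  have "(\<lambda>n. box_bump (real (Suc n)) l u x) \<longlonglongrightarrow> (\<Prod>c\<in>(Basis :: 'a set). 1 * 1)"
    unfolding box_bump_def
  proof (rule Limits.tendsto_prod, rule tendsto_mult)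
    fix c :: 'a assume c: "c \<in> Basis"
    have "x \<bullet> c - l \<bullet> c > 0" "u \<bullet> c - x \<bullet> c > 0" using True c by (auto simp: mem_box)
    from this[THEN bump1_scaled_tendsto]
    show "(\<lambda>n. bump1 1 (real (Suc n) * (x \<bullet> c) + - real (Suc n) * (l \<bullet> c))) \<longlonglongrightarrow> 1"
      "(\<lambda>n. bump1 1 (- real (Suc n) * (x \<bullet> c) + real (Suc n) * (u \<bullet> c))) \<longlonglongrightarrow> 1"
      by (simp_all add: algebra_simps)
  qed
  with True show ?thesis by simp
next
  case False
  then show ?thesis using box_bump_eq_0[of "real (Suc _)" x l u] by simp
qed

section \<open>Square integrable functions\<close>

lemma L2_measurable: "f \<in> L2 \<Longrightarrow> f \<in> borel_measurable lebesgue"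
  and L2_integrable_sq: "f \<in> L2 \<Longrightarrow> integrable lebesgue (\<lambda>x. (cmod (f x))\<^sup>2)"
  by (auto simp: L2_def)

lemma mult_le_sum_sq: "a * b \<le> a\<^sup>2 + (b::real)\<^sup>2"
  using sum_squares_bound[of a b] zero_le_power2[of a] zero_le_power2[of b] by linarith

lemma L2_mult_integrable:
  assumes "f \<in> L2" "g \<in> L2"
  shows "integrable lebesgue (\<lambda>x. f x * g x)"
proof (rule Bochner_Integration.integrable_bound)
  show "integrable lebesgue (\<lambda>x. (cmod (f x))\<^sup>2 + (cmod (g x))\<^sup>2)"
    using assms by (auto simp: L2_def)
  show "(\<lambda>x. f x * g x) \<in> borel_measurable lebesgue"
    using assms by (auto simp: L2_def)
qed (auto simp: norm_mult mult_le_sum_sq)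

lemma L2_bound:
  assumes "f \<in> L2" "g \<in> borel_measurable lebesgue" "AE x in lebesgue. cmod (g x) \<le> C * cmod (f x)"
  shows "g \<in> L2"
proof -
  have "integrable lebesgue (\<lambda>x. (cmod (g x))\<^sup>2)"
  proof (rule Bochner_Integration.integrable_bound)
    show "integrable lebesgue (\<lambda>x. C\<^sup>2 * (cmod (f x))\<^sup>2)" using assms(1) by (auto simp: L2_def)
    show "AE x in lebesgue. norm ((cmod (g x))\<^sup>2) \<le> norm (C\<^sup>2 * (cmod (f x))\<^sup>2)"
      using assms(3) by eventually_elim (simp add: power_mult_distrib[symmetric] power_mono)
  qed (use assms(2) in auto)
  with assms(2) show ?thesis by (simp add: L2_def)
qed

lemma L2_add: assumes "f \<in> L2" "g \<in> L2" shows "(\<lambda>x. f x + g x) \<in> L2"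
proof -
  have "integrable lebesgue (\<lambda>x. (cmod (f x + g x))\<^sup>2)"
  proof (rule Bochner_Integration.integrable_bound)
    show "integrable lebesgue (\<lambda>x. 2 * (cmod (f x))\<^sup>2 + 2 * (cmod (g x))\<^sup>2)"
      using assms by (auto simp: L2_def)
    have "(cmod (f x + g x))\<^sup>2 \<le> 2 * (cmod (f x))\<^sup>2 + 2 * (cmod (g x))\<^sup>2" for x
      using power_mono[OF norm_triangle_ineq[of "f x" "g x"], of 2] sum_squares_bound[of "cmod (f x)" "cmod (g x)"]
      by (simp add: power2_sum)
    then show "AE x in lebesgue. norm ((cmod (f x + g x))\<^sup>2) \<le> norm (2 * (cmod (f x))\<^sup>2 + 2 * (cmod (g x))\<^sup>2)"
      by simp
  qed (use assms in \<open>auto simp: L2_def\<close>)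
  with assms show ?thesis by (auto simp: L2_def)
qed

lemma L2_cmult: assumes "f \<in> L2" shows "(\<lambda>x. c * f x) \<in> L2"
  using assms by (intro L2_bound[OF assms, of _ "cmod c"]) (auto simp: L2_def norm_mult)

lemma L2_sum: "(\<And>i. i \<in> I \<Longrightarrow> f i \<in> L2) \<Longrightarrow> (\<lambda>x. \<Sum>i\<in>I. f i x) \<in> L2"
proof (induction I rule: infinite_finite_induct)
  case (insert i I)
  then show ?case using L2_add[of "f i" "\<lambda>x. \<Sum>i\<in>I. f i x"] by simp
qed (simp_all add: L2_def)

lemma L2_indicator_box: "(\<lambda>x. indicator (box l u) x) \<in> L2"
proof -
  have "integrable lebesgue (\<lambda>x. indicator (box l u) x :: real)"
    by (rule integrable_real_indicator) (auto simp: emeasure_lborel_box_eq)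
  moreover have "(cmod (indicator (box l u) x))\<^sup>2 = indicator (box l u) x" for x
    by (auto simp: indicator_def)
  moreover have "(indicator (box l u) :: 'a \<Rightarrow> complex) \<in> borel_measurable lebesgue"
    by (rule borel_measurable_indicator) simp
  ultimately show ?thesis by (auto simp: L2_def)
qed

lemma L2_box_integrable: "f \<in> L2 \<Longrightarrow> set_integrable lebesgue (box l u) f"
  using L2_mult_integrable[OF L2_indicator_box, of f l u]
  by (simp add: set_integrable_def indicator_def of_bool_def if_distrib if_distribR cong: if_cong)

section \<open>Comparison of functions through their integrals over boxes\<close>

lemma set_integral_box_eq:
  fixes f :: "'a::euclidean_space \<Rightarrow> 'b::euclidean_space"
  assumes "set_integrable lebesgue (box l u) f"
  shows "f integrable_on cbox l u" "integral (cbox l u) f = (LINT x:box l u|lebesgue. f x)"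
proof -
  have "(f has_integral (LINT x:box l u|lebesgue. f x)) (box l u)"
    by (rule has_integral_set_lebesgue[OF assms])
  then have "(f has_integral (LINT x:box l u|lebesgue. f x)) (cbox l u)"
  proof (rule has_integral_spike_set_eq[THEN iffD1, rotated -1])
    show "negligible {x \<in> box l u - cbox l u. f x \<noteq> 0}" 
    proof -
      have "{x \<in> box l u - cbox l u. f x \<noteq> 0} = {}" using box_subset_cbox[of l u] by auto
      then show ?thesis by (simp only: negligible_empty)
    qed
    show "negligible {x \<in> cbox l u - box l u. f x \<noteq> 0}"
      by (rule negligible_subset[OF negligible_frontier_interval[of l u]]) auto
  qed
  then show "f integrable_on cbox l u" "integral (cbox l u) f = (LINT x:box l u|lebesgue. f x)"
    by (auto simp: integral_unique integrable_on_def)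
qed

text \<open>
  Lebesgue differentiation over shrinking boxes with a corner at \<open>x\<close>: both averages converge to the
  values at \<open>x\<close> for almost every \<open>x\<close>.
\<close>

lemma AE_norm_le_of_box_integrals:
  fixes f :: "'a::euclidean_space \<Rightarrow> complex" and h :: "'a \<Rightarrow> real"
  assumes f: "\<And>l u. set_integrable lebesgue (box l u) f"
    and h: "\<And>l u. set_integrable lebesgue (box l u) h"
    and le: "\<And>l u. cmod (LINT x:box l u|lebesgue. f x) \<le> (LINT x:box l u|lebesgue. h x)"
  shows "AE x in lebesgue. cmod (f x) \<le> h x"
proof -
  obtain N where N: "negligible N" "\<And>x e. \<lbrakk>x \<notin> N; 0 < e\<rbrakk> \<Longrightarrow> \<exists>d>0. \<forall>t. 0 < t \<and> t < d \<longrightarrow>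
      norm (integral (cbox x (x + t *\<^sub>R One)) f /\<^sub>R t ^ DIM('a) - f x) < e"
    using integrable_ccontinuous_explicit[of f] set_integral_box_eq(1)[OF f] by blast
  obtain M where M: "negligible M" "\<And>x e. \<lbrakk>x \<notin> M; 0 < e\<rbrakk> \<Longrightarrow> \<exists>d>0. \<forall>t. 0 < t \<and> t < d \<longrightarrow>
      norm (integral (cbox x (x + t *\<^sub>R One)) h /\<^sub>R t ^ DIM('a) - h x) < e"
    using integrable_ccontinuous_explicit[of h] set_integral_box_eq(1)[OF h] by blast
  have "cmod (f x) \<le> h x" if x: "x \<notin> N \<union> M" for x
  proof (rule field_le_epsilon)
    fix e :: real assume e: "e > 0"
    obtain d1 where d1: "d1 > 0" "\<And>t. 0 < t \<and> t < d1 \<Longrightarrow>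
        norm (integral (cbox x (x + t *\<^sub>R One)) f /\<^sub>R t ^ DIM('a) - f x) < e / 2"
      using N(2)[of x "e/2"] x e by auto
    obtain d2 where d2: "d2 > 0" "\<And>t. 0 < t \<and> t < d2 \<Longrightarrow>
        norm (integral (cbox x (x + t *\<^sub>R One)) h /\<^sub>R t ^ DIM('a) - h x) < e / 2"
      using M(2)[of x "e/2"] x e by auto
    define t where "t = min d1 d2 / 2"
    have t: "0 < t" "t < d1" "t < d2" using d1(1) d2(1) by (auto simp: t_def)
    let ?A = "integral (cbox x (x + t *\<^sub>R One)) f" and ?B = "integral (cbox x (x + t *\<^sub>R One)) h"
    have "cmod (?A /\<^sub>R t ^ DIM('a)) \<le> ?B /\<^sub>R t ^ DIM('a)"
      using le[of x "x + t *\<^sub>R One"] t(1)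
      by (simp add: set_integral_box_eq(2)[OF f] set_integral_box_eq(2)[OF h] mult_left_mono)
    moreover have "cmod (?A /\<^sub>R t ^ DIM('a) - f x) < e / 2" "\<bar>?B /\<^sub>R t ^ DIM('a) - h x\<bar> < e / 2"
      using d1(2)[of t] d2(2)[of t] t by auto
    moreover have "cmod (f x) \<le> cmod (?A /\<^sub>R t ^ DIM('a)) + cmod (?A /\<^sub>R t ^ DIM('a) - f x)"
      by (metis norm_triangle_sub norm_minus_commute)
    ultimately show "cmod (f x) \<le> h x + e" by linarith
  qed
  moreover have "N \<union> M \<in> null_sets lebesgue"
    using N(1) M(1) negligible_Un negligible_iff_null_sets by blast
  ultimately show ?thesis by (auto intro!: AE_I'[of "N \<union> M"])
qed

text \<open>
  The fundamental lemma of the calculus of variations. Approximating the indicators of boxes by test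
  functions shows that all integrals over boxes vanish.
\<close>

lemma L2_AE_zero_of_test_functions:
  assumes f: "f \<in> L2" and 0: "\<And>\<phi>. \<phi> \<in> test_functions \<Longrightarrow> (LINT x|lebesgue. f x * \<phi> x) = 0"
  shows "AE x in lebesgue. f x = 0"
proof -
  have "(LINT x:box l u|lebesgue. f x) = 0" for l u
  proof -
    have "(\<lambda>n. LINT x|lebesgue. f x * box_bump (real (Suc n)) l u x) \<longlonglongrightarrow> (LINT x|lebesgue. f x * indicator (box l u) x)"
    proof (rule integral_dominated_convergence[where w="\<lambda>x. norm (f x * indicator (box l u) x)"])
      show "integrable lebesgue (\<lambda>x. norm (f x * indicator (box l u) x))"
        using L2_mult_integrable[OF f L2_indicator_box] by (rule integrable_norm)
      show "AE x in lebesgue. (\<lambda>n. f x * box_bump (real (Suc n)) l u x) \<longlonglongrightarrow> f x * indicator (box l u) x"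
        by (intro AE_I2 tendsto_mult tendsto_const box_bump_tendsto)
      show "AE x in lebesgue. norm (f x * box_bump (real (Suc n)) l u x) \<le> norm (f x * indicator (box l u) x)" for n
        using box_bump_eq_0[of "real (Suc n)" _ l u] cmod_box_bump_le[of "real (Suc n)" l u]
        by (auto simp: norm_mult indicator_def mult_left_le)
      have "box_bump (real (Suc n)) l u \<in> borel_measurable borel" for n
        using Ck_imp_continuous[OF Ck_box_bump] by (rule borel_measurable_continuous_onI)
      then have [measurable]: "box_bump (real (Suc n)) l u \<in> borel_measurable lebesgue" for n
        by (simp add: measurable_completion)
      have [measurable]: "f \<in> borel_measurable lebesgue" using f by (rule L2_measurable)
      show "(\<lambda>x. f x * box_bump (real (Suc n)) l u x) \<in> borel_measurable lebesgue" for n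
        by measurable
      show "(\<lambda>x. f x * indicator (box l u) x) \<in> borel_measurable lebesgue"
        using L2_mult_integrable[OF f L2_indicator_box] by auto
    qed
    moreover have "(LINT x|lebesgue. f x * box_bump (real (Suc n)) l u x) = 0" for n
      by (rule 0[OF box_bump_test_function]) simp
    ultimately have "(LINT x|lebesgue. f x * indicator (box l u) x) = 0"
      by (simp add: LIMSEQ_const_iff)
    moreover have "indicator (box l u) x *\<^sub>R f x = f x * indicator (box l u) x" for x
      by (auto simp: indicator_def)
    ultimately show ?thesis by (simp add: set_lebesgue_integral_def)
  qed
  then have "AE x in lebesgue. cmod (f x) \<le> 0"
    using AE_norm_le_of_box_integrals[of f "\<lambda>_. 0"] L2_box_integrable[OF f]
    by (simp add: set_integrable_def set_lebesgue_integral_def)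
  then show ?thesis by simp
qed


section \<open>Integration by parts\<close>

lemma lebesgue_affine_distr:
  fixes t :: "'a::euclidean_space" and c :: real
  assumes "c \<noteq> 0"
  shows "lebesgue = density (distr lebesgue lebesgue (\<lambda>x. t + c *\<^sub>R x)) (\<lambda>_. ennreal (\<bar>c\<bar> ^ DIM('a)))"
    and "(\<lambda>x. t + c *\<^sub>R x) \<in> lebesgue \<rightarrow>\<^sub>M (lebesgue :: 'a measure)"
proof -
  have eq: "(\<Sum>j\<in>Basis. (c * (x \<bullet> j)) *\<^sub>R j) = c *\<^sub>R x" for x :: 'a
    unfolding scaleR_scaleR[symmetric] scaleR_sum_right[symmetric] euclidean_representation ..
  show "lebesgue = density (distr lebesgue lebesgue (\<lambda>x. t + c *\<^sub>R x)) (\<lambda>_. ennreal (\<bar>c\<bar> ^ DIM('a)))"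
    using lebesgue_affine_euclidean[where c="\<lambda>_::'a. c" and t=t] assms by (simp add: eq)
  show "(\<lambda>x. t + c *\<^sub>R x) \<in> lebesgue \<rightarrow>\<^sub>M (lebesgue :: 'a measure)"
    using lebesgue_affine_measurable[where c="\<lambda>_::'a. c" and t=t] assms by (simp add: eq)
qed

lemma integrable_scaleR_right_iff_const:
  fixes f :: "'a \<Rightarrow> 'b::{banach, second_countable_topology}"
  assumes "c \<noteq> 0"
  shows "integrable M (\<lambda>x. c *\<^sub>R f x) \<longleftrightarrow> integrable M f"
proof
  assume "integrable M (\<lambda>x. c *\<^sub>R f x)"
  from integrable_scaleR_right[OF this, of "inverse c"] assms show "integrable M f" by simp
qed simp

lemma integral_lebesgue_affine:
  fixes f :: "'a::euclidean_space \<Rightarrow> 'b::{banach, second_countable_topology}"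
  assumes c: "c \<noteq> 0" and f: "f \<in> borel_measurable lebesgue"
  shows "integrable lebesgue (\<lambda>x. f (t + c *\<^sub>R x)) \<longleftrightarrow> integrable lebesgue f"
    and "(LINT x|lebesgue. f x) = \<bar>c\<bar> ^ DIM('a) *\<^sub>R (LINT x|lebesgue. f (t + c *\<^sub>R x))"
proof -
  note T = lebesgue_affine_distr[OF c, of t]
  have m: "f \<in> borel_measurable (distr lebesgue lebesgue (\<lambda>x. t + c *\<^sub>R x))"
    using f by simp
  have "integrable lebesgue f \<longleftrightarrow> integrable (density (distr lebesgue lebesgue (\<lambda>x. t + c *\<^sub>R x)) (\<lambda>_. ennreal (\<bar>c\<bar> ^ DIM('a)))) f"
    using T(1) by simp
  also have "\<dots> \<longleftrightarrow> integrable (distr lebesgue lebesgue (\<lambda>x. t + c *\<^sub>R x)) (\<lambda>x. \<bar>c\<bar> ^ DIM('a) *\<^sub>R f x)"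
    by (rule integrable_density[OF m]) auto
  also have "\<dots> \<longleftrightarrow> integrable (distr lebesgue lebesgue (\<lambda>x. t + c *\<^sub>R x)) f"
    by (rule integrable_scaleR_right_iff_const) (use c in simp)
  also have "\<dots> \<longleftrightarrow> integrable lebesgue (\<lambda>x. f (t + c *\<^sub>R x))"
    by (rule integrable_distr_eq[OF T(2) f])
  finally show "integrable lebesgue (\<lambda>x. f (t + c *\<^sub>R x)) \<longleftrightarrow> integrable lebesgue f" ..
  have "(LINT x|lebesgue. f x) = (LINT x|density (distr lebesgue lebesgue (\<lambda>x. t + c *\<^sub>R x)) (\<lambda>_. ennreal (\<bar>c\<bar> ^ DIM('a))). f x)"
    using T(1) by simp
  also have "\<dots> = (LINT x|distr lebesgue lebesgue (\<lambda>x. t + c *\<^sub>R x). \<bar>c\<bar> ^ DIM('a) *\<^sub>R f x)"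
    by (rule integral_density[OF m]) auto
  also have "\<dots> = \<bar>c\<bar> ^ DIM('a) *\<^sub>R (LINT x|distr lebesgue lebesgue (\<lambda>x. t + c *\<^sub>R x). f x)"
    by simp
  also have "(LINT x|distr lebesgue lebesgue (\<lambda>x. t + c *\<^sub>R x). f x) = (LINT x|lebesgue. f (t + c *\<^sub>R x))"
    by (rule integral_distr[OF T(2) f])
  finally show "(LINT x|lebesgue. f x) = \<bar>c\<bar> ^ DIM('a) *\<^sub>R (LINT x|lebesgue. f (t + c *\<^sub>R x))" .
qed

lemma borel_measurable_lebesgueI: "continuous_on UNIV f \<Longrightarrow> f \<in> borel_measurable lebesgue"
  by (simp add: borel_measurable_continuous_onI measurable_completion)

lemma continuous_compact_support_bounded:
  fixes f :: "'a::euclidean_space \<Rightarrow> complex"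
  assumes "continuous_on UNIV f" "compact (closure {x. f x \<noteq> 0})"
  obtains M where "M > 0" "\<And>x. cmod (f x) \<le> M"
proof -
  have "bounded (f ` closure {x. f x \<noteq> 0})"
    using assms by (intro compact_imp_bounded compact_continuous_image) (auto intro: continuous_on_subset)
  then obtain M where M: "M > 0" "\<And>x. x \<in> closure {x. f x \<noteq> 0} \<Longrightarrow> cmod (f x) \<le> M"
    unfolding bounded_pos by auto
  have "cmod (f x) \<le> M" for x
    using M(1) M(2)[of x] closure_subset[of "{x. f x \<noteq> 0}"] by (cases "f x = 0") auto
  with M(1) that show thesis by blast
qed

lemma pd_support: "closure {x. pd b f x \<noteq> 0} \<subseteq> closure {x. f x \<noteq> 0}"
proof (rule closure_minimal)
  show "{x. pd b f x \<noteq> 0} \<subseteq> closure {x. f x \<noteq> 0}"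
  proof
    fix x assume x: "x \<in> {x. pd b f x \<noteq> 0}"
    show "x \<in> closure {x. f x \<noteq> 0}"
    proof (rule ccontr)
      assume notin: "x \<notin> closure {x. f x \<noteq> 0}"
      have "(f has_derivative (\<lambda>_. 0)) (at x)"
      proof (rule has_derivative_transform_within_open[of "\<lambda>_. 0" _ _ UNIV "- closure {x. f x \<noteq> 0}"])
        show "0 = f y" if "y \<in> - closure {x. f x \<noteq> 0}" for y
          using closure_subset[of "{x. f x \<noteq> 0}"] that by auto
      qed (use notin in \<open>simp_all add: open_Compl\<close>)
      then have "pd b f x = 0" using pd_eq by force
      with x show False by simp
    qed
  qed
qed simp

lemma integrable_continuous_compact_support:
  fixes f :: "'a::euclidean_space \<Rightarrow> complex"
  assumes "continuous_on UNIV f" "compact (closure {x. f x \<noteq> 0})"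
  shows "integrable lebesgue f"
proof -
  have "integrable lborel (\<lambda>x. indicator (closure {x. f x \<noteq> 0}) x *\<^sub>R f x)"
    using assms by (intro borel_integrable_compact) (auto intro: continuous_on_subset)
  then have "set_integrable lebesgue (closure {x. f x \<noteq> 0}) f"
    unfolding set_integrable_def
    by (subst integrable_completion) (rule borel_measurable_integrable)
  moreover have "indicator (closure {x. f x \<noteq> 0}) x *\<^sub>R f x = f x" for x
    using closure_subset[of "{x. f x \<noteq> 0}"] by (auto simp: indicator_def)
  ultimately show ?thesis by (simp add: set_integrable_def)
qed

lemma compact_support_L2:
  fixes f :: "'a::euclidean_space \<Rightarrow> complex"
  assumes "continuous_on UNIV f" "compact (closure {x. f x \<noteq> 0})"
  shows "f \<in> L2"
proof -
  have "integrable lebesgue (\<lambda>x. f x * cnj (f x))"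
    by (rule integrable_continuous_compact_support)
       (use assms in \<open>auto intro!: continuous_intros\<close>)
  then have "integrable lebesgue (\<lambda>x. complex_of_real ((cmod (f x))\<^sup>2))"
    unfolding complex_norm_square .
  then have "integrable lebesgue (\<lambda>x. (cmod (f x))\<^sup>2)"
    using complex_of_real_integrable_eq by blast
  then show ?thesis using borel_measurable_lebesgueI[OF assms(1)] by (simp add: L2_def)
qed

text \<open>
  The difference quotients of \<open>f\<close> have integral \<open>0\<close> by translation invariance; they converge to the
  derivative dominatedly because \<open>f\<close> is Lipschitz along \<open>b\<close> and vanishes outside a ball.
\<close>

lemma integral_pd_eq_0:
  fixes f :: "'a::euclidean_space \<Rightarrow> complex"
  assumes f: "Ck 1 f" "compact (closure {x. f x \<noteq> 0})" and b: "b \<in> Basis"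
  shows "(LINT x|lebesgue. pd b f x) = 0"
proof -
  have cf: "continuous_on UNIV f" and cp: "continuous_on UNIV (pd b f)"
    using f(1) b Ck_imp_continuous[OF f(1)] by auto
  have der: "(f has_derivative frechet_derivative f (at x)) (at x)" for x
    using f(1) Ck_has_derivative[of 0 f x] by simp
  have intf: "integrable lebesgue f"
    using integrable_continuous_compact_support[OF cf f(2)] .
  have comp: "compact (closure {x. pd b f x \<noteq> 0})"
    using pd_support[of f b] f(2) by (metis closed_closure compact_Int_closed inf.absorb_iff2)
  obtain M where M: "M > 0" "\<And>x. cmod (pd b f x) \<le> M"
    using continuous_compact_support_bounded[OF cp comp] by blast
  obtain R where R: "R > 0" "\<And>x. f x \<noteq> 0 \<Longrightarrow> norm x \<le> R"
    using compact_imp_bounded[OF f(2)] closure_subset[of "{x. f x \<noteq> 0}"] unfolding bounded_pos by blast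
  define r where "r n = inverse (real (Suc n))" for n
  have r: "0 < r n" "r n \<le> 1" for n by (auto simp: r_def field_simps)
  have line: "((\<lambda>s. f (x + s *\<^sub>R b)) has_vector_derivative pd b f (x + s *\<^sub>R b)) (at s within A)" for x s A
  proof -
    have "((\<lambda>s. x + s *\<^sub>R b) has_derivative (\<lambda>h. h *\<^sub>R b)) (at s within A)"
      by (auto intro!: derivative_eq_intros)
    from has_derivative_compose[OF this der]
    show ?thesis using linear_cmul[OF has_derivative_linear[OF der]] by (simp add: has_vector_derivative_def)
  qed
  have lip: "cmod (f (x + s *\<^sub>R b) - f x) \<le> M * s" if "s \<ge> 0" for x s
  proof -
    have "norm (f (x + s *\<^sub>R b) - f (x + 0 *\<^sub>R b)) \<le> M * norm (s - 0)"
    proof (rule differentiable_bound[of UNIV "\<lambda>s. f (x + s *\<^sub>R b)" "\<lambda>s h. h *\<^sub>R pd b f (x + s *\<^sub>R b)"])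
      show "((\<lambda>s. f (x + s *\<^sub>R b)) has_derivative (\<lambda>h. h *\<^sub>R pd b f (x + s *\<^sub>R b))) (at s)" for s
        using line[of x s UNIV] by (simp add: has_vector_derivative_def)
      show "onorm (\<lambda>h. h *\<^sub>R pd b f (x + s *\<^sub>R b)) \<le> M" for s
      proof (rule onorm_le)
        fix h :: real
        show "norm (h *\<^sub>R pd b f (x + s *\<^sub>R b)) \<le> M * norm h"
          using mult_left_mono[OF M(2)[of "x + s *\<^sub>R b"], of "\<bar>h\<bar>"] by (simp add: mult.commute)
      qed
    qed auto
    with that show ?thesis by simp
  qed
  have "(\<lambda>n. LINT x|lebesgue. (f (x + r n *\<^sub>R b) - f x) /\<^sub>R r n) \<longlonglongrightarrow> (LINT x|lebesgue. pd b f x)"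
  proof (rule integral_dominated_convergence[where w="\<lambda>x. M * indicator (cball 0 (R + 1)) x"])
    show "integrable lebesgue (\<lambda>x::'a. M * indicator (cball 0 (R + 1)) x)"
      using emeasure_bounded_finite[OF bounded_cball, of 0 "R + 1"]
      by (intro integrable_mult_right integrable_real_indicator) auto
    show "(pd b f) \<in> borel_measurable lebesgue" by (rule borel_measurable_lebesgueI[OF cp])
    show "(\<lambda>x. (f (x + r n *\<^sub>R b) - f x) /\<^sub>R r n) \<in> borel_measurable lebesgue" for n
      by (rule borel_measurable_lebesgueI)
         (auto intro!: continuous_intros continuous_on_compose2[OF cf])
    show "AE x in lebesgue. (\<lambda>n. (f (x + r n *\<^sub>R b) - f x) /\<^sub>R r n) \<longlonglongrightarrow> pd b f x"
    proof (rule AE_I2)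
      fix x
      have "((\<lambda>s. (f (x + s *\<^sub>R b) - f x) /\<^sub>R s) \<longlongrightarrow> pd b f x) (at 0)"
      proof -
        have lim: "((\<lambda>s. (1 / norm s) *\<^sub>R (f (x + s *\<^sub>R b) - (f x + s *\<^sub>R pd b f x))) \<longlongrightarrow> 0) (at 0)"
          using line[of x 0 UNIV] unfolding has_vector_derivative_def has_derivative_at2 by simp
        have "((\<lambda>s. (f (x + s *\<^sub>R b) - f x) /\<^sub>R s - pd b f x) \<longlongrightarrow> 0) (at 0)"
        proof (rule Lim_null_comparison[OF _ tendsto_norm_zero[OF lim]])
          have "norm ((f (x + s *\<^sub>R b) - f x) /\<^sub>R s - pd b f x)
              = norm ((1 / norm s) *\<^sub>R (f (x + s *\<^sub>R b) - (f x + s *\<^sub>R pd b f x)))" if "s \<noteq> 0" for s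
          proof -
            have "(f (x + s *\<^sub>R b) - f x) /\<^sub>R s - pd b f x = (f (x + s *\<^sub>R b) - (f x + s *\<^sub>R pd b f x)) /\<^sub>R s"
              using that by (simp add: scaleR_diff_right scaleR_add_right)
            then show ?thesis by (simp add: divide_inverse)
          qed
          then show "\<forall>\<^sub>F s in at 0. norm ((f (x + s *\<^sub>R b) - f x) /\<^sub>R s - pd b f x)
              \<le> norm ((1 / norm s) *\<^sub>R (f (x + s *\<^sub>R b) - (f x + s *\<^sub>R pd b f x)))"
            by (auto simp: eventually_at intro!: exI[of _ 1])
        qed
        then show ?thesis by (simp add: LIM_zero_iff)
      qed
      moreover have "filterlim r (at 0) sequentially"
        unfolding filterlim_at using LIMSEQ_inverse_real_of_nat r(1) by (auto simp: r_def[abs_def])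
      ultimately show "(\<lambda>n. (f (x + r n *\<^sub>R b) - f x) /\<^sub>R r n) \<longlonglongrightarrow> pd b f x"
        using filterlim_compose[of "\<lambda>s. (f (x + s *\<^sub>R b) - f x) /\<^sub>R s" "nhds (pd b f x)" "at 0" r sequentially] by simp
    qed
    show "AE x in lebesgue. norm ((f (x + r n *\<^sub>R b) - f x) /\<^sub>R r n) \<le> M * indicator (cball 0 (R + 1)) x" for n
    proof (rule AE_I2)
      fix x
      show "norm ((f (x + r n *\<^sub>R b) - f x) /\<^sub>R r n) \<le> M * indicator (cball 0 (R + 1)) x"
      proof (cases "norm x \<le> R + 1")
        case True
        have "cmod (f (x + r n *\<^sub>R b) - f x) / r n \<le> M"
          using lip[of "r n" x] r[of n] by (simp add: divide_le_eq)
        with True r[of n] show ?thesis by (simp add: divide_inverse mult.commute)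
      next
        case False
        have "norm x \<le> norm (x + r n *\<^sub>R b) + norm (r n *\<^sub>R b)"
          by (metis add_diff_cancel_right' norm_triangle_ineq4)
        also have "norm (r n *\<^sub>R b) \<le> 1" using r[of n] b by simp
        finally have "norm (x + r n *\<^sub>R b) > R" using False by linarith
        then have "f (x + r n *\<^sub>R b) = 0" "f x = 0" using R(1) R(2)[of x] R(2)[of "x + r n *\<^sub>R b"] False by force+
        then show ?thesis using M(1) by simp
      qed
    qed
  qed
  moreover have "(LINT x|lebesgue. (f (x + r n *\<^sub>R b) - f x) /\<^sub>R r n) = 0" for n
  proof -
    have m: "f \<in> borel_measurable lebesgue" using intf by auto
    have "integrable lebesgue (\<lambda>x. f (x + r n *\<^sub>R b))"
      using integral_lebesgue_affine(1)[of 1 f "r n *\<^sub>R b", OF _ m] intf by (simp add: add.commute)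
    then show ?thesis
      using integral_lebesgue_affine(2)[of 1 f "r n *\<^sub>R b", OF _ m] intf by (simp add: add.commute)
  qed
  ultimately have "(\<lambda>_. 0) \<longlonglongrightarrow> (LINT x|lebesgue. pd b f x)" by (simp only:)
  then show ?thesis by (simp only: LIMSEQ_const_iff)
qed

section \<open>Weak derivatives\<close>

lemma compact_of_closed_subset:
  fixes S :: "'a::t2_space set"
  assumes "closed S" "S \<subseteq> T" "compact T"
  shows "compact S"
  using compact_Int_closed[OF assms(3,1)] assms(2) by (simp add: Int_absorb1)

lemma pd_mult:
  assumes "f differentiable (at x)" "g differentiable (at x)"
  shows "pd b (\<lambda>x. f x * g x) x = f x * pd b g x + pd b f x * g x"
  using pd_eq[OF has_derivative_mult[OF assms[unfolded frechet_derivative_works]]] .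

lemma Ck1_continuous: "Ck 1 f \<Longrightarrow> continuous_on UNIV f"
  and Ck1_continuous_pd: "Ck 1 f \<Longrightarrow> b \<in> Basis \<Longrightarrow> continuous_on UNIV (pd b f)"
  using Ck_imp_continuous[of 1 f] by auto

lemma smooth_is_weak_deriv:
  assumes f: "Ck 1 f" and b: "b \<in> Basis"
  shows "is_weak_deriv b f (pd b f)"
  unfolding is_weak_deriv_def
proof
  fix \<phi> :: "'a \<Rightarrow> complex" assume \<phi>: "\<phi> \<in> test_functions"
  then have C: "Ck 1 \<phi>" "compact (closure {x. \<phi> x \<noteq> 0})" by (auto simp: test_functions_def)
  have cont: "continuous_on UNIV f" "continuous_on UNIV \<phi>" "continuous_on UNIV (pd b f)" "continuous_on UNIV (pd b \<phi>)"
    by (rule Ck1_continuous[OF f] Ck1_continuous[OF C(1)] Ck1_continuous_pd[OF f b] Ck1_continuous_pd[OF C(1) b])+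
  have comp: "compact (closure {x. u x * v x \<noteq> 0})"
    if "compact (closure {x. v x \<noteq> 0})" for u v :: "'a \<Rightarrow> complex"
  proof -
    have "closure {x. u x * v x \<noteq> 0} \<subseteq> closure {x. v x \<noteq> 0}" by (intro closure_mono) auto
    from compact_of_closed_subset[OF closed_closure this that] show ?thesis .
  qed
  have comp': "compact (closure {x. pd b \<phi> x \<noteq> 0})"
    by (rule compact_of_closed_subset[OF closed_closure pd_support C(2)])
  have "0 = (LINT x|lebesgue. pd b (\<lambda>x. f x * \<phi> x) x)"
    using integral_pd_eq_0[OF Ck_mult[OF f C(1)] comp[OF C(2)] b] by simp
  also have "\<dots> = (LINT x|lebesgue. f x * pd b \<phi> x + pd b f x * \<phi> x)"
    using f C(1) by (subst pd_mult) auto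
  also have "\<dots> = (LINT x|lebesgue. f x * pd b \<phi> x) + (LINT x|lebesgue. pd b f x * \<phi> x)"
    by (intro Bochner_Integration.integral_add integrable_continuous_compact_support comp C(2) comp')
       (auto intro!: continuous_intros cont)
  finally show "(LINT x|lebesgue. f x * pd b \<phi> x) = - (LINT x|lebesgue. pd b f x * \<phi> x)"
    by (simp add: eq_neg_iff_add_eq_0)
qed

lemma is_weak_deriv_cong_AE:
  assumes "AE x in lebesgue. f x = f' x" "AE x in lebesgue. g x = g' x"
    and m: "f \<in> borel_measurable lebesgue" "f' \<in> borel_measurable lebesgue"
       "g \<in> borel_measurable lebesgue" "g' \<in> borel_measurable lebesgue"
  shows "b \<in> Basis \<Longrightarrow> is_weak_deriv b f g \<longleftrightarrow> is_weak_deriv b f' g'"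
proof -
  assume b: "b \<in> Basis"
  have "(LINT x|lebesgue. f x * pd b \<phi> x) = (LINT x|lebesgue. f' x * pd b \<phi> x)"
    "(LINT x|lebesgue. g x * \<phi> x) = (LINT x|lebesgue. g' x * \<phi> x)" if "\<phi> \<in> test_functions" for \<phi>
  proof -
    have "Ck 1 \<phi>" using that unfolding test_functions_def by blast
    then have [measurable]: "pd b \<phi> \<in> borel_measurable lebesgue" "\<phi> \<in> borel_measurable lebesgue"
      by (intro borel_measurable_lebesgueI Ck1_continuous Ck1_continuous_pd b; assumption)+
    note [measurable] = m
    show "(LINT x|lebesgue. f x * pd b \<phi> x) = (LINT x|lebesgue. f' x * pd b \<phi> x)"
      by (rule integral_cong_AE) (use assms in auto)
    show "(LINT x|lebesgue. g x * \<phi> x) = (LINT x|lebesgue. g' x * \<phi> x)"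
      by (rule integral_cong_AE) (use assms in auto)
  qed
  then show ?thesis by (auto simp: is_weak_deriv_def)
qed

lemma test_function_L2: "\<phi> \<in> test_functions \<Longrightarrow> \<phi> \<in> L2"
  using Ck_imp_continuous by (auto simp: test_functions_def intro!: compact_support_L2)

text \<open>
  Uniqueness up to null sets makes the choice in \<open>weak_deriv\<close> harmless: any representative that is
  known explicitly may be used in its place.
\<close>

lemma is_weak_deriv_unique:
  assumes "is_weak_deriv b f g" "is_weak_deriv b f h" "g \<in> L2" "h \<in> L2"
  shows "AE x in lebesgue. g x = h x"
proof -
  have "AE x in lebesgue. g x + (-1) * h x = 0"
  proof (rule L2_AE_zero_of_test_functions)
    show "(\<lambda>x. g x + (-1) * h x) \<in> L2" by (intro L2_add L2_cmult assms)
    fix \<phi> :: "'a \<Rightarrow> complex" assume \<phi>: "\<phi> \<in> test_functions"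
    have "(LINT x|lebesgue. (g x + (-1) * h x) * \<phi> x) = (LINT x|lebesgue. g x * \<phi> x) - (LINT x|lebesgue. h x * \<phi> x)"
      using L2_mult_integrable[OF assms(3) test_function_L2[OF \<phi>]]
        L2_mult_integrable[OF assms(4) test_function_L2[OF \<phi>]]
      by (simp add: ring_distribs)
    also have "\<dots> = 0" using assms(1,2) \<phi> by (simp add: is_weak_deriv_def)
    finally show "(LINT x|lebesgue. (g x + (-1) * h x) * \<phi> x) = 0" .
  qed
  then show ?thesis by simp
qed

lemma weak_deriv_works:
  assumes "is_weak_deriv b f g" "g \<in> L2"
  shows "weak_deriv b f \<in> L2" "is_weak_deriv b f (weak_deriv b f)" "AE x in lebesgue. weak_deriv b f x = g x"
proof -
  have "weak_deriv b f \<in> L2 \<and> is_weak_deriv b f (weak_deriv b f)"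
    unfolding weak_deriv_def
    by (rule someI[where P="\<lambda>g. g \<in> L2 \<and> is_weak_deriv b f g"]) (use assms in blast)
  then show "weak_deriv b f \<in> L2" "is_weak_deriv b f (weak_deriv b f)" by auto
  then show "AE x in lebesgue. weak_deriv b f x = g x"
    using is_weak_deriv_unique assms by blast
qed

lemma Sobolev_L2: "f \<in> Sobolev k \<Longrightarrow> f \<in> L2"
  by (cases k) auto

text \<open>
  Membership in \<open>Sobolev 2\<close> provides some first derivatives that are again differentiable; by
  uniqueness the chosen derivatives inherit this, so \<open>laplacian\<close> is composed of genuine second weak
  derivatives.
\<close>

lemma Sobolev2_weak_deriv:
  assumes f: "f \<in> Sobolev 2" and b: "b \<in> Basis"
  shows "weak_deriv b f \<in> L2" "is_weak_deriv b f (weak_deriv b f)"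
    "weak_deriv b (weak_deriv b f) \<in> L2" "is_weak_deriv b (weak_deriv b f) (weak_deriv b (weak_deriv b f))"
proof -
  obtain g where g: "g \<in> Sobolev 1" "is_weak_deriv b f g"
    using f b by (auto simp: numeral_2_eq_2)
  obtain h where h: "h \<in> L2" "is_weak_deriv b g h"
    using g(1) b by auto
  have gL: "g \<in> L2" using Sobolev_L2[OF g(1)] .
  note w = weak_deriv_works[OF g(2) gL]
  show "weak_deriv b f \<in> L2" "is_weak_deriv b f (weak_deriv b f)" using w by auto
  have "is_weak_deriv b (weak_deriv b f) h"
    using is_weak_deriv_cong_AE[of "weak_deriv b f" g h h b] w(3) h(2) b L2_measurable w(1) gL h(1) by auto
  from weak_deriv_works[OF this h(1)]
  show "weak_deriv b (weak_deriv b f) \<in> L2" "is_weak_deriv b (weak_deriv b f) (weak_deriv b (weak_deriv b f))"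
    by auto
qed

lemma laplacian_L2: "f \<in> Sobolev 2 \<Longrightarrow> laplacian f \<in> L2"
  unfolding laplacian_def[abs_def] by (intro L2_sum Sobolev2_weak_deriv)

lemma shifted_laplacian_L2:
  assumes "f \<in> Sobolev 2"
  shows "(\<lambda>x. c * f x - laplacian f x) \<in> L2"
  using L2_add[OF L2_cmult[OF Sobolev_L2[OF assms]] L2_cmult[OF laplacian_L2[OF assms], of "- 1"]]
  by simp

text \<open>
  The integration by parts of the definition, extended from test functions to smooth functions that
  are square integrable with their derivative. A cutoff \<open>\<eta>(x / n)\<close> is inserted; its own derivative
  carries a factor \<open>1 / n\<close> and disappears in the limit.
\<close>

lemma weak_deriv_pairing:
  fixes f :: "'a::euclidean_space \<Rightarrow> complex"
  assumes w: "is_weak_deriv b f g" and fg: "f \<in> L2" "g \<in> L2" and b: "b \<in> Basis"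
    and \<phi>: "\<And>k. Ck k \<phi>" "\<phi> \<in> L2" "pd b \<phi> \<in> L2"
  shows "(LINT x|lebesgue. f x * pd b \<phi> x) = - (LINT x|lebesgue. g x * \<phi> x)"
proof -
  define \<eta> :: "'a \<Rightarrow> complex" where "\<eta> = box_bump 1 (- One) One"
  define r where "r n = inverse (real (Suc n))" for n
  define \<eta>' where "\<eta>' n x = \<eta> (r n *\<^sub>R x)" for n x
  have r: "0 < r n" "r n \<le> 1" for n by (auto simp: r_def field_simps)
  have r0: "r \<longlonglongrightarrow> 0" unfolding r_def[abs_def] by (rule LIMSEQ_inverse_real_of_nat)
  have \<eta>: "\<eta> \<in> test_functions" unfolding \<eta>_def by (rule box_bump_test_function) simp
  have Ck\<eta>: "Ck k \<eta>" for k unfolding \<eta>_def by (rule Ck_box_bump)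
  have c\<eta>: "continuous_on UNIV \<eta>" using Ck_imp_continuous[OF Ck\<eta>] .
  have cp\<eta>: "continuous_on UNIV (pd b \<eta>)" using Ck\<eta>[of 1] b by simp
  \<comment> \<open>The cutoff is not 1 at the origin; its value there is a common factor of both limits.\<close>
  have \<eta>0: "\<eta> 0 \<noteq> 0"
    by (auto simp: \<eta>_def box_bump_def bump1_def)
  have "compact (closure {x. pd b \<eta> x \<noteq> 0})"
    by (rule compact_of_closed_subset[OF closed_closure pd_support])
       (use \<eta> in \<open>simp add: test_functions_def\<close>)
  then obtain M where M: "M > 0" "\<And>x. cmod (pd b \<eta> x) \<le> M"
    using continuous_compact_support_bounded[OF cp\<eta>] by blast
  have \<eta>1: "cmod (\<eta> x) \<le> 1" for x unfolding \<eta>_def by (rule cmod_box_bump_le)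
  have Ck\<eta>': "Ck k (\<eta>' n)" for k n
    using Ck_affine[OF Ck\<eta>, of k "r n" 0] by (simp add: \<eta>'_def[abs_def])
  have test: "(\<lambda>x. \<eta>' n x * \<phi> x) \<in> test_functions" for n
  proof -
    have "{x. \<eta>' n x * \<phi> x \<noteq> 0} \<subseteq> cbox (- (One /\<^sub>R r n)) (One /\<^sub>R r n)"
    proof
      fix x assume "x \<in> {x. \<eta>' n x * \<phi> x \<noteq> 0}"
      then have "box_bump 1 (- One) One (r n *\<^sub>R x) \<noteq> 0" by (auto simp: \<eta>'_def \<eta>_def)
      then have "r n *\<^sub>R x \<in> box (- One) One" using box_bump_eq_0[of 1 "r n *\<^sub>R x" "- One" One] by auto
      then show "x \<in> cbox (- (One /\<^sub>R r n)) (One /\<^sub>R r n)"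
        using r(1)[of n] by (force simp: mem_box field_simps)
    qed
    then have "closure {x. \<eta>' n x * \<phi> x \<noteq> 0} \<subseteq> cbox (- (One /\<^sub>R r n)) (One /\<^sub>R r n)"
      by (intro closure_minimal) auto
    then have "compact (closure {x. \<eta>' n x * \<phi> x \<noteq> 0})"
      by (rule compact_of_closed_subset[OF closed_closure _ compact_cbox])
    then show ?thesis using Ck_mult[OF Ck\<eta>' \<phi>(1)] by (auto simp: test_functions_def)
  qed
  have pd': "pd b (\<lambda>x. \<eta>' n x * \<phi> x) x = \<eta>' n x * pd b \<phi> x + of_real (r n) * pd b \<eta> (r n *\<^sub>R x) * \<phi> x" for n x
  proof -
    have "pd b (\<eta>' n) x = of_real (r n) * pd b \<eta> (r n *\<^sub>R x)"
      using pd_affine[of \<eta> "r n" x 0 b] Ck\<eta>[of 1] by (simp add: \<eta>'_def[abs_def] scaleR_conv_of_real)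
    moreover have "\<eta>' n differentiable (at x)" "\<phi> differentiable (at x)"
      using Ck\<eta>'[of 1 n] \<phi>(1)[of 1] by auto
    ultimately show ?thesis by (simp add: pd_mult)
  qed
  have \<eta>'0: "(\<lambda>n. \<eta>' n x) \<longlonglongrightarrow> \<eta> 0" for x
  proof -
    have "(\<lambda>n. r n *\<^sub>R x) \<longlonglongrightarrow> 0 *\<^sub>R x" by (intro tendsto_intros r0)
    moreover have "isCont \<eta> (0 *\<^sub>R x)" using c\<eta> by (simp add: continuous_on_eq_continuous_at)
    ultimately show ?thesis unfolding \<eta>'_def using isCont_tendsto_compose by fastforce
  qed
  note [measurable] = L2_measurable[OF fg(1)] L2_measurable[OF fg(2)] L2_measurable[OF \<phi>(2)] L2_measurable[OF \<phi>(3)]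
  have [measurable]: "\<eta>' n \<in> borel_measurable lebesgue" for n
    using Ck_imp_continuous[OF Ck\<eta>'] by (rule borel_measurable_lebesgueI)
  have [measurable]: "(\<lambda>x. pd b \<eta> (r n *\<^sub>R x)) \<in> borel_measurable lebesgue" for n
    by (intro borel_measurable_lebesgueI continuous_on_compose2[OF cp\<eta>]) (auto intro!: continuous_intros)
  have A: "(\<lambda>n. LINT x|lebesgue. f x * pd b (\<lambda>x. \<eta>' n x * \<phi> x) x) \<longlonglongrightarrow> (LINT x|lebesgue. f x * (\<eta> 0 * pd b \<phi> x))"
  proof (rule integral_dominated_convergence[where w="\<lambda>x. norm (f x * pd b \<phi> x) + M * norm (f x * \<phi> x)"])
    show "integrable lebesgue (\<lambda>x. norm (f x * pd b \<phi> x) + M * norm (f x * \<phi> x))"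
      by (intro Bochner_Integration.integrable_add integrable_mult_right integrable_norm L2_mult_integrable fg \<phi>)
    show "(\<lambda>x. f x * (\<eta> 0 * pd b \<phi> x)) \<in> borel_measurable lebesgue" by measurable
    show "(\<lambda>x. f x * pd b (\<lambda>x. \<eta>' n x * \<phi> x) x) \<in> borel_measurable lebesgue" for n
      unfolding pd' by measurable
    have "(\<lambda>n. of_real (r n) * pd b \<eta> (r n *\<^sub>R x)) \<longlonglongrightarrow> 0" for x
    proof (rule Lim_null_comparison)
      show "(\<lambda>n. r n * M) \<longlonglongrightarrow> 0" using tendsto_mult[OF r0 tendsto_const[of M]] by simp
      show "\<forall>\<^sub>F n in sequentially. cmod (of_real (r n) * pd b \<eta> (r n *\<^sub>R x)) \<le> r n * M"
        using M(2) less_imp_le[OF r(1)] by (intro always_eventually) (simp add: norm_mult mult_left_mono)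
    qed
    then have "(\<lambda>n. f x * (\<eta>' n x * pd b \<phi> x + of_real (r n) * pd b \<eta> (r n *\<^sub>R x) * \<phi> x)) \<longlonglongrightarrow>
      f x * (\<eta> 0 * pd b \<phi> x + 0 * \<phi> x)" for x
      by (intro tendsto_intros \<eta>'0)
    then show "AE x in lebesgue. (\<lambda>n. f x * pd b (\<lambda>x. \<eta>' n x * \<phi> x) x) \<longlonglongrightarrow> f x * (\<eta> 0 * pd b \<phi> x)"
      unfolding pd' by simp
    have "norm (f x * (\<eta>' n x * pd b \<phi> x + of_real (r n) * pd b \<eta> (r n *\<^sub>R x) * \<phi> x))
      \<le> norm (f x * pd b \<phi> x) + M * norm (f x * \<phi> x)" for x n
    proof -
      have "cmod (\<eta>' n x * pd b \<phi> x) \<le> cmod (pd b \<phi> x)"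
        using \<eta>1 by (auto simp: norm_mult \<eta>'_def mult_left_le_one_le)
      moreover have "cmod (of_real (r n) * pd b \<eta> (r n *\<^sub>R x) * \<phi> x) \<le> M * cmod (\<phi> x)"
      proof -
        have "r n * cmod (pd b \<eta> (r n *\<^sub>R x)) \<le> 1 * M" using M r[of n] by (intro mult_mono) auto
        then show ?thesis using r(1)[of n] by (auto simp: norm_mult intro!: mult_right_mono)
      qed
      ultimately have "cmod (\<eta>' n x * pd b \<phi> x + of_real (r n) * pd b \<eta> (r n *\<^sub>R x) * \<phi> x)
         \<le> cmod (pd b \<phi> x) + M * cmod (\<phi> x)"
        using norm_triangle_le by (metis add_mono)
      from mult_left_mono[OF this norm_ge_zero[of "f x"]]
      have "norm (f x * (\<eta>' n x * pd b \<phi> x + of_real (r n) * pd b \<eta> (r n *\<^sub>R x) * \<phi> x))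
         \<le> cmod (f x) * (cmod (pd b \<phi> x) + M * cmod (\<phi> x))" by (simp only: norm_mult[of "f x"])
      also have "\<dots> = norm (f x * pd b \<phi> x) + M * norm (f x * \<phi> x)"
        by (simp add: norm_mult algebra_simps)
      finally show ?thesis .
    qed
    then show "AE x in lebesgue. norm (f x * pd b (\<lambda>x. \<eta>' n x * \<phi> x) x)
      \<le> norm (f x * pd b \<phi> x) + M * norm (f x * \<phi> x)" for n
      unfolding pd' by simp
  qed
  have B: "(\<lambda>n. LINT x|lebesgue. g x * (\<eta>' n x * \<phi> x)) \<longlonglongrightarrow> (LINT x|lebesgue. g x * (\<eta> 0 * \<phi> x))"
  proof (rule integral_dominated_convergence[where w="\<lambda>x. norm (g x * \<phi> x)"])
    show "integrable lebesgue (\<lambda>x. norm (g x * \<phi> x))" by (intro integrable_norm L2_mult_integrable fg \<phi>)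
    show "AE x in lebesgue. (\<lambda>n. g x * (\<eta>' n x * \<phi> x)) \<longlonglongrightarrow> g x * (\<eta> 0 * \<phi> x)"
      by (intro AE_I2 tendsto_intros \<eta>'0)
    show "AE x in lebesgue. norm (g x * (\<eta>' n x * \<phi> x)) \<le> norm (g x * \<phi> x)" for n
      using \<eta>1 by (auto simp: norm_mult \<eta>'_def intro!: mult_left_mono mult_left_le_one_le)
  qed measurable
  have "(LINT x|lebesgue. f x * pd b (\<lambda>x. \<eta>' n x * \<phi> x) x) = - (LINT x|lebesgue. g x * (\<eta>' n x * \<phi> x))" for n
    using w test[of n] unfolding is_weak_deriv_def by blast
  then have "(LINT x|lebesgue. f x * (\<eta> 0 * pd b \<phi> x)) = - (LINT x|lebesgue. g x * (\<eta> 0 * \<phi> x))"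
    using LIMSEQ_unique[OF A] tendsto_minus[OF B] by simp
  then have "\<eta> 0 * (LINT x|lebesgue. f x * pd b \<phi> x) = \<eta> 0 * - (LINT x|lebesgue. g x * \<phi> x)"
    by (simp add: mult.left_commute)
  with \<eta>0 show ?thesis by (simp only: mult_cancel_left) simp
qed

section \<open>Radial integrals in three dimensions\<close>

lemma emeasure_cball3:
  assumes "r \<ge> 0"
  shows "emeasure lborel (cball (0 :: real^3) r) = ennreal (unit_ball_vol 3 * r ^ 3)"
  using emeasure_cball[OF assms, of "0 :: real^3"] by simp

text \<open>
  Polar coordinates for radial functions: the image of Lebesgue measure under the norm has density
  proportional to \<open>r\<^sup>2\<close>, as the volume of a ball shows.
\<close>

lemma distr_norm3:
  "distr lborel borel (norm :: real^3 \<Rightarrow> real) =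
    density lborel (\<lambda>r. ennreal (3 * unit_ball_vol 3 * r\<^sup>2) * indicator {0..} r)" (is "?M = ?N")
proof (rule measure_eqI_generator_eq[where E="range atMost" and \<Omega>=UNIV and A="\<lambda>i. {..real i}"])
  show "Int_stable (range (atMost :: real \<Rightarrow> _))"
    by (auto simp: Int_stable_def intro!: range_eqI[of _ _ "min _ _"])
  show "sets ?M = sigma_sets UNIV (range atMost)" "sets ?N = sigma_sets UNIV (range atMost)"
    by (simp_all add: borel_eq_atMost sets_measure_of_conv full_SetCompr_eq[symmetric])
  show "(\<Union>i. {..real i}) = UNIV" using real_arch_simple by auto
  have M: "emeasure ?M {..r} = (if r < 0 then 0 else ennreal (unit_ball_vol 3 * r ^ 3))" for r
  proof -
    have "emeasure ?M {..r} = emeasure lborel {x :: real^3. norm x \<le> r}"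
      by (subst emeasure_distr) (auto simp: vimage_def)
    also have "{x :: real^3. norm x \<le> r} = cball 0 r" by auto
    finally show ?thesis using emeasure_cball3[of r] by (auto simp: cball_empty)
  qed
  then show "emeasure ?M {..real i} \<noteq> \<infinity>" for i by auto
  fix X :: "real set" assume "X \<in> range atMost"
  then obtain r where X: "X = {..r}" by auto
  show "emeasure ?M X = emeasure ?N X"
  proof (cases "r < 0")
    case True
    have "emeasure ?N X = (\<integral>\<^sup>+t. ennreal (3 * unit_ball_vol 3 * t\<^sup>2) * indicator {0..} t * indicator {..r} t \<partial>lborel)"
      unfolding X by (subst emeasure_density) auto
    also have "\<dots> = (\<integral>\<^sup>+(t::real). 0 \<partial>lborel)"
      using True by (intro nn_integral_cong) (auto simp: indicator_def)
    finally show ?thesis using True M[of r] X by simp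
  next
    case False
    have "emeasure ?N X = (\<integral>\<^sup>+t. ennreal (3 * unit_ball_vol 3 * t\<^sup>2) * indicator {0..} t * indicator {..r} t \<partial>lborel)"
      unfolding X by (subst emeasure_density) auto
    also have "\<dots> = (\<integral>\<^sup>+t. ennreal (3 * unit_ball_vol 3 * t\<^sup>2) * indicator {0..r} t \<partial>lborel)"
      by (intro nn_integral_cong) (auto simp: indicator_def)
    also have "\<dots> = ennreal (unit_ball_vol 3 * r ^ 3 - unit_ball_vol 3 * 0 ^ 3)"
      using False by (intro nn_integral_FTC_Icc) (auto intro!: derivative_eq_intros)
    finally show ?thesis using False M[of r] X by simp
  qed
qed auto

text \<open>
  The one integrability statement from which all others are derived: \<open>r\<^sup>-\<^sup>2\<close> at the origin and
  \<open>r\<^sup>-\<^sup>4\<close> at infinity are integrable in dimension three.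
\<close>

lemma integrable_inverse_sq_decay:
  "integrable lborel (\<lambda>x::real^3. 1 / ((norm x)\<^sup>2 * (1 + norm x)\<^sup>2))"
proof (rule integrableI_nonneg)
  let ?g = "\<lambda>r::real. 1 / (r\<^sup>2 * (1 + r)\<^sup>2)"
  have "(\<integral>\<^sup>+ x. ennreal (?g (norm (x::real^3))) \<partial>lborel) = (\<integral>\<^sup>+ r. ennreal (?g r) \<partial>distr lborel borel (norm :: real^3 \<Rightarrow> real))"
    by (subst nn_integral_distr) auto
  also have "\<dots> = (\<integral>\<^sup>+ r. (ennreal (3 * unit_ball_vol 3 * r\<^sup>2) * indicator {0..} r) * ennreal (?g r) \<partial>lborel)"
    unfolding distr_norm3 by (subst nn_integral_density) auto
  also have "\<dots> \<le> (\<integral>\<^sup>+ r. ennreal (3 * unit_ball_vol 3 * (1 / (1 + r)\<^sup>2)) * indicator {0..} r \<partial>lborel)"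
  proof (rule nn_integral_mono)
    fix r :: real
    have "3 * unit_ball_vol 3 * r\<^sup>2 * ?g r \<le> 3 * unit_ball_vol 3 * (1 / (1 + r)\<^sup>2)" if "r \<ge> 0"
      using that by (cases "r = 0") auto
    then show "(ennreal (3 * unit_ball_vol 3 * r\<^sup>2) * indicator {0..} r) * ennreal (?g r)
      \<le> ennreal (3 * unit_ball_vol 3 * (1 / (1 + r)\<^sup>2)) * indicator {0..} r"
      by (auto simp: indicator_def ennreal_mult[symmetric] simp del: ennreal_mult'')
  qed
  also have "\<dots> = ennreal (0 - (- (3 * unit_ball_vol 3) / (1 + 0)))"
  proof (rule nn_integral_FTC_atLeast)
    show "((\<lambda>r. - (3 * unit_ball_vol 3) / (1 + r)) \<longlongrightarrow> 0) at_top"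
      by (intro tendsto_divide_0[OF tendsto_const] filterlim_at_top_imp_at_infinity
          filterlim_tendsto_add_at_top[OF tendsto_const] filterlim_ident)
    show "((\<lambda>r. - (3 * unit_ball_vol 3) / (1 + r)) has_real_derivative 3 * unit_ball_vol 3 * (1 / (1 + r)\<^sup>2)) (at r)"
      if "0 \<le> r" for r
      using that by (auto intro!: derivative_eq_intros simp: power2_eq_square field_simps)
  qed auto
  finally show "(\<integral>\<^sup>+ x. ennreal (?g (norm (x::real^3))) \<partial>lborel) < \<infinity>"
    using le_less_trans ennreal_less_top by fastforce
qed auto

text \<open>The smooth substitute for the norm that regularises all kernels below.\<close>

definition rad :: "real \<Rightarrow> real^3 \<Rightarrow> real" where
  "rad d v = sqrt ((norm v)\<^sup>2 + d\<^sup>2)"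

lemma rad_ge: "norm v \<le> rad d v" "d > 0 \<Longrightarrow> d \<le> rad d v"
  by (auto simp: rad_def intro!: real_le_rsqrt)

lemma rad_pos: "d > 0 \<Longrightarrow> rad d v > 0"
  using rad_ge(2)[of d v] by linarith

lemma rad_ne_0: "d > 0 \<Longrightarrow> rad d v \<noteq> 0"
  using rad_pos[of d v] by linarith

lemma rad_sq: "(rad d v)\<^sup>2 = (norm v)\<^sup>2 + d\<^sup>2"
  by (simp add: rad_def)

lemma rad_mono: "0 < d \<Longrightarrow> d \<le> e \<Longrightarrow> rad d v \<le> rad e v"
  by (simp add: rad_def power_mono)

lemma rad_minus: "rad d (- v) = rad d v" "rad d (x - y) = rad d (y - x)"
  by (simp_all add: rad_def norm_minus_commute)

lemma rad_scale: "d > 0 \<Longrightarrow> rad d (d *\<^sub>R u) = d * rad 1 u"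
  by (simp add: rad_def power_mult_distrib distrib_left[symmetric] real_sqrt_mult
      flip: ring_distribs(1)[of "d\<^sup>2" _ 1, simplified])

lemma continuous_rad [continuous_intros]: "continuous_on A f \<Longrightarrow> continuous_on A (\<lambda>x. rad d (f x))"
  unfolding rad_def by (intro continuous_intros)

lemma integrable_of_decay:
  fixes f :: "real^3 \<Rightarrow> 'b::{banach, second_countable_topology}"
  assumes "d > 0" and m: "f \<in> borel_measurable lebesgue" and b: "\<And>v. norm (f v) \<le> C / (rad d v) ^ 4"
  shows "integrable lebesgue f"
proof (rule Bochner_Integration.integrable_bound)
  show "integrable lebesgue (\<lambda>x::real^3. \<bar>C\<bar> * (1 + 1 / d)\<^sup>2 * (1 / ((norm x)\<^sup>2 * (1 + norm x)\<^sup>2)))"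
    using integrable_inverse_sq_decay by (intro integrable_mult_right) (simp add: integrable_completion)
  have "norm (f v) \<le> \<bar>C\<bar> * (1 + 1 / d)\<^sup>2 * (1 / ((norm v)\<^sup>2 * (1 + norm v)\<^sup>2))" if "v \<noteq> 0" for v
  proof -
    have s: "rad d v > 0" "norm v \<le> rad d v" "d \<le> rad d v" using rad_pos rad_ge assms(1) by auto
    have "1 + norm v \<le> rad d v / d + rad d v"
      using s assms(1) by (intro add_mono) (auto simp: field_simps)
    also have "\<dots> = (1 + 1 / d) * rad d v" by (simp add: algebra_simps)
    finally have "norm v * (1 + norm v) \<le> rad d v * ((1 + 1 / d) * rad d v)"
      using s by (intro mult_mono) auto
    then have "(norm v * (1 + norm v))\<^sup>2 \<le> (rad d v * ((1 + 1 / d) * rad d v))\<^sup>2"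
      by (intro power_mono) auto
    then have "(norm v)\<^sup>2 * (1 + norm v)\<^sup>2 \<le> (1 + 1/d)\<^sup>2 * rad d v ^ 4"
      by (simp add: power_mult_distrib power2_eq_square power4_eq_xxxx mult_ac)
    moreover have "0 < (norm v)\<^sup>2 * (1 + norm v)\<^sup>2" using that
      by (intro mult_pos_pos zero_less_power) (auto simp: add_pos_nonneg)
    ultimately have "1 / (rad d v) ^ 4 \<le> (1 + 1/d)\<^sup>2 * (1 / ((norm v)\<^sup>2 * (1 + norm v)\<^sup>2))"
      using s(1) by (simp add: divide_le_eq le_divide_eq mult_ac)
    from mult_left_mono[OF this, of "\<bar>C\<bar>"]
    have "\<bar>C\<bar> / (rad d v) ^ 4 \<le> \<bar>C\<bar> * (1 + 1/d)\<^sup>2 * (1 / ((norm v)\<^sup>2 * (1 + norm v)\<^sup>2))" by (simp add: mult_ac)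
    moreover have "C / (rad d v) ^ 4 \<le> \<bar>C\<bar> / (rad d v) ^ 4" using s by (intro divide_right_mono) auto
    ultimately show ?thesis using b[of v] by linarith
  qed
  moreover have "AE v in lebesgue. v \<noteq> (0::real^3)"
    by (rule AE_I'[of "{0}"]) auto
  ultimately show "AE v in lebesgue. norm (f v) \<le> norm (\<bar>C\<bar> * (1 + 1 / d)\<^sup>2 * (1 / ((norm v)\<^sup>2 * (1 + norm v)\<^sup>2)))"
    by (auto elim!: eventually_mono)
qed (use m in auto)

text \<open>
  The value is \<open>4 \<pi>\<close>. It normalises all kernels alike and cancels from every estimate, which is why it stays
  an abstract positive number.
\<close>

definition mass :: real where
  "mass = (LINT u|lebesgue. 3 / (rad 1 u) ^ 5)"

lemma integrable_profile: "integrable lebesgue (\<lambda>u. 3 / (rad 1 u) ^ 5)"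
proof (rule integrable_of_decay[of 1])
  show "norm (3 / (rad 1 v) ^ 5) \<le> 3 / (rad 1 v) ^ 4" for v
  proof -
    have "1 \<le> rad 1 v" by (rule rad_ge) simp
    then show ?thesis by (auto intro!: divide_left_mono power_increasing mult_pos_pos zero_less_power)
  qed
  show "(\<lambda>u. 3 / (rad 1 u) ^ 5) \<in> borel_measurable lebesgue"
    by (intro borel_measurable_lebesgueI continuous_intros ballI) (simp add: rad_ne_0)
qed simp

lemma mass_pos: "mass > 0"
proof -
  have p: "3 / (rad 1 u) ^ 5 > 0" for u using rad_pos[of 1 u] by simp
  have "mass \<noteq> 0"
  proof
    assume "mass = 0"
    moreover have "AE u in lebesgue. 0 \<le> 3 / (rad 1 u) ^ 5"
      by (rule AE_I2) (rule less_imp_le[OF p])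
    ultimately have "AE u in lebesgue. 3 / (rad 1 u) ^ 5 = 0"
      unfolding mass_def using integral_nonneg_eq_0_iff_AE[OF integrable_profile] by blast
    then have "AE u in (lebesgue :: (real^3) measure). False"
      by (rule AE_mp) (intro AE_I2 impI, metis p less_irrefl)
    then have "ae_filter (lebesgue :: (real^3) measure) = bot" by (simp add: trivial_limit_def)
    then show False unfolding ae_filter_eq_bot_iff by simp
  qed
  moreover have "mass \<ge> 0" unfolding mass_def using p by (intro integral_nonneg_AE) (auto simp: less_imp_le)
  ultimately show ?thesis by simp
qed

section \<open>Smooth functions in the second Sobolev space\<close>

text \<open>
  The class of smooth functions for which all derivatives entering \<open>laplacian\<close> may be taken
  classically.
\<close>

definition smooth_H2 :: "('a::euclidean_space \<Rightarrow> complex) \<Rightarrow> bool" where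
  "smooth_H2 \<phi> \<longleftrightarrow> (\<forall>k. Ck k \<phi>) \<and> \<phi> \<in> L2 \<and> (\<forall>b\<in>Basis. pd b \<phi> \<in> L2) \<and>
     (\<forall>b\<in>Basis. \<forall>c\<in>Basis. pd c (pd b \<phi>) \<in> L2)"

lemma smooth_H2_Ck: "smooth_H2 \<phi> \<Longrightarrow> Ck k \<phi>"
  and smooth_H2_Ck_pd: "smooth_H2 \<phi> \<Longrightarrow> b \<in> Basis \<Longrightarrow> Ck k (pd b \<phi>)"
  by (auto simp: smooth_H2_def) (metis Ck.simps(2))

lemma smooth_H2_L2:
  assumes "smooth_H2 \<phi>"
  shows "\<phi> \<in> L2" "b \<in> Basis \<Longrightarrow> pd b \<phi> \<in> L2"
    "b \<in> Basis \<Longrightarrow> c \<in> Basis \<Longrightarrow> pd c (pd b \<phi>) \<in> L2"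
  using assms by (auto simp: smooth_H2_def)

lemma smooth_H2_Sobolev: "smooth_H2 \<phi> \<Longrightarrow> \<phi> \<in> Sobolev 2"
  using smooth_H2_L2[of \<phi>] smooth_is_weak_deriv[OF smooth_H2_Ck[of \<phi> 1]]
    smooth_is_weak_deriv[OF smooth_H2_Ck_pd[of \<phi> _ 1]]
  by (auto simp: numeral_2_eq_2) blast

lemma smooth_H2_laplacian:
  assumes \<phi>: "smooth_H2 \<phi>"
  shows "AE x in lebesgue. laplacian \<phi> x = (\<Sum>b\<in>Basis. pd b (pd b \<phi>) x)"
proof -
  have "AE x in lebesgue. weak_deriv b (weak_deriv b \<phi>) x = pd b (pd b \<phi>) x" if b: "b \<in> Basis" for b
  proof -
    note S = Sobolev2_weak_deriv[OF smooth_H2_Sobolev[OF \<phi>] b]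
    note L = smooth_H2_L2(2)[OF \<phi> b] smooth_H2_L2(3)[OF \<phi> b b]
    have "AE x in lebesgue. weak_deriv b \<phi> x = pd b \<phi> x"
      using weak_deriv_works(3)[OF smooth_is_weak_deriv[OF smooth_H2_Ck[OF \<phi>] b] L(1)] .
    then have "is_weak_deriv b (pd b \<phi>) (weak_deriv b (weak_deriv b \<phi>))"
      using is_weak_deriv_cong_AE[of "weak_deriv b \<phi>" "pd b \<phi>" "weak_deriv b (weak_deriv b \<phi>)" "weak_deriv b (weak_deriv b \<phi>)" b]
        S b L L2_measurable by auto
    then show ?thesis
      using is_weak_deriv_unique[OF _ smooth_is_weak_deriv[OF smooth_H2_Ck_pd[OF \<phi> b] b]] S L by blast
  qed
  then have "AE x in lebesgue. \<forall>b\<in>Basis. weak_deriv b (weak_deriv b \<phi>) x = pd b (pd b \<phi>) x"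
    by (simp add: AE_finite_all)
  then show ?thesis by eventually_elim (simp add: laplacian_def)
qed

text \<open>
  Green's second identity with one merely weakly differentiable factor; the smoothness of the other
  factor pays for both integrations by parts.
\<close>

lemma laplacian_pairing:
  assumes \<psi>: "\<psi> \<in> Sobolev 2" and \<phi>: "smooth_H2 \<phi>"
  shows "(LINT x|lebesgue. \<psi> x * (\<Sum>b\<in>Basis. pd b (pd b \<phi>) x)) = (LINT x|lebesgue. laplacian \<psi> x * \<phi> x)"
proof -
  note S = Sobolev2_weak_deriv[OF \<psi>] and P = Sobolev_L2[OF \<psi>] and L = smooth_H2_L2[OF \<phi>]
  have "(LINT x|lebesgue. \<psi> x * pd b (pd b \<phi>) x) = (LINT x|lebesgue. weak_deriv b (weak_deriv b \<psi>) x * \<phi> x)"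
    if b: "b \<in> Basis" for b
    using weak_deriv_pairing[OF S(2)[OF b] P S(1)[OF b] b smooth_H2_Ck_pd[OF \<phi> b] L(2)[OF b] L(3)[OF b b]]
      weak_deriv_pairing[OF S(4)[OF b] S(1)[OF b] S(3)[OF b] b smooth_H2_Ck[OF \<phi>] L(1) L(2)[OF b]]
    by simp
  then show ?thesis
    unfolding laplacian_def sum_distrib_left sum_distrib_right
    by (subst (1 2) Bochner_Integration.integral_sum) (auto intro!: L2_mult_integrable P S L)
qed

section \<open>Regularised resolvent kernels\<close>

text \<open>
  The functions \<open>exp (- \<zeta> s) / s\<^sup>m\<close> of the regularised radius \<open>s\<close>. A derivative in direction \<open>h\<close> is
  \<open>- (v \<bullet> h)\<close> times a combination of the members with indices \<open>m + 1\<close> and \<open>m + 2\<close>, because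
  \<open>s\<close> has derivative \<open>(v \<bullet> h) / s\<close>. Smoothness and all explicit derivatives follow from this single rule.
\<close>

definition expk :: "complex \<Rightarrow> real \<Rightarrow> nat \<Rightarrow> real^3 \<Rightarrow> complex" where
  "expk \<zeta> d m v = exp (- \<zeta> * of_real (rad d v)) / of_real (rad d v) ^ m"

lemma rad_has_derivative:
  assumes "d > 0"
  shows "(rad d has_derivative (\<lambda>h. (v \<bullet> h) / rad d v)) (at v)"
proof -
  have "((\<lambda>v. sqrt (v \<bullet> v + d\<^sup>2)) has_derivative (\<lambda>h. (v \<bullet> h) / sqrt (v \<bullet> v + d\<^sup>2))) (at v)"
    using assms
    by (auto intro!: derivative_eq_intros simp: add_nonneg_pos inner_commute field_simps)
  then show ?thesis by (simp add: rad_def[abs_def] dot_square_norm)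
qed

lemma expk_has_derivative:
  assumes "d > 0"
  shows "(expk \<zeta> d m has_derivative
    (\<lambda>h. - of_real (v \<bullet> h) * (\<zeta> * expk \<zeta> d (m + 1) v + of_nat m * expk \<zeta> d (m + 2) v))) (at v)"
proof -
  let ?f = "\<lambda>s::complex. exp (- \<zeta> * s) * inverse s ^ m"
  have s: "rad d v > 0" using rad_pos[OF assms] .
  have D: "(?f has_field_derivative (- \<zeta> * ?f s - of_nat m * (?f s * inverse s))) (at s)" if "s \<noteq> 0" for s
  proof -
    have I0: "(inverse has_field_derivative - (inverse s * inverse s)) (at s)"
      using DERIV_inverse[OF that, of UNIV] by (simp add: power2_eq_square)
    have I: "((\<lambda>s. inverse s ^ m) has_field_derivative (- of_nat m * (inverse s ^ m * inverse s))) (at s)"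
    proof (induction m)
      case (Suc m)
      have "((\<lambda>s. inverse s * inverse s ^ m) has_field_derivative
        (- (inverse s * inverse s)) * inverse s ^ m + (- of_nat m * (inverse s ^ m * inverse s)) * inverse s) (at s)"
        by (rule DERIV_mult[OF I0 Suc])
      then show ?case by (simp add: algebra_simps)
    qed simp
    have "((\<lambda>s. exp (- \<zeta> * s)) has_field_derivative (exp (- \<zeta> * s) * - \<zeta>)) (at s)"
      by (auto intro!: derivative_eq_intros)
    from DERIV_mult[OF this I] show ?thesis by (simp add: algebra_simps)
  qed
  have "((\<lambda>v. of_real (rad d v) :: complex) has_derivative (\<lambda>h. of_real ((v \<bullet> h) / rad d v))) (at v)"
    using rad_has_derivative[OF assms] by (rule has_derivative_of_real)
  from has_derivative_compose[OF this D[unfolded has_field_derivative_def]] s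
  have "((\<lambda>v. ?f (of_real (rad d v))) has_derivative
    (\<lambda>h. (- \<zeta> * ?f (of_real (rad d v)) - of_nat m * (?f (of_real (rad d v)) * inverse (of_real (rad d v)))) * of_real ((v \<bullet> h) / rad d v))) (at v)"
    by simp
  moreover have "(\<lambda>v. ?f (of_real (rad d v))) = expk \<zeta> d m"
    by (auto simp: expk_def divide_inverse power_inverse)
  moreover have "(- \<zeta> * ?f (of_real (rad d v)) - of_nat m * (?f (of_real (rad d v)) * inverse (of_real (rad d v)))) * of_real ((v \<bullet> h) / rad d v)
    = - of_real (v \<bullet> h) * (\<zeta> * expk \<zeta> d (m + 1) v + of_nat m * expk \<zeta> d (m + 2) v)" for h
    using s by (simp add: expk_def field_simps power_inverse)
  ultimately show ?thesis by simp
qed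

lemma Ck_expk: "d > 0 \<Longrightarrow> Ck k (expk \<zeta> d m)"
proof (induction k arbitrary: m)
  case 0
  show ?case using has_derivative_continuous[OF expk_has_derivative[OF 0]]
    by (simp add: continuous_at_imp_continuous_on)
next
  case (Suc k)
  show ?case
  proof (rule Ck_SucI[OF expk_has_derivative[OF Suc.prems]])
    fix b :: "real^3"
    have "Ck k (\<lambda>v. (- 1) * of_real (v \<bullet> b) * (\<zeta> * expk \<zeta> d (m + 1) v + of_nat m * expk \<zeta> d (m + 2) v))"
      by (intro Ck_mult Ck_add Ck_const Ck_inner Suc)
    then show "Ck k (\<lambda>v. - of_real (v \<bullet> b) * (\<zeta> * expk \<zeta> d (m + 1) v + of_nat m * expk \<zeta> d (m + 2) v))"
      by simp
  qed
qed

lemma cmod_expk: "d > 0 \<Longrightarrow> cmod (expk \<zeta> d m v) = exp (- Re \<zeta> * rad d v) / rad d v ^ m"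
  using rad_pos[of d v] by (simp add: expk_def norm_divide norm_power)

text \<open>
  Trades exponential decay for polynomial decay of any order.
\<close>

lemma exp_minus_le_inverse_power:
  assumes "x > (0::real)" "k > 0"
  shows "exp (- x) \<le> (of_nat k / x) ^ k"
proof -
  have "x / of_nat k \<le> exp (x / of_nat k)" using exp_ge_add_one_self[of "x / of_nat k"] by linarith
  then have "(x / of_nat k) ^ k \<le> exp (x / of_nat k) ^ k" using assms by (intro power_mono) auto
  also have "\<dots> = exp x" using assms by (simp add: exp_of_nat_mult[symmetric])
  finally have "inverse (exp x) \<le> inverse ((x / of_nat k) ^ k)" using assms by (intro le_imp_inverse_le) auto
  then show ?thesis by (simp add: exp_minus power_inverse[symmetric])
qed

lemma expk_decay:
  assumes "d > 0" "Re \<zeta> > 0" "n \<le> m + k" "k > 0"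
  shows "cmod (expk \<zeta> d m v) \<le> ((real k / Re \<zeta>) ^ k / d ^ (m + k - n)) / rad d v ^ n"
proof -
  let ?s = "rad d v"
  have s: "?s > 0" "d \<le> ?s" using rad_pos rad_ge assms by auto
  have "cmod (expk \<zeta> d m v) \<le> (real k / (Re \<zeta> * ?s)) ^ k / ?s ^ m"
    using exp_minus_le_inverse_power[of "Re \<zeta> * ?s" k] s assms
    by (simp add: cmod_expk divide_right_mono)
  also have "\<dots> = (real k / Re \<zeta>) ^ k / ?s ^ (m + k)"
    by (simp add: power_divide power_mult_distrib power_add)
  also have "\<dots> = (real k / Re \<zeta>) ^ k / (?s ^ (m + k - n) * ?s ^ n)"
    using assms(3) by (simp add: power_add[symmetric])
  also have "\<dots> \<le> (real k / Re \<zeta>) ^ k / (d ^ (m + k - n) * ?s ^ n)"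
    using s assms by (intro divide_left_mono mult_right_mono power_mono mult_pos_pos zero_less_power) auto
  finally show ?thesis by simp
qed

text \<open>
  The exponent \<open>4\<close> makes the functions integrable and square integrable in dimension three and is
  the rate in the uniform bound on the mollifiers below. The radius \<open>rad 1\<close> avoids a singularity at \<open>0\<close>.
\<close>

definition decaying :: "(real^3 \<Rightarrow> complex) \<Rightarrow> bool" where
  "decaying f \<longleftrightarrow> continuous_on UNIV f \<and> (\<exists>C. \<forall>v. cmod (f v) \<le> C / rad 1 v ^ 4)"

lemma decaying_add: "decaying f \<Longrightarrow> decaying g \<Longrightarrow> decaying (\<lambda>v. f v + g v)"
  unfolding decaying_def
proof (elim conjE exE, intro conjI continuous_intros)
  fix C D assume "\<forall>v. cmod (f v) \<le> C / rad 1 v ^ 4" "\<forall>v. cmod (g v) \<le> D / rad 1 v ^ 4"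
  then have "cmod (f v + g v) \<le> (C + D) / rad 1 v ^ 4" for v
    by (metis add_divide_distrib norm_triangle_mono)
  then show "\<exists>C. \<forall>v. cmod (f v + g v) \<le> C / rad 1 v ^ 4" by blast
qed

lemma decaying_cmult: "decaying f \<Longrightarrow> decaying (\<lambda>v. c * f v)"
  unfolding decaying_def
proof (elim conjE exE, intro conjI continuous_intros)
  fix C assume C: "\<forall>v. cmod (f v) \<le> C / rad 1 v ^ 4"
  have "cmod (c * f v) \<le> (cmod c * C) / rad 1 v ^ 4" for v
    using mult_left_mono[OF C[rule_format, of v], of "cmod c"] by (simp add: norm_mult)
  then show "\<exists>C. \<forall>v. cmod (c * f v) \<le> C / rad 1 v ^ 4" by blast
qed

lemma rad_le_rad1: "d > 0 \<Longrightarrow> rad 1 v \<le> max 1 (1 / d) * rad d v"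
proof -
  assume d: "d > 0"
  have "rad 1 v \<le> rad (max 1 (1 / d) * d) v"
    by (rule rad_mono) (use d in \<open>auto simp: max_def field_simps\<close>)
  also have "\<dots> \<le> sqrt ((max 1 (1 / d))\<^sup>2 * ((norm v)\<^sup>2 + d\<^sup>2))"
    unfolding rad_def
  proof (rule real_sqrt_le_mono)
    have "1 * (norm v)\<^sup>2 \<le> (max 1 (1 / d))\<^sup>2 * (norm v)\<^sup>2"
      by (intro mult_right_mono) (auto intro: one_le_power)
    then show "(norm v)\<^sup>2 + (max 1 (1 / d) * d)\<^sup>2 \<le> (max 1 (1 / d))\<^sup>2 * ((norm v)\<^sup>2 + d\<^sup>2)"
      by (simp add: distrib_left power_mult_distrib)
  qed
  also have "\<dots> = max 1 (1 / d) * rad d v" by (simp add: rad_def real_sqrt_mult)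
  finally show ?thesis .
qed

lemma decaying_expk:
  assumes "d > 0" "Re \<zeta> > 0"
  shows "decaying (\<lambda>v. of_real (v \<bullet> b) * (of_real (v \<bullet> c) * expk \<zeta> d m v))"
    "decaying (\<lambda>v. of_real (v \<bullet> b) * expk \<zeta> d m v)" "decaying (expk \<zeta> d m)"
proof -
  define C where "C n = (real (n + 4) / Re \<zeta>) ^ (n + 4) / d ^ (m + (n + 4) - (n + 4))" for n
  have C0: "C n \<ge> 0" for n using assms by (auto simp: C_def)
  have E: "cmod (expk \<zeta> d m v) * rad d v ^ n \<le> C n / rad d v ^ 4" for n v
  proof -
    have s: "rad d v > 0" using rad_pos[OF assms(1)] .
    have "cmod (expk \<zeta> d m v) \<le> C n / rad d v ^ (n + 4)"
      unfolding C_def by (rule expk_decay) (use assms in auto)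
    then have "cmod (expk \<zeta> d m v) * rad d v ^ n \<le> C n / rad d v ^ (n + 4) * rad d v ^ n"
      using s by (intro mult_right_mono) auto
    also have "\<dots> = C n / rad d v ^ 4" using s by (simp add: power_add field_simps)
    finally show ?thesis .
  qed
  let ?M = "max 1 (1 / d)"
  have conv: "C n / rad d v ^ 4 \<le> (C n * ?M ^ 4) / rad 1 v ^ 4" for n v
  proof -
    have s: "rad d v > 0" "rad 1 v > 0" using rad_pos assms(1) by auto
    have "rad 1 v ^ 4 \<le> (?M * rad d v) ^ 4" using rad_le_rad1[OF assms(1)] s by (intro power_mono) auto
    then show ?thesis using s C0[of n] mult_left_mono[of "rad 1 v ^ 4" "(?M * rad d v) ^ 4" "C n"]
      by (simp add: divide_le_eq le_divide_eq power_mult_distrib mult_ac)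
  qed
  have inner: "\<bar>v \<bullet> b\<bar> \<le> norm b * rad d v" for v b
    using Cauchy_Schwarz_ineq2[of v b] mult_left_mono[OF rad_ge(1)[of v d] norm_ge_zero[of b]]
    by (simp add: mult.commute)
  have cont: "continuous_on UNIV (expk \<zeta> d m)" using Ck_imp_continuous[OF Ck_expk[OF assms(1)]] .
  have s: "rad d v > 0" for v using rad_pos[OF assms(1)] .
  have 2: "cmod (of_real (v \<bullet> b) * (of_real (v \<bullet> c) * expk \<zeta> d m v)) \<le> (norm b * norm c * (C 2 * ?M ^ 4)) / rad 1 v ^ 4" for v
  proof -
    have "\<bar>v \<bullet> b\<bar> * \<bar>v \<bullet> c\<bar> \<le> (norm b * rad d v) * (norm c * rad d v)"
      using inner s[THEN less_imp_le] by (intro mult_mono) auto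
    then have "cmod (of_real (v \<bullet> b) * (of_real (v \<bullet> c) * expk \<zeta> d m v)) \<le> (norm b * rad d v) * (norm c * rad d v) * cmod (expk \<zeta> d m v)"
      by (simp add: norm_mult mult.assoc[symmetric] mult_right_mono)
    also have "\<dots> = norm b * norm c * (cmod (expk \<zeta> d m v) * rad d v ^ 2)" by (simp add: power2_eq_square mult_ac)
    also have "\<dots> \<le> norm b * norm c * ((C 2 * ?M ^ 4) / rad 1 v ^ 4)"
      by (intro mult_left_mono order.trans[OF E conv]) auto
    finally show ?thesis by simp
  qed
  have 1: "cmod (of_real (v \<bullet> b) * expk \<zeta> d m v) \<le> (norm b * (C 1 * ?M ^ 4)) / rad 1 v ^ 4" for v
  proof -
    have "cmod (of_real (v \<bullet> b) * expk \<zeta> d m v) \<le> (norm b * rad d v) * cmod (expk \<zeta> d m v)"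
      using inner[of v b] by (simp add: norm_mult mult_right_mono)
    also have "\<dots> = norm b * (cmod (expk \<zeta> d m v) * rad d v ^ 1)" by (simp add: mult_ac)
    also have "\<dots> \<le> norm b * ((C 1 * ?M ^ 4) / rad 1 v ^ 4)"
      by (intro mult_left_mono order.trans[OF E conv]) auto
    finally show ?thesis by simp
  qed
  have 0: "cmod (expk \<zeta> d m v) \<le> (C 0 * ?M ^ 4) / rad 1 v ^ 4" for v
    using order.trans[OF E[of v 0] conv] by simp
  show "decaying (\<lambda>v. of_real (v \<bullet> b) * (of_real (v \<bullet> c) * expk \<zeta> d m v))"
    unfolding decaying_def using 2 by (intro conjI exI allI continuous_intros cont) auto
  show "decaying (\<lambda>v. of_real (v \<bullet> b) * expk \<zeta> d m v)"
    unfolding decaying_def using 1 by (intro conjI exI allI continuous_intros cont) auto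
  show "decaying (expk \<zeta> d m)"
    unfolding decaying_def using 0 cont by blast
qed

lemma decay_integrable_L2:
  fixes f :: "real^3 \<Rightarrow> complex"
  assumes m: "f \<in> borel_measurable lebesgue" and C: "\<And>v. cmod (f v) \<le> C / rad 1 v ^ 4"
  shows "integrable lebesgue f" "f \<in> L2"
proof -
  show "integrable lebesgue f" by (rule integrable_of_decay[OF _ m C]) simp
  have "norm ((cmod (f v))\<^sup>2) \<le> C\<^sup>2 / rad 1 v ^ 4" for v
  proof -
    have "1 \<le> rad 1 v" by (rule rad_ge) simp
    then have 1: "1 \<le> rad 1 v ^ 4" by (rule one_le_power)
    have "(cmod (f v))\<^sup>2 \<le> (C / rad 1 v ^ 4)\<^sup>2" using C by (intro power_mono) auto
    also have "\<dots> = C\<^sup>2 / (rad 1 v ^ 4 * rad 1 v ^ 4)" by (simp add: power_divide power2_eq_square)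
    also have "\<dots> \<le> C\<^sup>2 / (1 * rad 1 v ^ 4)"
      using 1 by (intro divide_left_mono mult_right_mono mult_pos_pos) auto
    finally show ?thesis by simp
  qed
  then have "integrable lebesgue (\<lambda>v. (cmod (f v))\<^sup>2)"
    using m by (intro integrable_of_decay[where d=1]) auto
  then show "f \<in> L2" using m by (simp add: L2_def)
qed

lemma decaying_measurable: "decaying f \<Longrightarrow> f \<in> borel_measurable lebesgue"
  by (auto simp: decaying_def intro: borel_measurable_lebesgueI)

lemma decaying_integrable:
  assumes "decaying f"
  shows "integrable lebesgue f" "f \<in> L2"
  using assms decay_integrable_L2[OF decaying_measurable[OF assms]] by (auto simp: decaying_def)

text \<open>
  The regularised kernel of \<open>(- \<Delta> + \<zeta>\<^sup>2)\<^sup>-\<^sup>1\<close>, its partial derivatives, and the mollifier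
  \<open>(- \<Delta> + \<zeta>\<^sup>2) ker\<close> that takes the place of the delta function.
\<close>

definition ker :: "complex \<Rightarrow> real \<Rightarrow> real^3 \<Rightarrow> complex" where
  "ker \<zeta> d v = expk \<zeta> d 1 v / of_real mass"

definition dker :: "complex \<Rightarrow> real \<Rightarrow> real^3 \<Rightarrow> real^3 \<Rightarrow> complex" where
  "dker \<zeta> d b v = - of_real (v \<bullet> b) * (\<zeta> * expk \<zeta> d 2 v + expk \<zeta> d 3 v) / of_real mass"

definition rho :: "complex \<Rightarrow> real \<Rightarrow> real^3 \<Rightarrow> complex" where
  "rho \<zeta> d v = of_real (d\<^sup>2) * (3 * expk \<zeta> d 5 v + 3 * \<zeta> * expk \<zeta> d 4 v + \<zeta>\<^sup>2 * expk \<zeta> d 3 v) / of_real mass"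

lemma pd_ker: "d > 0 \<Longrightarrow> pd b (ker \<zeta> d) = dker \<zeta> d b"
proof
  fix v assume d: "d > 0"
  have "(ker \<zeta> d has_derivative (\<lambda>h. (- of_real (v \<bullet> h) * (\<zeta> * expk \<zeta> d (1 + 1) v + of_nat 1 * expk \<zeta> d (1 + 2) v)) / of_real mass)) (at v)"
    unfolding ker_def[abs_def] divide_inverse
    by (intro has_derivative_mult_left expk_has_derivative d)
  from pd_eq[OF this, of b] show "pd b (ker \<zeta> d) v = dker \<zeta> d b v"
    by (simp add: dker_def eval_nat_numeral)
qed

lemma pd_dker:
  assumes d: "d > 0"
  shows "pd c (dker \<zeta> d b) v = (- of_real (c \<bullet> b) * (\<zeta> * expk \<zeta> d 2 v + expk \<zeta> d 3 v)
     + of_real (v \<bullet> b) * (of_real (v \<bullet> c) * (\<zeta>\<^sup>2 * expk \<zeta> d 3 v + 3 * \<zeta> * expk \<zeta> d 4 v + 3 * expk \<zeta> d 5 v))) / of_real mass"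
proof -
  have 1: "((\<lambda>v. of_real (v \<bullet> b) :: complex) has_derivative (\<lambda>h. of_real (h \<bullet> b))) (at v)"
    by (auto intro!: derivative_eq_intros)
  have E: "(expk \<zeta> d 2 has_derivative (\<lambda>h. - of_real (v \<bullet> h) * (\<zeta> * expk \<zeta> d 3 v + 2 * expk \<zeta> d 4 v))) (at v)"
    "(expk \<zeta> d 3 has_derivative (\<lambda>h. - of_real (v \<bullet> h) * (\<zeta> * expk \<zeta> d 4 v + 3 * expk \<zeta> d 5 v))) (at v)"
    using expk_has_derivative[OF d, of \<zeta> 2 v] expk_has_derivative[OF d, of \<zeta> 3 v]
    by (simp_all add: eval_nat_numeral)
  have 2: "((\<lambda>v. \<zeta> * expk \<zeta> d 2 v + expk \<zeta> d 3 v) has_derivative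
     (\<lambda>h. \<zeta> * (- of_real (v \<bullet> h) * (\<zeta> * expk \<zeta> d 3 v + 2 * expk \<zeta> d 4 v))
       + (- of_real (v \<bullet> h) * (\<zeta> * expk \<zeta> d 4 v + 3 * expk \<zeta> d 5 v)))) (at v)"
    by (intro has_derivative_add has_derivative_mult_right E)
  have eq: "dker \<zeta> d b = (\<lambda>v. (- 1 / of_real mass) * (of_real (v \<bullet> b) * (\<zeta> * expk \<zeta> d 2 v + expk \<zeta> d 3 v)))"
    by (auto simp: dker_def)
  have "(dker \<zeta> d b has_derivative (\<lambda>h. (- 1 / of_real mass) * (of_real (v \<bullet> b) *
     (\<zeta> * (- of_real (v \<bullet> h) * (\<zeta> * expk \<zeta> d 3 v + 2 * expk \<zeta> d 4 v))
       + (- of_real (v \<bullet> h) * (\<zeta> * expk \<zeta> d 4 v + 3 * expk \<zeta> d 5 v)))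
     + of_real (h \<bullet> b) * (\<zeta> * expk \<zeta> d 2 v + expk \<zeta> d 3 v)))) (at v)"
    unfolding eq by (rule has_derivative_mult_right[OF has_derivative_mult[OF 1 2]])
  from pd_eq[OF this, of c] show ?thesis
    by (simp add: divide_inverse algebra_simps power2_eq_square)
qed

lemma Ck_ker: "d > 0 \<Longrightarrow> Ck k (ker \<zeta> d)"
  unfolding ker_def[abs_def] divide_inverse by (intro Ck_mult Ck_expk Ck_const)

lemma decaying_ker:
  assumes d: "d > 0" "Re \<zeta> > 0"
  shows "decaying (ker \<zeta> d)" "decaying (dker \<zeta> d b)" "decaying (pd c (dker \<zeta> d b))" "decaying (rho \<zeta> d)"
proof -
  note E = decaying_expk[OF d]
  have *: "ker \<zeta> d = (\<lambda>v. (1 / of_real mass) * expk \<zeta> d 1 v)"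
    by (auto simp: ker_def)
  show "decaying (ker \<zeta> d)" unfolding * by (intro decaying_cmult E)
  have *: "dker \<zeta> d b = (\<lambda>v. (- \<zeta> / of_real mass) * (of_real (v \<bullet> b) * expk \<zeta> d 2 v) + (- 1 / of_real mass) * (of_real (v \<bullet> b) * expk \<zeta> d 3 v))"
    by (auto simp: dker_def divide_inverse algebra_simps)
  show "decaying (dker \<zeta> d b)" unfolding * by (intro decaying_add decaying_cmult E)
  have *: "pd c (dker \<zeta> d b) = (\<lambda>v. (- of_real (c \<bullet> b) * \<zeta> / of_real mass) * expk \<zeta> d 2 v
     + ((- of_real (c \<bullet> b) / of_real mass) * expk \<zeta> d 3 v
     + ((\<zeta>\<^sup>2 / of_real mass) * (of_real (v \<bullet> b) * (of_real (v \<bullet> c) * expk \<zeta> d 3 v))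
     + ((3 * \<zeta> / of_real mass) * (of_real (v \<bullet> b) * (of_real (v \<bullet> c) * expk \<zeta> d 4 v))
     + (3 / of_real mass) * (of_real (v \<bullet> b) * (of_real (v \<bullet> c) * expk \<zeta> d 5 v))))))"
    using pd_dker[OF d(1)] by (auto simp: divide_inverse algebra_simps)
  show "decaying (pd c (dker \<zeta> d b))" unfolding * by (intro decaying_add decaying_cmult E)
  have *: "rho \<zeta> d = (\<lambda>v. (3 * of_real (d\<^sup>2) / of_real mass) * expk \<zeta> d 5 v + ((3 * \<zeta> * of_real (d\<^sup>2) / of_real mass) * expk \<zeta> d 4 v
     + (\<zeta>\<^sup>2 * of_real (d\<^sup>2) / of_real mass) * expk \<zeta> d 3 v))"
    by (auto simp: rho_def divide_inverse algebra_simps)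
  show "decaying (rho \<zeta> d)" unfolding * by (intro decaying_add decaying_cmult E)
qed

lemma expk_reduce: "d > 0 \<Longrightarrow> expk \<zeta> d (Suc m) v * of_real (rad d v) = expk \<zeta> d m v"
  using rad_ne_0[of d v] by (simp add: expk_def)

text \<open>
  Summing the second derivatives over the three basis directions replaces \<open>(v \<bullet> b)\<^sup>2\<close> by
  \<open>s\<^sup>2 - d\<^sup>2\<close>. The \<open>s\<^sup>2\<close> part lowers the indices by two and cancels the first-order terms exactly because
  the dimension is three; the \<open>d\<^sup>2\<close> part is \<open>rho\<close>.
\<close>

lemma laplacian_ker:
  assumes d: "d > 0"
  shows "(\<Sum>b\<in>Basis. pd b (dker \<zeta> d b) v) = \<zeta>\<^sup>2 * ker \<zeta> d v - rho \<zeta> d v"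
proof -
  let ?A = "\<zeta> * expk \<zeta> d 2 v + expk \<zeta> d 3 v"
  let ?B = "\<zeta>\<^sup>2 * expk \<zeta> d 3 v + 3 * \<zeta> * expk \<zeta> d 4 v + 3 * expk \<zeta> d 5 v"
  define A where "A = (- 1 / of_real mass) * ?A"
  define B where "B = ?B / of_real mass"
  have "pd b (dker \<zeta> d b) v = A + of_real ((v \<bullet> b)\<^sup>2) * B" if "b \<in> Basis" for b
    using that by (simp add: pd_dker[OF d] A_def B_def inner_Basis power2_eq_square algebra_simps divide_inverse)
  then have "(\<Sum>b\<in>Basis. pd b (dker \<zeta> d b) v) = (\<Sum>b\<in>(Basis :: (real^3) set). A) + of_real (\<Sum>b\<in>Basis. (v \<bullet> b)\<^sup>2) * B"
    by (simp add: sum.distrib sum_distrib_right)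
  also have "(\<Sum>b\<in>(Basis :: (real^3) set). A) = 3 * A" by simp
  also have "(\<Sum>b\<in>Basis. (v \<bullet> b)\<^sup>2) = (rad d v)\<^sup>2 - d\<^sup>2"
    unfolding rad_sq power2_norm_eq_inner by (subst euclidean_inner) (simp add: power2_eq_square)
  also have "of_real ((rad d v)\<^sup>2 - d\<^sup>2) * B =
      (of_real ((rad d v)\<^sup>2) * ?B - of_real (d\<^sup>2) * ?B) / of_real mass"
    by (simp add: B_def algebra_simps diff_divide_distrib)
  also have "of_real ((rad d v)\<^sup>2) * ?B = \<zeta>\<^sup>2 * expk \<zeta> d 1 v + 3 * ?A"
  proof -
    have e: "of_real ((rad d v)\<^sup>2) * expk \<zeta> d (Suc (Suc m)) v = expk \<zeta> d m v" for m
      using expk_reduce[OF d, of \<zeta> "Suc m" v] expk_reduce[OF d, of \<zeta> m v]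
      by (simp add: power2_eq_square mult_ac)
    have "of_real ((rad d v)\<^sup>2) * expk \<zeta> d 3 v = expk \<zeta> d 1 v"
      "of_real ((rad d v)\<^sup>2) * expk \<zeta> d 4 v = expk \<zeta> d 2 v"
      "of_real ((rad d v)\<^sup>2) * expk \<zeta> d 5 v = expk \<zeta> d 3 v"
      using e[of 1] e[of 2] e[of 3] by (simp_all add: eval_nat_numeral)
    then show ?thesis by (simp add: distrib_left mult.left_commute[of "of_real ((rad d v)\<^sup>2)"] del: of_real_power)
  qed
  finally show ?thesis
    by (simp add: A_def ker_def rho_def algebra_simps divide_inverse)
qed

lemma pd_translate:
  assumes "Ck 1 f"
  shows "pd b (\<lambda>y. f (y - x)) = (\<lambda>y. pd b f (y - x))"
proof
  fix y
  have "f differentiable (at (1 *\<^sub>R y + - x))" using assms by simp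
  from pd_affine[OF this, of b] show "pd b (\<lambda>y. f (y - x)) y = pd b f (y - x)" by simp
qed

lemma Ck_translate: "Ck k f \<Longrightarrow> Ck k (\<lambda>y. f (y - x))"
  using Ck_affine[of k f 1 "- x"] by simp

lemma integrable_translate:
  fixes f :: "'a::euclidean_space \<Rightarrow> 'b::{banach, second_countable_topology}"
  assumes "integrable lebesgue f"
  shows "integrable lebesgue (\<lambda>y. f (y - x))"
  using integral_lebesgue_affine(1)[of 1 f "- x"] assms by (simp add: borel_measurable_integrable)

lemma L2_translate:
  fixes f :: "'a::euclidean_space \<Rightarrow> complex"
  assumes "f \<in> L2"
  shows "(\<lambda>y. f (y - x)) \<in> L2"
proof -
  have "(\<lambda>y. f (- x + 1 *\<^sub>R y)) \<in> borel_measurable lebesgue"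
    using measurable_comp[OF lebesgue_affine_distr(2)[of 1 "- x"] L2_measurable[OF assms]] by (simp add: o_def)
  then show ?thesis
    using integrable_translate[OF L2_integrable_sq[OF assms], of x] by (simp add: L2_def)
qed

lemma smooth_H2_translate:
  assumes "smooth_H2 f"
  shows "smooth_H2 (\<lambda>y. f (y - x))"
proof -
  note C = smooth_H2_Ck[OF assms] and C' = smooth_H2_Ck_pd[OF assms] and L = smooth_H2_L2[OF assms]
  show ?thesis
    unfolding smooth_H2_def pd_translate[OF C[of 1]]
    by (auto simp: pd_translate[OF C'] intro!: Ck_translate C L2_translate L)
qed

lemma smooth_H2_ker:
  assumes d: "d > 0" "Re \<zeta> > 0"
  shows "smooth_H2 (ker \<zeta> d)"
  unfolding smooth_H2_def pd_ker[OF d(1)]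
  using Ck_ker[OF d(1)] decaying_integrable(2)[OF decaying_ker(1)[OF d]]
    decaying_integrable(2)[OF decaying_ker(2)[OF d]] decaying_integrable(2)[OF decaying_ker(3)[OF d]] by auto

lemma pd_ker_translate: "d > 0 \<Longrightarrow> pd b (\<lambda>y. ker \<zeta> d (y - x)) = (\<lambda>y. dker \<zeta> d b (y - x))"
  using pd_translate[OF Ck_ker[where k=1 and \<zeta>=\<zeta> and d=d], of x b] fun_cong[OF pd_ker[where b=b and d=d and \<zeta>=\<zeta>]] by simp

lemma laplacian_ker_translate:
  assumes d: "d > 0" "Re \<zeta> > 0"
  shows "(\<Sum>b\<in>Basis. pd b (pd b (\<lambda>y. ker \<zeta> d (y - x))) y) = \<zeta>\<^sup>2 * ker \<zeta> d (y - x) - rho \<zeta> d (y - x)"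
proof -
  have "Ck 1 (dker \<zeta> d b)" if "b \<in> Basis" for b
    using smooth_H2_Ck_pd[OF smooth_H2_ker[OF d] that] by (simp only: pd_ker[OF d(1)])
  then have "(\<Sum>b\<in>Basis. pd b (pd b (\<lambda>y. ker \<zeta> d (y - x))) y) = (\<Sum>b\<in>Basis. pd b (dker \<zeta> d b) (y - x))"
    unfolding pd_ker_translate[OF d(1)]
    by (intro sum.cong refl fun_cong[OF pd_translate]) blast
  then show ?thesis using laplacian_ker[OF d(1)] by simp
qed

section \<open>Approximation of the identity\<close>

text \<open>
  Each of the three terms is compared with \<open>d / s\<^sup>4\<close>: the first by \<open>d \<le> s\<close>, the second by \<open>d \<le> 1\<close>,
  and the last, which alone would not be integrable uniformly in \<open>d\<close>, by the exponential factor and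
  \<open>d \<le> Re \<zeta>\<close>.
\<close>

lemma rho_bound:
  assumes d: "0 < d" "d \<le> 1" "d \<le> Re \<zeta>" and M: "cmod \<zeta> \<le> M"
  shows "cmod (rho \<zeta> d v) \<le> (3 + 3 * M + M\<^sup>2) / mass * d / rad d v ^ 4"
proof -
  let ?s = "rad d v" and ?e = "exp (- Re \<zeta> * rad d v)"
  have s: "?s > 0" "d \<le> ?s" using rad_pos rad_ge d by auto
  have M0: "M \<ge> 0" using norm_ge_zero M order_trans by blast
  have e1: "?e \<le> 1" using s d by simp
  have "?e \<le> exp (- (d * ?s))" using s d by simp
  also have "\<dots> \<le> 1 / (d * ?s)" using exp_minus_le_inverse_power[of "d * ?s" 1] s d by simp
  finally have e2: "?e * (d * ?s) \<le> 1" using s d by (simp add: le_divide_eq)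
  have t1: "d\<^sup>2 * (3 * (?e / ?s ^ 5)) \<le> 3 * (d / ?s ^ 4)"
  proof -
    have "d * ?e \<le> ?s * 1" using s d e1 by (intro mult_mono) auto
    then have "d * (d * ?e) \<le> d * ?s" using d by (intro mult_left_mono) auto
    then show ?thesis using s by (simp add: field_simps power2_eq_square eval_nat_numeral)
  qed
  have t2: "d\<^sup>2 * (3 * cmod \<zeta> * (?e / ?s ^ 4)) \<le> 3 * M * (d / ?s ^ 4)"
  proof -
    have "cmod \<zeta> * (d * ?e) \<le> M * (1 * 1)" using d e1 M M0 by (intro mult_mono) auto
    then have "d * (cmod \<zeta> * (d * ?e)) \<le> d * M" using d by (intro mult_left_mono) auto
    then show ?thesis using s by (simp add: field_simps power2_eq_square)
  qed
  have t3: "d\<^sup>2 * ((cmod \<zeta>)\<^sup>2 * (?e / ?s ^ 3)) \<le> M\<^sup>2 * (d / ?s ^ 4)"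
  proof -
    have "(cmod \<zeta>)\<^sup>2 * (?e * (d * ?s)) \<le> M\<^sup>2 * 1"
      using e2 M s d by (intro mult_mono power_mono) auto
    then have "d * ((cmod \<zeta>)\<^sup>2 * (?e * (d * ?s))) \<le> d * M\<^sup>2" using d by (intro mult_left_mono) auto
    then show ?thesis using s by (simp add: field_simps power2_eq_square eval_nat_numeral)
  qed
  have "cmod (3 * expk \<zeta> d 5 v + 3 * \<zeta> * expk \<zeta> d 4 v + \<zeta>\<^sup>2 * expk \<zeta> d 3 v)
    \<le> 3 * (?e / ?s ^ 5) + 3 * cmod \<zeta> * (?e / ?s ^ 4) + (cmod \<zeta>)\<^sup>2 * (?e / ?s ^ 3)"
    using d(1) by (intro order.trans[OF norm_triangle_ineq] add_mono)
      (auto simp: norm_mult norm_power cmod_expk)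
  then have "cmod (rho \<zeta> d v) \<le> d\<^sup>2 * (3 * (?e / ?s ^ 5) + 3 * cmod \<zeta> * (?e / ?s ^ 4) + (cmod \<zeta>)\<^sup>2 * (?e / ?s ^ 3)) / mass"
    using mass_pos by (simp add: rho_def norm_divide norm_mult norm_power divide_right_mono mult_left_mono)
  also have "\<dots> \<le> (3 * (d / ?s ^ 4) + 3 * M * (d / ?s ^ 4) + M\<^sup>2 * (d / ?s ^ 4)) / mass"
    using t1 t2 t3 mass_pos by (intro divide_right_mono) (auto simp: distrib_left)
  also have "\<dots> = (3 + 3 * M + M\<^sup>2) / mass * d / ?s ^ 4"
    by (simp add: algebra_simps add_divide_distrib)
  finally show ?thesis .
qed

lemma rho_scaled:
  assumes "d > 0"
  shows "of_real (d ^ 3) * rho \<zeta> d (d *\<^sub>R u) = exp (- \<zeta> * of_real (d * rad 1 u)) *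
    (of_real (3 / rad 1 u ^ 5) + of_real d * (3 * \<zeta> / of_real (rad 1 u ^ 4)) + of_real d ^ 2 * (\<zeta>\<^sup>2 / of_real (rad 1 u ^ 3))) / of_real mass"
proof -
  have *: "D ^ 3 * (D\<^sup>2 * (3 * (e / (D * S) ^ 5) + 3 * z * (e / (D * S) ^ 4) + z\<^sup>2 * (e / (D * S) ^ 3)) / m)
      = e * (3 / S ^ 5 + D * (3 * z / S ^ 4) + D ^ 2 * (z\<^sup>2 / S ^ 3)) / m"
    if "D \<noteq> 0" for D S e z m :: complex
  proof -
    have "D ^ 3 * (D\<^sup>2 * (e / (D * S) ^ 5)) = e / S ^ 5" "D ^ 3 * (D\<^sup>2 * (e / (D * S) ^ 4)) = D * (e / S ^ 4)"
      "D ^ 3 * (D\<^sup>2 * (e / (D * S) ^ 3)) = D\<^sup>2 * (e / S ^ 3)"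
      using that by (simp_all add: power_mult_distrib eval_nat_numeral)
    note 1 = this
    have "D ^ 3 * (D\<^sup>2 * (3 * (e / (D * S) ^ 5) + 3 * z * (e / (D * S) ^ 4) + z\<^sup>2 * (e / (D * S) ^ 3)) / m)
      = (3 * (D ^ 3 * (D\<^sup>2 * (e / (D * S) ^ 5))) + 3 * z * (D ^ 3 * (D\<^sup>2 * (e / (D * S) ^ 4)))
        + z\<^sup>2 * (D ^ 3 * (D\<^sup>2 * (e / (D * S) ^ 3)))) / m"
      by (simp only: times_divide_eq_right distrib_left mult_ac)
    then show ?thesis unfolding 1 by (simp add: divide_inverse algebra_simps)
  qed
  from *[of "of_real d" "exp (- \<zeta> * of_real (d * rad 1 u))" "of_real (rad 1 u)" \<zeta> "of_real mass"] assms
  show ?thesis by (simp add: rho_def expk_def rad_scale)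
qed

text \<open>
  After the substitution \<open>y = x + d u\<close> only the term \<open>3 / (1 + |u|\<^sup>2)\<^bsup>5/2\<^esup>\<close> survives in the limit,
  and \<open>mass\<close> is its integral. The parameter \<open>\<zeta>\<close> may vary with \<open>d\<close>, since the root \<open>\<zeta>\<close> will be shifted
  along with the regularisation.
\<close>

lemma rho_approximates_identity:
  fixes h :: "real^3 \<Rightarrow> complex"
  assumes h: "h \<in> borel_measurable lebesgue" "\<And>y. cmod (h y) \<le> B" and x: "isCont h x"
    and d: "\<And>n. 0 < d n" "\<And>n. d n \<le> 1" "d \<longlonglongrightarrow> 0"
    and \<zeta>: "\<And>n. d n \<le> Re (\<zeta> n)" "\<And>n. cmod (\<zeta> n) \<le> M"
  shows "(\<lambda>n. LINT y|lebesgue. rho (\<zeta> n) (d n) (y - x) * h y) \<longlonglongrightarrow> h x"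
proof -
  have M0: "M \<ge> 0" using norm_ge_zero \<zeta>(2) order_trans by blast
  have B0: "B \<ge> 0" using norm_ge_zero h(2) order_trans by blast
  have Re: "Re (\<zeta> n) > 0" for n using d(1) \<zeta>(1) by (rule less_le_trans)
  let ?K = "(3 + 3 * M + M\<^sup>2) / mass"
  have K0: "?K \<ge> 0" using M0 mass_pos by auto
  have mrho: "rho (\<zeta> n) (d n) \<in> borel_measurable lebesgue" for n
    using decaying_integrable(1)[OF decaying_ker(4)[OF d(1) Re]] by (rule borel_measurable_integrable)
  have mh: "(\<lambda>u. h (x + c *\<^sub>R u)) \<in> borel_measurable lebesgue" if "c \<noteq> 0" for c
    using measurable_comp[OF lebesgue_affine_distr(2)[OF that, of x] h(1)] by (simp add: o_def)
  have mr: "(\<lambda>u. rho (\<zeta> n) (d n) (0 + c *\<^sub>R u)) \<in> borel_measurable lebesgue" if "c \<noteq> 0" for c n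
    using measurable_comp[OF lebesgue_affine_distr(2)[OF that, of 0] mrho] by (simp add: o_def)
  have mt: "(\<lambda>y. rho (\<zeta> n) (d n) (y - x)) \<in> borel_measurable lebesgue" for n
    using measurable_comp[OF lebesgue_affine_distr(2)[of 1 "- x"] mrho[of n]] by (simp add: o_def)
  have eq: "(LINT y|lebesgue. rho (\<zeta> n) (d n) (y - x) * h y)
      = (LINT u|lebesgue. (of_real (d n ^ 3) * rho (\<zeta> n) (d n) (d n *\<^sub>R u)) * h (x + d n *\<^sub>R u))" for n
  proof -
    have "(\<lambda>y. rho (\<zeta> n) (d n) (y - x) * h y) \<in> borel_measurable lebesgue"
      using mt h(1) by (rule borel_measurable_times)
    from integral_lebesgue_affine(2)[OF _ this, of "d n" x] d(1)[of n]
    show ?thesis by (simp add: scaleR_conv_of_real mult.assoc)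
  qed
  have lim: "(\<lambda>n. LINT u|lebesgue. (of_real (d n ^ 3) * rho (\<zeta> n) (d n) (d n *\<^sub>R u)) * h (x + d n *\<^sub>R u))
      \<longlonglongrightarrow> (LINT u|lebesgue. of_real (3 / rad 1 u ^ 5) / of_real mass * h x)"
  proof (rule integral_dominated_convergence[where w="\<lambda>u. ?K * B / rad 1 u ^ 4"])
    show "(\<lambda>u. complex_of_real (3 / rad 1 u ^ 5) / of_real mass * h x) \<in> borel_measurable lebesgue"
      by (intro borel_measurable_lebesgueI continuous_intros) (use mass_pos rad_ne_0[of 1] in auto)
    show "(\<lambda>u. (of_real (d n ^ 3) * rho (\<zeta> n) (d n) (d n *\<^sub>R u)) * h (x + d n *\<^sub>R u)) \<in> borel_measurable lebesgue" for n
      using mr[of "d n" n] mh[of "d n"] d(1)[of n] by (intro borel_measurable_times) auto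
    have "(\<lambda>u. ?K * B / rad 1 u ^ 4) \<in> borel_measurable lebesgue"
      by (intro borel_measurable_lebesgueI continuous_intros) (use rad_ne_0[of 1] in auto)
    then show "integrable lebesgue (\<lambda>u. ?K * B / rad 1 u ^ 4)"
      by (rule integrable_of_decay[of 1, OF zero_less_one, where C="?K * B"])
         (simp only: real_norm_def abs_of_nonneg[OF divide_nonneg_nonneg[OF mult_nonneg_nonneg[OF K0 B0]]]
           order.refl zero_le_power less_imp_le[OF rad_pos[OF zero_less_one]])
    show "AE u in lebesgue. norm ((of_real (d n ^ 3) * rho (\<zeta> n) (d n) (d n *\<^sub>R u)) * h (x + d n *\<^sub>R u)) \<le> ?K * B / rad 1 u ^ 4" for n
    proof (rule AE_I2)
      fix u
      have s: "rad 1 u > 0" by (rule rad_pos) simp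
      have "d n ^ 3 * cmod (rho (\<zeta> n) (d n) (d n *\<^sub>R u)) \<le> d n ^ 3 * (?K * d n / rad (d n) (d n *\<^sub>R u) ^ 4)"
        by (intro mult_left_mono rho_bound d \<zeta>) (use d(1)[of n] in simp)
      also have "\<dots> = ?K / rad 1 u ^ 4"
        using d(1)[of n] s by (simp add: rad_scale power_mult_distrib eval_nat_numeral)
      finally have "(d n ^ 3 * cmod (rho (\<zeta> n) (d n) (d n *\<^sub>R u))) * cmod (h (x + d n *\<^sub>R u)) \<le> ?K / rad 1 u ^ 4 * B"
        by (rule mult_mono[OF _ h(2) divide_nonneg_nonneg[OF K0]]) (use s in auto)
      then show "norm ((of_real (d n ^ 3) * rho (\<zeta> n) (d n) (d n *\<^sub>R u)) * h (x + d n *\<^sub>R u)) \<le> ?K * B / rad 1 u ^ 4"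
        using d(1)[of n] by (simp add: norm_mult norm_power)
    qed
    show "AE u in lebesgue. (\<lambda>n. (of_real (d n ^ 3) * rho (\<zeta> n) (d n) (d n *\<^sub>R u)) * h (x + d n *\<^sub>R u))
       \<longlonglongrightarrow> of_real (3 / rad 1 u ^ 5) / of_real mass * h x"
    proof (rule AE_I2)
      fix u
      have null: "(\<lambda>n. of_real (d n) * (\<zeta> n * c)) \<longlonglongrightarrow> 0" for c
      proof (rule Lim_null_comparison)
        show "(\<lambda>n. d n * (M * cmod c)) \<longlonglongrightarrow> 0" using tendsto_mult_left_zero[OF d(3)] .
        show "\<forall>\<^sub>F n in sequentially. norm (of_real (d n) * (\<zeta> n * c)) \<le> d n * (M * cmod c)"
          using less_imp_le[OF d(1)] \<zeta>(2)
          by (intro always_eventually allI) (simp add: norm_mult mult_left_mono mult_right_mono)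
      qed
      have "(\<lambda>n. exp (- (of_real (d n) * (\<zeta> n * of_real (rad 1 u)))) *
        (of_real (3 / rad 1 u ^ 5) + of_real (d n) * (\<zeta> n * (3 / of_real (rad 1 u ^ 4)))
          + (of_real (d n) * (\<zeta> n * 1))\<^sup>2 / of_real (rad 1 u ^ 3)) / of_real mass * h (x + d n *\<^sub>R u))
        \<longlonglongrightarrow> exp (- 0) * (of_real (3 / rad 1 u ^ 5) + 0 + 0\<^sup>2 / of_real (rad 1 u ^ 3)) / of_real mass * h x"
      proof (intro tendsto_intros null)
        have "(\<lambda>n. x + d n *\<^sub>R u) \<longlonglongrightarrow> x + 0 *\<^sub>R u" by (intro tendsto_intros d)
        then show "(\<lambda>n. h (x + d n *\<^sub>R u)) \<longlonglongrightarrow> h x"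
          using x isCont_tendsto_compose[of x h] by simp
      qed (use mass_pos rad_ne_0[of 1 u] in auto)
      moreover have "(of_real (d n ^ 3) * rho (\<zeta> n) (d n) (d n *\<^sub>R u)) * h (x + d n *\<^sub>R u) =
        exp (- (of_real (d n) * (\<zeta> n * of_real (rad 1 u)))) *
        (of_real (3 / rad 1 u ^ 5) + of_real (d n) * (\<zeta> n * (3 / of_real (rad 1 u ^ 4)))
          + (of_real (d n) * (\<zeta> n * 1))\<^sup>2 / of_real (rad 1 u ^ 3)) / of_real mass * h (x + d n *\<^sub>R u)" for n
        unfolding rho_scaled[OF d(1)] by (simp add: power_mult_distrib mult_ac)
      ultimately show "(\<lambda>n. (of_real (d n ^ 3) * rho (\<zeta> n) (d n) (d n *\<^sub>R u)) * h (x + d n *\<^sub>R u))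
       \<longlonglongrightarrow> of_real (3 / rad 1 u ^ 5) / of_real mass * h x" by simp
    qed
  qed
  have "(LINT u|lebesgue. complex_of_real (3 / rad 1 u ^ 5) / of_real mass * h x) = h x"
  proof -
    have "(LINT u|lebesgue. complex_of_real (3 / rad 1 u ^ 5) / of_real mass * h x)
        = (LINT u|lebesgue. complex_of_real (3 / rad 1 u ^ 5) * (h x / of_real mass))"
      by (simp only: times_divide_eq_left times_divide_eq_right)
    also have "\<dots> = (LINT u|lebesgue. complex_of_real (3 / rad 1 u ^ 5)) * (h x / of_real mass)"
      by (rule integral_mult_left_zero)
    also have "(LINT u|lebesgue. complex_of_real (3 / rad 1 u ^ 5)) = of_real mass"
      unfolding mass_def by (rule integral_complex_of_real)
    finally show ?thesis using mass_pos by simp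
  qed
  with lim show ?thesis unfolding eq by simp
qed

section \<open>Kernel operators\<close>

lemma sigma_finite_lebesgue: "sigma_finite_measure (lebesgue :: 'a::euclidean_space measure)"
proof
  show "\<exists>A. countable A \<and> A \<subseteq> sets (lebesgue :: 'a measure) \<and> \<Union> A = space lebesgue \<and>
    (\<forall>a\<in>A. emeasure lebesgue a \<noteq> \<infinity>)"
  proof (intro exI[of _ "range (\<lambda>n. cball 0 (real n))"] conjI)
    show "\<Union> (range (\<lambda>n. cball (0::'a) (real n))) = space lebesgue"
      using real_arch_simple by (auto simp: mem_cball)
    show "\<forall>a\<in>range (\<lambda>n. cball (0::'a) (real n)). emeasure lebesgue a \<noteq> \<infinity>"
      using emeasure_bounded_finite[OF bounded_cball, of "0::'a"] by (auto simp: less_top)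
  qed auto
qed

interpretation leb: sigma_finite_measure "lebesgue :: (real^3) measure"
  by (rule sigma_finite_lebesgue)

interpretation leb2: pair_sigma_finite "lebesgue :: (real^3) measure" "lebesgue :: (real^3) measure" ..

lemma measurable_difference_kernel:
  assumes "k \<in> borel_measurable borel"
  shows "(\<lambda>p. k (fst p - snd p)) \<in> borel_measurable (lebesgue \<Otimes>\<^sub>M (lebesgue :: (real^3) measure))"
proof -
  have id: "(\<lambda>x. x) \<in> lebesgue \<rightarrow>\<^sub>M (borel :: (real^3) measure)"
    by (simp add: measurable_completion)
  have [measurable]: "fst \<in> lebesgue \<Otimes>\<^sub>M (lebesgue :: (real^3) measure) \<rightarrow>\<^sub>M (borel :: (real^3) measure)"
    "snd \<in> lebesgue \<Otimes>\<^sub>M (lebesgue :: (real^3) measure) \<rightarrow>\<^sub>M (borel :: (real^3) measure)"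
    using measurable_compose[OF measurable_fst id] measurable_compose[OF measurable_snd id] by auto
  note [measurable] = assms
  show ?thesis by measurable
qed

text \<open>
  Fubini's theorem in the form used throughout. The hypotheses cover both bounded \<open>g\<close> against an
  integrable kernel and square integrable \<open>g\<close> against a square integrable kernel.
\<close>

lemma kernel_Fubini:
  fixes f g k :: "real^3 \<Rightarrow> complex"
  assumes f: "integrable lebesgue f" and g[measurable]: "g \<in> borel_measurable lebesgue"
    and k: "continuous_on UNIV k"
    and int: "\<And>x. integrable lebesgue (\<lambda>y. k (x - y) * g y)"
    and B: "\<And>x. (LINT y|lebesgue. norm (k (x - y) * g y)) \<le> B"
  shows "(LINT x|lebesgue. f x * (LINT y|lebesgue. k (x - y) * g y)) = (LINT y|lebesgue. (LINT x|lebesgue. f x * k (x - y)) * g y)"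
    and "(\<lambda>x. LINT y|lebesgue. k (x - y) * g y) \<in> borel_measurable lebesgue"
    and "integrable lebesgue (\<lambda>y. (LINT x|lebesgue. f x * k (x - y)) * g y)"
proof -
  note [measurable] = borel_measurable_integrable[OF f]
    measurable_difference_kernel[OF borel_measurable_continuous_onI[OF k]]
  have m: "(\<lambda>(x, y). f x * (k (x - y) * g y)) \<in> borel_measurable (lebesgue \<Otimes>\<^sub>M lebesgue)"
    by measurable
  have mk: "(\<lambda>(x, y). k (x - y) * g y) \<in> borel_measurable (lebesgue \<Otimes>\<^sub>M lebesgue)"
    by measurable
  show mc: "(\<lambda>x. LINT y|lebesgue. k (x - y) * g y) \<in> borel_measurable lebesgue"
    using leb.borel_measurable_lebesgue_integral[OF mk] by simp
  have I: "integrable (lebesgue \<Otimes>\<^sub>M lebesgue) (\<lambda>(x, y). f x * (k (x - y) * g y))"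
  proof (rule leb2.Fubini_integrable[OF m])
    show "integrable lebesgue (\<lambda>x. LINT y|lebesgue. norm (case (x, y) of (x, y) \<Rightarrow> f x * (k (x - y) * g y)))"
    proof (rule Bochner_Integration.integrable_bound)
      show "integrable lebesgue (\<lambda>x. B * norm (f x))" using f by simp
      have "(\<lambda>(x, y). norm (f x * (k (x - y) * g y))) \<in> borel_measurable (lebesgue \<Otimes>\<^sub>M lebesgue)"
        by measurable
      then show "(\<lambda>x. LINT y|lebesgue. norm (case (x, y) of (x, y) \<Rightarrow> f x * (k (x - y) * g y))) \<in> borel_measurable lebesgue"
        using leb.borel_measurable_lebesgue_integral by simp
      have "norm (LINT y|lebesgue. norm (f x * (k (x - y) * g y))) \<le> norm (B * norm (f x))" for x
      proof -
        have "(LINT y|lebesgue. norm (f x * (k (x - y) * g y))) = norm (f x) * (LINT y|lebesgue. norm (k (x - y) * g y))"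
          unfolding norm_mult[of "f x"] by simp
        also have "\<dots> \<le> norm (f x) * B" by (intro mult_left_mono B) simp
        finally show ?thesis by (simp add: mult.commute abs_of_nonneg integral_nonneg_AE)
      qed
      then show "AE x in lebesgue. norm (LINT y|lebesgue. norm (case (x, y) of (x, y) \<Rightarrow> f x * (k (x - y) * g y))) \<le> norm (B * norm (f x))"
        by simp
    qed
    show "AE x in lebesgue. integrable lebesgue (\<lambda>y. case (x, y) of (x, y) \<Rightarrow> f x * (k (x - y) * g y))"
      using int by simp
  qed
  have "integrable lebesgue (\<lambda>y. LINT x|lebesgue. f x * (k (x - y) * g y))"
    using leb2.integrable_snd[OF I] .
  then show "integrable lebesgue (\<lambda>y. (LINT x|lebesgue. f x * k (x - y)) * g y)"
    by (simp add: mult.assoc[symmetric])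
  have "(LINT x|lebesgue. f x * (LINT y|lebesgue. k (x - y) * g y)) = (LINT x|lebesgue. LINT y|lebesgue. f x * (k (x - y) * g y))"
    by simp
  also have "\<dots> = (LINT y|lebesgue. LINT x|lebesgue. f x * (k (x - y) * g y))"
    using leb2.Fubini_integral[OF I] by simp
  also have "\<dots> = (LINT y|lebesgue. (LINT x|lebesgue. f x * k (x - y)) * g y)"
    by (simp add: mult.assoc[symmetric])
  finally show "(LINT x|lebesgue. f x * (LINT y|lebesgue. k (x - y) * g y)) = (LINT y|lebesgue. (LINT x|lebesgue. f x * k (x - y)) * g y)" .
qed

section \<open>Positive kernels\<close>

text \<open>
  For real positive \<open>\<zeta>\<close> the kernels are positive. These real versions carry the order arguments.
\<close>

definition rker :: "real \<Rightarrow> real \<Rightarrow> real^3 \<Rightarrow> real" where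
  "rker \<mu> d v = exp (- \<mu> * rad d v) / (mass * rad d v)"

definition rrho :: "real \<Rightarrow> real \<Rightarrow> real^3 \<Rightarrow> real" where
  "rrho \<mu> d v = d\<^sup>2 * exp (- \<mu> * rad d v) * (3 / rad d v ^ 5 + 3 * \<mu> / rad d v ^ 4 + \<mu>\<^sup>2 / rad d v ^ 3) / mass"

lemma ker_of_real: "ker (of_real \<mu>) d v = of_real (rker \<mu> d v)"
  by (simp add: ker_def expk_def rker_def exp_of_real[symmetric] mult.commute)

lemma rho_of_real: "rho (of_real \<mu>) d v = of_real (rrho \<mu> d v)"
  by (simp add: rho_def expk_def rrho_def exp_of_real[symmetric] algebra_simps divide_inverse)

lemma rker_nonneg: "d > 0 \<Longrightarrow> 0 \<le> rker \<mu> d v"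
  using mass_pos rad_pos[of d v] by (simp add: rker_def)

lemma rrho_nonneg: "d > 0 \<Longrightarrow> \<mu> \<ge> 0 \<Longrightarrow> 0 \<le> rrho \<mu> d v"
  using mass_pos rad_pos[of d v] by (simp add: rrho_def)

lemma rker_minus: "rker \<mu> d (x - y) = rker \<mu> d (y - x)"
  by (simp add: rker_def rad_minus(2)[of d x y])

lemma rker_mono:
  assumes "0 < d" "d \<le> d'" "0 \<le> \<mu>" "\<mu> \<le> \<mu>'"
  shows "rker \<mu>' d' v \<le> rker \<mu> d v"
  unfolding rker_def
proof (rule frac_le)
  have s: "0 < rad d v" "rad d v \<le> rad d' v" using rad_pos rad_mono assms by auto
  show "exp (- \<mu>' * rad d' v) \<le> exp (- \<mu> * rad d v)" using s assms by (simp add: mult_mono)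
  show "mass * rad d v \<le> mass * rad d' v" "0 < mass * rad d v" using s mass_pos by auto
qed simp

lemma rker_le: "d > 0 \<Longrightarrow> \<mu> \<ge> 0 \<Longrightarrow> rker \<mu> d v \<le> 1 / (mass * d)"
  unfolding rker_def using rad_ge(2)[of d v] mass_pos
  by (intro frac_le) auto

lemma continuous_rker: "d > 0 \<Longrightarrow> continuous_on UNIV (rker \<mu> d)"
  unfolding rker_def[abs_def] using rad_ne_0[of d] mass_pos by (intro continuous_intros) auto

text \<open>
  Both sides represent the convolution of the two mollifiers with the Yukawa kernel; the equality is
  Green's identity, the zeroth-order terms being the same on both sides.
\<close>

lemma ker_rho_symmetric:
  assumes d: "0 < d" "0 < d'" "0 < Re \<zeta>"
  shows "(LINT x|lebesgue. ker \<zeta> d' (x - y') * rho \<zeta> d (x - y)) = (LINT x|lebesgue. rho \<zeta> d' (x - y') * ker \<zeta> d (x - y))"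
proof -
  note S = smooth_H2_translate[OF smooth_H2_ker[OF d(1,3)], of y]
  note S' = smooth_H2_translate[OF smooth_H2_ker[OF d(2,3)], of y']
  note L = decaying_integrable(2)[OF decaying_ker(1)[OF d(1,3)], THEN L2_translate, of y]
    decaying_integrable(2)[OF decaying_ker(1)[OF d(2,3)], THEN L2_translate, of y']
    decaying_integrable(2)[OF decaying_ker(4)[OF d(1,3)], THEN L2_translate, of y]
    decaying_integrable(2)[OF decaying_ker(4)[OF d(2,3)], THEN L2_translate, of y']
  let ?k = "\<lambda>x. ker \<zeta> d (x - y)" and ?k' = "\<lambda>x. ker \<zeta> d' (x - y')"
  let ?r = "\<lambda>x. rho \<zeta> d (x - y)" and ?r' = "\<lambda>x. rho \<zeta> d' (x - y')"
  have "(LINT x|lebesgue. ?k' x * (\<zeta>\<^sup>2 * ?k x - ?r x)) = (LINT x|lebesgue. laplacian ?k' x * ?k x)"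
    using laplacian_pairing[OF smooth_H2_Sobolev[OF S'] S] by (simp only: laplacian_ker_translate[OF d(1,3)])
  also have "\<dots> = (LINT x|lebesgue. (\<zeta>\<^sup>2 * ?k' x - ?r' x) * ?k x)"
  proof (rule integral_cong_AE)
    show "AE x in lebesgue. laplacian ?k' x * ?k x = (\<zeta>\<^sup>2 * ?k' x - ?r' x) * ?k x"
      using smooth_H2_laplacian[OF S'] by eventually_elim (simp only: laplacian_ker_translate[OF d(2,3)])
    show "(\<lambda>x. laplacian ?k' x * ?k x) \<in> borel_measurable lebesgue"
      using L2_measurable[OF laplacian_L2[OF smooth_H2_Sobolev[OF S']]] L2_measurable[OF L(1)] by measurable
    show "(\<lambda>x. (\<zeta>\<^sup>2 * ?k' x - ?r' x) * ?k x) \<in> borel_measurable lebesgue"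
      using L2_measurable[OF L(1)] L2_measurable[OF L(2)] L2_measurable[OF L(4)] by measurable
  qed
  finally have eq: "(LINT x|lebesgue. \<zeta>\<^sup>2 * (?k' x * ?k x) - ?k' x * ?r x) = (LINT x|lebesgue. \<zeta>\<^sup>2 * (?k' x * ?k x) - ?r' x * ?k x)"
    by (simp add: algebra_simps)
  note I = L2_mult_integrable[OF L(2) L(1)] L2_mult_integrable[OF L(2) L(3)] L2_mult_integrable[OF L(4) L(1)]
  have "(LINT x|lebesgue. \<zeta>\<^sup>2 * (?k' x * ?k x)) - (LINT x|lebesgue. ?k' x * ?r x)
     = (LINT x|lebesgue. \<zeta>\<^sup>2 * (?k' x * ?k x)) - (LINT x|lebesgue. ?r' x * ?k x)"
    using eq I by (simp only: Bochner_Integration.integral_diff integrable_mult_right)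
  then show ?thesis by simp
qed

lemma rker_rrho_integrable:
  assumes "0 < d" "0 < d'" "0 < \<mu>"
  shows "integrable lebesgue (\<lambda>x. rker \<mu> d' (x - y') * rrho \<mu> d (x - y))"
proof -
  have Re: "0 < Re (of_real \<mu>)" using assms by simp
  have "integrable lebesgue (\<lambda>x. ker (of_real \<mu>) d' (x - y') * rho (of_real \<mu>) d (x - y))"
    by (intro L2_mult_integrable L2_translate decaying_integrable(2) decaying_ker assms Re)
  then show ?thesis unfolding ker_of_real rho_of_real of_real_mult[symmetric] complex_of_real_integrable_eq .
qed

text \<open>
  Mollifying the regularised kernel once more decreases it. Replacing the regularisation \<open>d\<close> of the
  first factor by a smaller \<open>e\<close> increases that factor; by symmetry the integral equals the
  \<open>e\<close>-mollification of \<open>rker \<mu> d\<close>, which converges to the right-hand side as \<open>e\<close> tends to \<open>0\<close>.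
\<close>

lemma rker_rrho_le:
  assumes d: "0 < d" and \<mu>: "0 < \<mu>"
  shows "(LINT x|lebesgue. rker \<mu> d (x - y') * rrho \<mu> d (x - y)) \<le> rker \<mu> d (y - y')"
proof -
  \<comment> \<open>The regularisation e must stay below d for monotonicity, and below 1 and \<open>\<mu>\<close> for the mollifier bound.\<close>
  define m where "m = min d (min 1 \<mu>)"
  define e where "e n = m * inverse (real (Suc n))" for n
  have m: "0 < m" "m \<le> d" "m \<le> 1" "m \<le> \<mu>" using d \<mu> by (auto simp: m_def)
  have em: "0 < e n" "e n \<le> m" for n
    using m(1) by (auto simp: e_def field_simps)
  have e: "e n \<le> d" "e n \<le> 1" "e n \<le> \<mu>" for n using em(2)[of n] m by auto
  have e0: "e \<longlonglongrightarrow> 0"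
    using tendsto_mult_right_zero[OF LIMSEQ_inverse_real_of_nat, of m] by (simp add: e_def[abs_def])
  have Re: "0 < Re (of_real \<mu>)" using \<mu> by simp
  let ?h = "\<lambda>x. ker (of_real \<mu>) d (x - y)"
  have "(\<lambda>n. LINT x|lebesgue. rho (of_real \<mu>) (e n) (x - y') * ?h x) \<longlonglongrightarrow> ?h y'"
  proof (rule rho_approximates_identity[where B="1 / (mass * d)" and M=\<mu>])
    have c: "continuous_on UNIV ?h"
      by (rule Ck_imp_continuous[OF Ck_translate[OF Ck_ker[OF d]]])
    then show "?h \<in> borel_measurable lebesgue" by (rule borel_measurable_lebesgueI)
    show "isCont ?h y'" using c by (simp add: continuous_on_eq_continuous_at)
    show "cmod (?h x) \<le> 1 / (mass * d)" for x
      using rker_le[OF d, of \<mu> "x - y"] rker_nonneg[OF d, of \<mu> "x - y"] \<mu> by (simp add: ker_of_real)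
  qed (use em e e0 \<mu> in auto)
  then have "(\<lambda>n. LINT x|lebesgue. ker (of_real \<mu>) (e n) (x - y') * rho (of_real \<mu>) d (x - y)) \<longlonglongrightarrow> ?h y'"
    using ker_rho_symmetric[OF d em(1) Re] by simp
  then have "(\<lambda>n. complex_of_real (LINT x|lebesgue. rker \<mu> (e n) (x - y') * rrho \<mu> d (x - y))) \<longlonglongrightarrow> of_real (rker \<mu> d (y' - y))"
    unfolding ker_of_real rho_of_real of_real_mult[symmetric] integral_complex_of_real .
  then have lim: "(\<lambda>n. LINT x|lebesgue. rker \<mu> (e n) (x - y') * rrho \<mu> d (x - y)) \<longlonglongrightarrow> rker \<mu> d (y - y')"
    by (simp add: tendsto_of_real_iff rker_minus[of \<mu> d y y'])
  have "(LINT x|lebesgue. rker \<mu> d (x - y') * rrho \<mu> d (x - y)) \<le> (LINT x|lebesgue. rker \<mu> (e n) (x - y') * rrho \<mu> d (x - y))" for n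
    using d \<mu> em(1)[of n] e(1)[of n]
    by (intro integral_mono rker_rrho_integrable mult_right_mono rker_mono rrho_nonneg) auto
  then show ?thesis using lim by (intro LIMSEQ_le_const[OF lim]) auto
qed

section \<open>Energy of regularised potentials\<close>

text \<open>
  Bounded densities of bounded support have potentials in \<open>H\<^sup>1\<close>; general densities are reached by
  monotone limits.
\<close>

definition bdd_density :: "(real^3 \<Rightarrow> real) \<Rightarrow> bool" where
  "bdd_density w \<longleftrightarrow> w \<in> borel_measurable lebesgue \<and> (\<forall>x. 0 \<le> w x) \<and>
     (\<exists>W. \<forall>x. w x \<le> W) \<and> (\<exists>R. \<forall>x. w x \<noteq> 0 \<longrightarrow> norm x \<le> R)"

definition conv :: "(real^3 \<Rightarrow> complex) \<Rightarrow> (real^3 \<Rightarrow> real) \<Rightarrow> real^3 \<Rightarrow> complex" where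
  "conv k w x = (LINT y|lebesgue. k (x - y) * of_real (w y))"

definition pot :: "real \<Rightarrow> real \<Rightarrow> (real^3 \<Rightarrow> real) \<Rightarrow> real^3 \<Rightarrow> real" where
  "pot \<mu> d w x = (LINT y|lebesgue. rker \<mu> d (x - y) * w y)"

lemma bdd_density_integrable:
  assumes "bdd_density w"
  shows "integrable lebesgue w"
proof -
  obtain W R where W: "\<And>x. w x \<le> W" "\<And>x. w x \<noteq> 0 \<Longrightarrow> norm x \<le> R" and w: "w \<in> borel_measurable lebesgue" "\<And>x. 0 \<le> w x"
    using assms unfolding bdd_density_def by blast
  show ?thesis
  proof (rule Bochner_Integration.integrable_bound)
    show "integrable lebesgue (\<lambda>x. W * indicator (cball (0::real^3) R) x)"
      using emeasure_bounded_finite[OF bounded_cball, of 0 R]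
      by (intro integrable_mult_right integrable_real_indicator) auto
    show "AE x in lebesgue. norm (w x) \<le> norm (W * indicator (cball 0 R) x)"
    proof (rule AE_I2)
      fix x show "norm (w x) \<le> norm (W * indicator (cball 0 R) x)"
        using W(1)[of x] W(2)[of x] w(2)[of x] by (cases "w x = 0") auto
    qed
  qed (rule w)
qed

lemma bdd_density_indicator_box: "bdd_density (indicator (box l u))"
proof -
  obtain R where "\<And>x. x \<in> box l u \<Longrightarrow> norm x \<le> R" using bounded_box[of l u] unfolding bounded_iff by blast
  then have "\<exists>R. \<forall>x. indicat_real (box l u) x \<noteq> 0 \<longrightarrow> norm x \<le> R"
    by (intro exI[of _ R]) (auto simp: indicator_def)
  moreover have "indicat_real (box l u) \<in> borel_measurable lebesgue"
    by (rule borel_measurable_indicator) simp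
  moreover have "\<exists>W. \<forall>x. indicat_real (box l u) x \<le> W" by (intro exI[of _ 1]) (simp add: indicator_def)
  ultimately show ?thesis unfolding bdd_density_def by simp
qed

lemma rad1_shift: "rad 1 x \<le> rad 1 (x - y) + norm y"
proof -
  let ?s = "rad 1 (x - y)"
  have s: "norm (x - y) \<le> ?s" "?s > 0" using rad_ge(1) rad_pos[of 1] by auto
  have "norm x \<le> norm (x - y) + norm y" by (metis diff_add_cancel norm_triangle_ineq)
  then have "(norm x)\<^sup>2 \<le> (norm (x - y) + norm y)\<^sup>2" by (intro power_mono) auto
  also have "\<dots> = (norm (x - y))\<^sup>2 + 2 * (norm (x - y) * norm y) + (norm y)\<^sup>2" by (simp add: power2_sum)
  also have "\<dots> \<le> (norm (x - y))\<^sup>2 + 2 * (?s * norm y) + (norm y)\<^sup>2"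
    using s by (intro add_mono mult_left_mono mult_right_mono) auto
  finally have "(norm x)\<^sup>2 + 1\<^sup>2 \<le> (?s + norm y)\<^sup>2"
    using rad_sq[of 1 "x - y"] by (simp add: power2_sum)
  then show ?thesis unfolding rad_def[of 1 x] using s(2) by (intro real_le_lsqrt) auto
qed

text \<open>
  On the support of \<open>w\<close>, which lies in a ball of radius \<open>R\<close>, the radius \<open>rad 1 (x - y)\<close> is at
  least \<open>rad 1 x / (1 + R)\<close>, so that convolution with \<open>w\<close> preserves the decay rate.
\<close>

lemma conv_decay:
  assumes k: "decaying k" and w: "bdd_density w"
  shows "integrable lebesgue (\<lambda>y. k (x - y) * of_real (w y))"
    and "\<exists>B. \<forall>x. (LINT y|lebesgue. norm (k (x - y) * of_real (w y))) \<le> B"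
    and "conv k w \<in> borel_measurable lebesgue"
    and "\<exists>C. \<forall>x. cmod (conv k w x) \<le> C / rad 1 x ^ 4"
proof -
  obtain C where C: "\<And>v. cmod (k v) \<le> C / rad 1 v ^ 4" using k by (auto simp: decaying_def)
  have ck: "continuous_on UNIV k" using k by (simp add: decaying_def)
  obtain R where R: "\<And>x. w x \<noteq> 0 \<Longrightarrow> norm x \<le> R" and mw[measurable]: "w \<in> borel_measurable lebesgue" and w0: "\<And>x. 0 \<le> w x"
    using w unfolding bdd_density_def by blast
  have iw: "integrable lebesgue w" using bdd_density_integrable[OF w] .
  have r1: "1 \<le> rad 1 v" for v by (rule rad_ge) simp
  have C0: "C \<ge> 0" using order.trans[OF norm_ge_zero C[of 0]] r1[of 0]
    by (smt (verit) divide_neg_pos zero_less_power)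
  have kC: "cmod (k v) \<le> C" for v
  proof -
    have "C / rad 1 v ^ 4 \<le> C / 1" using C0 r1[of v] one_le_power[OF r1, of v 4] by (intro divide_left_mono) auto
    with C[of v] show ?thesis by simp
  qed
  have mk: "(\<lambda>y. k (x - y)) \<in> borel_measurable lebesgue" for x
    by (intro borel_measurable_lebesgueI continuous_on_compose2[OF ck]) (auto intro!: continuous_intros)
  show int: "integrable lebesgue (\<lambda>y. k (x - y) * of_real (w y))" for x
  proof (rule Bochner_Integration.integrable_bound[where f="\<lambda>y. C * w y"])
    show "integrable lebesgue (\<lambda>y. C * w y)" using iw by simp
    show "(\<lambda>y. k (x - y) * of_real (w y)) \<in> borel_measurable lebesgue"
      using mk by measurable
    show "AE y in lebesgue. norm (k (x - y) * of_real (w y)) \<le> norm (C * w y)"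
      using kC w0 C0 by (auto simp: norm_mult intro!: mult_right_mono)
  qed
  have bound: "(LINT y|lebesgue. norm (k (x - y) * of_real (w y))) \<le> (C * (1 + \<bar>R\<bar>) ^ 4 * (LINT y|lebesgue. w y)) / rad 1 x ^ 4" for x
  proof -
    have "(LINT y|lebesgue. norm (k (x - y) * of_real (w y))) \<le> (LINT y|lebesgue. (C * (1 + \<bar>R\<bar>) ^ 4 / rad 1 x ^ 4) * w y)"
    proof (rule integral_mono)
      show "integrable lebesgue (\<lambda>y. norm (k (x - y) * of_real (w y)))" using int by simp
      show "integrable lebesgue (\<lambda>y. (C * (1 + \<bar>R\<bar>) ^ 4 / rad 1 x ^ 4) * w y)" using iw by (rule integrable_mult_right)
      fix y
      show "norm (k (x - y) * of_real (w y)) \<le> (C * (1 + \<bar>R\<bar>) ^ 4 / rad 1 x ^ 4) * w y"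
      proof (cases "w y = 0")
        case False
        have "rad 1 x \<le> rad 1 (x - y) + \<bar>R\<bar> * 1" using rad1_shift[of x y] R[OF False] by linarith
        also have "\<dots> \<le> rad 1 (x - y) + \<bar>R\<bar> * rad 1 (x - y)" using r1[of "x - y"] by (intro add_mono mult_left_mono) auto
        also have "\<dots> = (1 + \<bar>R\<bar>) * rad 1 (x - y)" by (simp add: algebra_simps)
        finally have "rad 1 x ^ 4 \<le> ((1 + \<bar>R\<bar>) * rad 1 (x - y)) ^ 4" using r1[of x] by (intro power_mono) auto
        then have "C * rad 1 x ^ 4 \<le> C * ((1 + \<bar>R\<bar>) ^ 4 * rad 1 (x - y) ^ 4)" using C0 by (intro mult_left_mono) (auto simp: power_mult_distrib)
        then have "C / rad 1 (x - y) ^ 4 \<le> C * (1 + \<bar>R\<bar>) ^ 4 / rad 1 x ^ 4"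
          using rad_pos[of 1 x] rad_pos[of 1 "x - y"] by (simp add: divide_le_eq le_divide_eq mult_ac)
        then have "cmod (k (x - y)) \<le> C * (1 + \<bar>R\<bar>) ^ 4 / rad 1 x ^ 4" using C order.trans by blast
        from mult_right_mono[OF this w0[of y]] show ?thesis using w0[of y] by (simp add: norm_mult)
      qed simp
    qed
    then show ?thesis by simp
  qed
  show B: "\<exists>B. \<forall>x. (LINT y|lebesgue. norm (k (x - y) * of_real (w y))) \<le> B"
  proof (intro exI allI)
    fix x
    let ?D = "C * (1 + \<bar>R\<bar>) ^ 4 * (LINT y|lebesgue. w y)"
    have "?D \<ge> 0" using C0 w0 by (intro mult_nonneg_nonneg integral_nonneg_AE) auto
    then have "?D / rad 1 x ^ 4 \<le> ?D / 1" using one_le_power[OF r1, of x 4] by (intro divide_left_mono) auto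
    with bound[of x] show "(LINT y|lebesgue. norm (k (x - y) * of_real (w y))) \<le> ?D" by simp
  qed
  then obtain B where B: "\<And>x. (LINT y|lebesgue. norm (k (x - y) * of_real (w y))) \<le> B" by blast
  have mw': "(\<lambda>y. complex_of_real (w y)) \<in> borel_measurable lebesgue" by measurable
  show "conv k w \<in> borel_measurable lebesgue"
    using kernel_Fubini(2)[OF integrable_zero mw' ck int B] by (simp add: conv_def[abs_def])
  have "cmod (conv k w x) \<le> (LINT y|lebesgue. norm (k (x - y) * of_real (w y)))" for x
    unfolding conv_def by (rule integral_norm_bound)
  then show "\<exists>C. \<forall>x. cmod (conv k w x) \<le> C / rad 1 x ^ 4" using bound order.trans by blast
qed

lemma conv_L2:
  assumes "decaying k" "bdd_density w"
  shows "integrable lebesgue (conv k w)" "conv k w \<in> L2"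
  using decay_integrable_L2[OF conv_decay(3)[OF assms]] conv_decay(4)[OF assms] by auto

lemma conv_Fubini:
  assumes k: "decaying k" and w: "bdd_density w" and f: "integrable lebesgue f"
  shows "(LINT x|lebesgue. f x * conv k w x) = (LINT y|lebesgue. (LINT x|lebesgue. f x * k (x - y)) * of_real (w y))"
    and "integrable lebesgue (\<lambda>y. (LINT x|lebesgue. f x * k (x - y)) * of_real (w y))"
proof -
  obtain B where B: "\<And>x. (LINT y|lebesgue. norm (k (x - y) * of_real (w y))) \<le> B"
    using conv_decay(2)[OF k w] by blast
  have m: "(\<lambda>y. complex_of_real (w y)) \<in> borel_measurable lebesgue"
    using bdd_density_integrable[OF w] by measurable
  have ck: "continuous_on UNIV k" using k by (simp add: decaying_def)
  note F = kernel_Fubini[OF f m ck conv_decay(1)[OF k w] B]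
  from F(1) show "(LINT x|lebesgue. f x * conv k w x) = (LINT y|lebesgue. (LINT x|lebesgue. f x * k (x - y)) * of_real (w y))"
    by (simp add: conv_def)
  from F(3) show "integrable lebesgue (\<lambda>y. (LINT x|lebesgue. f x * k (x - y)) * of_real (w y))" .
qed

text \<open>
  By Fubini the derivative falls on the kernel, whose weak derivative is classical; the convolution
  itself is never differentiated.
\<close>

lemma conv_weak_deriv:
  assumes d: "0 < d" "0 < Re \<zeta>" and w: "bdd_density w" and b: "b \<in> Basis"
  shows "is_weak_deriv b (conv (ker \<zeta> d) w) (conv (dker \<zeta> d b) w)"
  unfolding is_weak_deriv_def
proof
  fix \<phi> :: "real^3 \<Rightarrow> complex" assume \<phi>: "\<phi> \<in> test_functions"
  have C: "Ck 1 \<phi>" "compact (closure {x. \<phi> x \<noteq> 0})" using \<phi> unfolding test_functions_def by blast+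
  have i: "integrable lebesgue (pd b \<phi>)"
    by (rule integrable_continuous_compact_support[OF Ck1_continuous_pd[OF C(1) b]
        compact_of_closed_subset[OF closed_closure pd_support C(2)]])
  have i': "integrable lebesgue \<phi>"
    by (rule integrable_continuous_compact_support[OF Ck1_continuous[OF C(1)] C(2)])
  have inner: "(LINT x|lebesgue. pd b \<phi> x * ker \<zeta> d (x - y)) = - (LINT x|lebesgue. \<phi> x * dker \<zeta> d b (x - y))" for y
  proof -
    have "is_weak_deriv b (\<lambda>x. ker \<zeta> d (x - y)) (\<lambda>x. dker \<zeta> d b (x - y))"
      using smooth_is_weak_deriv[OF Ck_translate[OF Ck_ker[OF d(1)]] b, of \<zeta> y] by (simp only: pd_ker_translate[OF d(1)])
    then show ?thesis using \<phi> by (simp add: is_weak_deriv_def mult.commute)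
  qed
  have "(LINT x|lebesgue. conv (ker \<zeta> d) w x * pd b \<phi> x) = (LINT x|lebesgue. pd b \<phi> x * conv (ker \<zeta> d) w x)"
    by (simp add: mult.commute)
  also have "\<dots> = (LINT y|lebesgue. (LINT x|lebesgue. pd b \<phi> x * ker \<zeta> d (x - y)) * of_real (w y))"
    by (rule conv_Fubini[OF decaying_ker(1)[OF d] w i])
  also have "\<dots> = - (LINT y|lebesgue. (LINT x|lebesgue. \<phi> x * dker \<zeta> d b (x - y)) * of_real (w y))"
    unfolding inner by simp
  also have "(LINT y|lebesgue. (LINT x|lebesgue. \<phi> x * dker \<zeta> d b (x - y)) * of_real (w y)) = (LINT x|lebesgue. \<phi> x * conv (dker \<zeta> d b) w x)"
    by (rule conv_Fubini(1)[OF decaying_ker(2)[OF d] w i', symmetric])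
  finally show "(LINT x|lebesgue. conv (ker \<zeta> d) w x * pd b \<phi> x) = - (LINT x|lebesgue. conv (dker \<zeta> d b) w x * \<phi> x)"
    by (simp add: mult.commute)
qed

lemma conv_ker_of_real: "conv (ker (of_real \<mu>) d) w x = of_real (pot \<mu> d w x)"
  unfolding conv_def pot_def ker_of_real of_real_mult[symmetric] by (rule integral_complex_of_real)

lemma pot_nonneg: "d > 0 \<Longrightarrow> bdd_density w \<Longrightarrow> 0 \<le> pot \<mu> d w x"
  unfolding pot_def bdd_density_def using rker_nonneg by (intro integral_nonneg_AE) auto

lemma pot_integrable:
  assumes "0 < d" "0 < \<mu>" "bdd_density w"
  shows "integrable lebesgue (\<lambda>y. rker \<mu> d (x - y) * w y)"
    "pot \<mu> d w \<in> borel_measurable lebesgue" "(\<lambda>x. of_real (pot \<mu> d w x)) \<in> L2"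
    "\<exists>B. \<forall>x. pot \<mu> d w x \<le> B" "integrable lebesgue (\<lambda>y. w y * pot \<mu> d w y)"
proof -
  have Re: "0 < Re (of_real \<mu>)" using assms by simp
  note D = decaying_ker(1)[OF assms(1) Re]
  show "integrable lebesgue (\<lambda>y. rker \<mu> d (x - y) * w y)"
    using conv_decay(1)[OF D assms(3), of x]
    unfolding ker_of_real of_real_mult[symmetric] complex_of_real_integrable_eq .
  have eq: "conv (ker (of_real \<mu>) d) w = (\<lambda>x. of_real (pot \<mu> d w x))" by (auto simp: conv_ker_of_real)
  show L: "(\<lambda>x. of_real (pot \<mu> d w x)) \<in> L2" using conv_L2(2)[OF D assms(3)] by (simp add: eq)
  have "(\<lambda>x. Re (of_real (pot \<mu> d w x))) \<in> borel_measurable lebesgue"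
    by (rule measurable_compose[OF L2_measurable[OF L]]) measurable
  then show m: "pot \<mu> d w \<in> borel_measurable lebesgue" by simp
  obtain B where B: "\<And>x. (LINT y|lebesgue. norm (ker (of_real \<mu>) d (x - y) * of_real (w y))) \<le> B"
    using conv_decay(2)[OF D assms(3)] by blast
  have "pot \<mu> d w x \<le> B" for x
  proof -
    have "pot \<mu> d w x \<le> norm (conv (ker (of_real \<mu>) d) w x)" by (simp add: conv_ker_of_real)
    also have "\<dots> \<le> (LINT y|lebesgue. norm (ker (of_real \<mu>) d (x - y) * of_real (w y)))"
      unfolding conv_def by (rule integral_norm_bound)
    finally show ?thesis using B order.trans by blast
  qed
  then show "\<exists>B. \<forall>x. pot \<mu> d w x \<le> B" by blast
  show "integrable lebesgue (\<lambda>y. w y * pot \<mu> d w y)"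
  proof (rule Bochner_Integration.integrable_bound[where f="\<lambda>y. B * w y"])
    show "integrable lebesgue (\<lambda>y. B * w y)" using bdd_density_integrable[OF assms(3)] by simp
    show "(\<lambda>y. w y * pot \<mu> d w y) \<in> borel_measurable lebesgue"
      using m bdd_density_integrable[OF assms(3)] by measurable
    have "w y * pot \<mu> d w y \<le> B * w y" "0 \<le> w y * pot \<mu> d w y" for y
      using \<open>\<And>x. pot \<mu> d w x \<le> B\<close> assms(3) pot_nonneg[OF assms(1,3)]
      by (auto simp: bdd_density_def mult.commute[of _ "w y"] mult_left_mono)
    then show "AE y in lebesgue. norm (w y * pot \<mu> d w y) \<le> norm (B * w y)"
      by (auto intro!: AE_I2) (smt (verit))
  qed
qed

text \<open>
  The mollified potential is a superposition of mollified kernels, each of which is at most the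
  kernel itself.
\<close>

lemma pot_rrho_le:
  assumes d: "0 < d" "0 < \<mu>" and w: "bdd_density w"
  shows "(LINT x|lebesgue. pot \<mu> d w x * rrho \<mu> d (x - y)) \<le> pot \<mu> d w y"
proof -
  have Re: "0 < Re (of_real \<mu>)" using d by simp
  have w0: "0 \<le> w x" for x using w by (simp add: bdd_density_def)
  have "(LINT x|lebesgue. rho (of_real \<mu>) d (x - y) * conv (ker (of_real \<mu>) d) w x)
    = (LINT y'|lebesgue. (LINT x|lebesgue. rho (of_real \<mu>) d (x - y) * ker (of_real \<mu>) d (x - y')) * of_real (w y'))"
    by (rule conv_Fubini[OF decaying_ker(1)[OF d(1) Re] w])
       (rule integrable_translate[OF decaying_integrable(1)[OF decaying_ker(4)[OF d(1) Re]]])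
  then have "(LINT x|lebesgue. rrho \<mu> d (x - y) * pot \<mu> d w x)
    = (LINT y'|lebesgue. (LINT x|lebesgue. rrho \<mu> d (x - y) * rker \<mu> d (x - y')) * w y')"
    unfolding conv_ker_of_real ker_of_real rho_of_real of_real_mult[symmetric] integral_complex_of_real
    by (simp only: of_real_eq_iff)
  also have "\<dots> \<le> (LINT y'|lebesgue. rker \<mu> d (y - y') * w y')"
  proof (rule integral_mono')
    show "integrable lebesgue (\<lambda>y'. rker \<mu> d (y - y') * w y')" by (rule pot_integrable[OF d w])
    fix y'
    have "(LINT x|lebesgue. rrho \<mu> d (x - y) * rker \<mu> d (x - y')) \<le> rker \<mu> d (y - y')"
      using rker_rrho_le[OF d, of y' y] by (simp add: mult.commute)
    then show "(LINT x|lebesgue. rrho \<mu> d (x - y) * rker \<mu> d (x - y')) * w y' \<le> rker \<mu> d (y - y') * w y'"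
      using w0 by (rule mult_right_mono)
    show "0 \<le> rker \<mu> d (y - y') * w y'" using rker_nonneg[OF d(1)] w0 by simp
  qed
  finally show ?thesis by (simp add: pot_def mult.commute)
qed

lemma cnj_dker_of_real: "cnj (dker (of_real \<mu>) d b v) = dker (of_real \<mu>) d b v"
  by (simp add: dker_def expk_def exp_cnj)

text \<open>
  The energy inequality \<open>\<integral> |\<nabla> u|\<^sup>2 \<le> \<integral> w u\<close> for the potential \<open>u\<close> of \<open>w\<close>. One of the two gradients is
  written as a convolution with \<open>w\<close>, and integration by parts against the smooth kernel moves the
  other derivative, so that \<open>w\<close> is integrated against \<open>\<integral> u (rho - \<mu>\<^sup>2 ker)\<close>. The second term has the good
  sign, and the first is at most \<open>u\<close>.
\<close>

lemma pot_energy: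
  assumes d: "0 < d" "0 < \<mu>" and w: "bdd_density w"
  shows "(\<Sum>b\<in>Basis. LINT x|lebesgue. (cmod (conv (dker (of_real \<mu>) d b) w x))\<^sup>2) \<le> (LINT y|lebesgue. w y * pot \<mu> d w y)"
proof -
  define \<zeta> :: complex where "\<zeta> = of_real \<mu>"
  have Re: "0 < Re \<zeta>" using d by (simp add: \<zeta>_def)
  let ?u = "conv (ker \<zeta> d) w" and ?v = "\<lambda>b. conv (dker \<zeta> d b) w"
  note D = decaying_ker[OF d(1) Re]
  note L = conv_L2[OF D(1) w] conv_L2[OF D(2) w]
  have w0: "0 \<le> w x" for x using w by (simp add: bdd_density_def)
  have sq: "complex_of_real ((cmod (?v b x))\<^sup>2) = ?v b x * ?v b x" for b x
  proof -
    have "cnj (?v b x) = ?v b x"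
    proof -
      have "cnj (?v b x) = (LINT y|lebesgue. cnj (dker \<zeta> d b (x - y) * of_real (w y)))"
        unfolding conv_def by (rule Bochner_Integration.integral_cnj[symmetric])
      also have "\<dots> = ?v b x"
        unfolding conv_def complex_cnj_mult \<zeta>_def cnj_dker_of_real complex_cnj_complex_of_real ..
      finally show ?thesis .
    qed
    then show ?thesis by (simp only: complex_norm_square)
  qed
  have step: "complex_of_real (LINT x|lebesgue. (cmod (?v b x))\<^sup>2) = (LINT y|lebesgue. (LINT x|lebesgue. ?v b x * dker \<zeta> d b (x - y)) * of_real (w y))" for b
    unfolding integral_complex_of_real[symmetric] sq by (rule conv_Fubini[OF D(2) w L(3)])
  have parts: "(LINT x|lebesgue. ?v b x * dker \<zeta> d b (x - y)) = - (LINT x|lebesgue. ?u x * pd b (\<lambda>x. dker \<zeta> d b (x - y)) x)" if b: "b \<in> Basis" for b y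
  proof -
    have S: "smooth_H2 (\<lambda>x. ker \<zeta> d (x - y))" using smooth_H2_translate[OF smooth_H2_ker[OF d(1) Re]] .
    have "(LINT x|lebesgue. ?u x * pd b (\<lambda>x. dker \<zeta> d b (x - y)) x) = - (LINT x|lebesgue. ?v b x * dker \<zeta> d b (x - y))"
      using smooth_H2_Ck_pd[OF S b] smooth_H2_L2(2)[OF S b] smooth_H2_L2(3)[OF S b b]
      unfolding pd_ker_translate[OF d(1)]
      by (rule weak_deriv_pairing[OF conv_weak_deriv[OF d(1) Re w b] L(2) L(4) b])
    then show ?thesis by simp
  qed
  have lap: "(\<Sum>b\<in>Basis. LINT x|lebesgue. ?v b x * dker \<zeta> d b (x - y))
    = of_real (LINT x|lebesgue. pot \<mu> d w x * (rrho \<mu> d (x - y) - \<mu>\<^sup>2 * rker \<mu> d (x - y)))" for y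
  proof -
    have S: "smooth_H2 (\<lambda>x. ker \<zeta> d (x - y))" using smooth_H2_translate[OF smooth_H2_ker[OF d(1) Re]] .
    have "(\<Sum>b\<in>Basis. LINT x|lebesgue. ?v b x * dker \<zeta> d b (x - y))
      = - (\<Sum>b\<in>Basis. LINT x|lebesgue. ?u x * pd b (\<lambda>x. dker \<zeta> d b (x - y)) x)"
      by (simp add: parts sum_negf)
    also have "(\<Sum>b\<in>Basis. LINT x|lebesgue. ?u x * pd b (\<lambda>x. dker \<zeta> d b (x - y)) x)
      = (LINT x|lebesgue. (\<Sum>b\<in>Basis. ?u x * pd b (\<lambda>x. dker \<zeta> d b (x - y)) x))"
      using smooth_H2_L2(3)[OF S] unfolding pd_ker_translate[OF d(1)]
      by (intro Bochner_Integration.integral_sum[symmetric] L2_mult_integrable L(2))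
    also have "\<dots> = (LINT x|lebesgue. ?u x * (\<zeta>\<^sup>2 * ker \<zeta> d (x - y) - rho \<zeta> d (x - y)))"
      unfolding sum_distrib_left[symmetric]
      using laplacian_ker_translate[OF d(1) Re, of y] by (simp only: pd_ker_translate[OF d(1)])
    also have "\<dots> = (LINT x|lebesgue. of_real (- (pot \<mu> d w x * (rrho \<mu> d (x - y) - \<mu>\<^sup>2 * rker \<mu> d (x - y)))))"
      unfolding \<zeta>_def conv_ker_of_real ker_of_real rho_of_real
      by (intro Bochner_Integration.integral_cong refl) (simp add: algebra_simps)
    also have "\<dots> = of_real (- (LINT x|lebesgue. pot \<mu> d w x * (rrho \<mu> d (x - y) - \<mu>\<^sup>2 * rker \<mu> d (x - y))))"
      unfolding integral_complex_of_real by simp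
    finally show ?thesis by simp
  qed
  have "complex_of_real (\<Sum>b\<in>Basis. LINT x|lebesgue. (cmod (?v b x))\<^sup>2)
    = (\<Sum>b\<in>Basis. LINT y|lebesgue. (LINT x|lebesgue. ?v b x * dker \<zeta> d b (x - y)) * of_real (w y))"
    by (simp add: step del: of_real_power)
  also have "\<dots> = (LINT y|lebesgue. (\<Sum>b\<in>Basis. (LINT x|lebesgue. ?v b x * dker \<zeta> d b (x - y)) * of_real (w y)))"
    by (intro Bochner_Integration.integral_sum[symmetric] conv_Fubini[OF D(2) w L(3)])
  also have "\<dots> = (LINT y|lebesgue. of_real ((LINT x|lebesgue. pot \<mu> d w x * (rrho \<mu> d (x - y) - \<mu>\<^sup>2 * rker \<mu> d (x - y))) * w y))"
    unfolding sum_distrib_right[symmetric] lap by simp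
  finally have "(\<Sum>b\<in>Basis. LINT x|lebesgue. (cmod (?v b x))\<^sup>2)
    = (LINT y|lebesgue. (LINT x|lebesgue. pot \<mu> d w x * (rrho \<mu> d (x - y) - \<mu>\<^sup>2 * rker \<mu> d (x - y))) * w y)"
    unfolding integral_complex_of_real by (simp only: of_real_eq_iff)
  also have "\<dots> \<le> (LINT y|lebesgue. w y * pot \<mu> d w y)"
  proof (rule integral_mono')
    show "integrable lebesgue (\<lambda>y. w y * pot \<mu> d w y)" by (rule pot_integrable[OF d w])
    fix y
    show "0 \<le> w y * pot \<mu> d w y" using w0 pot_nonneg[OF d(1) w] by simp
    have i: "integrable lebesgue (\<lambda>x. pot \<mu> d w x * rrho \<mu> d (x - y))"
    proof -
      have "integrable lebesgue (\<lambda>x. of_real (pot \<mu> d w x) * rho \<zeta> d (x - y))"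
        by (intro L2_mult_integrable pot_integrable[OF d w] L2_translate[OF decaying_integrable(2)[OF D(4)]])
      then show ?thesis unfolding \<zeta>_def rho_of_real of_real_mult[symmetric] complex_of_real_integrable_eq .
    qed
    have "(LINT x|lebesgue. pot \<mu> d w x * (rrho \<mu> d (x - y) - \<mu>\<^sup>2 * rker \<mu> d (x - y))) \<le> (LINT x|lebesgue. pot \<mu> d w x * rrho \<mu> d (x - y))"
    proof (rule integral_mono'[OF i])
      fix x
      show "pot \<mu> d w x * (rrho \<mu> d (x - y) - \<mu>\<^sup>2 * rker \<mu> d (x - y)) \<le> pot \<mu> d w x * rrho \<mu> d (x - y)"
        using rker_nonneg[OF d(1)] by (intro mult_left_mono pot_nonneg[OF d(1) w]) simp
      show "0 \<le> pot \<mu> d w x * rrho \<mu> d (x - y)"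
        using pot_nonneg[OF d(1) w] rrho_nonneg[OF d(1)] d(2) by simp
    qed
    also have "\<dots> \<le> pot \<mu> d w y" by (rule pot_rrho_le[OF d w])
    finally show "(LINT x|lebesgue. pot \<mu> d w x * (rrho \<mu> d (x - y) - \<mu>\<^sup>2 * rker \<mu> d (x - y))) * w y \<le> w y * pot \<mu> d w y"
      using w0[of y] by (subst mult.commute) (rule mult_left_mono)
  qed
  finally show ?thesis by (simp add: \<zeta>_def)
qed

text \<open>
  The inequality that defines the supremum of the theorem, in product form.
\<close>

definition form_bound :: "(real^3 \<Rightarrow> complex) \<Rightarrow> ennreal \<Rightarrow> bool" where
  "form_bound V S \<longleftrightarrow> (\<forall>f\<in>Sobolev 1. (\<integral>\<^sup>+ x. ennreal (cmod (V x) * (cmod (f x))\<^sup>2) \<partial>lebesgue)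
     \<le> S * (\<integral>\<^sup>+ x. ennreal (grad_norm_sq f x) \<partial>lebesgue))"

lemma form_bound_pot:
  assumes V: "form_bound V S" and d: "0 < d" "0 < \<mu>" and w: "bdd_density w"
  shows "(\<integral>\<^sup>+ x. ennreal (cmod (V x) * (pot \<mu> d w x)\<^sup>2) \<partial>lebesgue) \<le> S * ennreal (LINT y|lebesgue. w y * pot \<mu> d w y)"
proof -
  define \<zeta> :: complex where "\<zeta> = of_real \<mu>"
  have Re: "0 < Re \<zeta>" using d by (simp add: \<zeta>_def)
  let ?u = "conv (ker \<zeta> d) w" and ?v = "\<lambda>b. conv (dker \<zeta> d b) w"
  note D = decaying_ker[OF d(1) Re]
  note L = conv_L2[OF D(1) w] conv_L2[OF D(2) w]
  note W = conv_weak_deriv[OF d(1) Re w]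
  have u: "?u \<in> Sobolev 1" using L W by auto
  have "AE x in lebesgue. \<forall>b\<in>Basis. weak_deriv b ?u x = ?v b x"
    using weak_deriv_works(3)[OF W L(4)] by (simp add: AE_finite_all)
  then have ae: "AE x in lebesgue. grad_norm_sq ?u x = (\<Sum>b\<in>Basis. (cmod (?v b x))\<^sup>2)"
    by eventually_elim (simp add: grad_norm_sq_def)
  have int: "integrable lebesgue (\<lambda>x. \<Sum>b\<in>Basis. (cmod (?v b x))\<^sup>2)"
    using L2_integrable_sq[OF L(4)] by (intro Bochner_Integration.integrable_sum) auto
  have "(\<integral>\<^sup>+ x. ennreal (cmod (V x) * (pot \<mu> d w x)\<^sup>2) \<partial>lebesgue) = (\<integral>\<^sup>+ x. ennreal (cmod (V x) * (cmod (?u x))\<^sup>2) \<partial>lebesgue)"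
    by (simp add: \<zeta>_def conv_ker_of_real)
  also have "\<dots> \<le> S * (\<integral>\<^sup>+ x. ennreal (grad_norm_sq ?u x) \<partial>lebesgue)"
    using V u by (simp add: form_bound_def)
  also have "(\<integral>\<^sup>+ x. ennreal (grad_norm_sq ?u x) \<partial>lebesgue) = (\<integral>\<^sup>+ x. ennreal (\<Sum>b\<in>Basis. (cmod (?v b x))\<^sup>2) \<partial>lebesgue)"
    by (rule nn_integral_cong_AE, rule eventually_mono[OF ae]) simp
  also have "\<dots> = ennreal (LINT x|lebesgue. (\<Sum>b\<in>Basis. (cmod (?v b x))\<^sup>2))"
    by (rule nn_integral_eq_integral[OF int]) (simp add: sum_nonneg)
  also have "(LINT x|lebesgue. (\<Sum>b\<in>Basis. (cmod (?v b x))\<^sup>2)) = (\<Sum>b\<in>Basis. LINT x|lebesgue. (cmod (?v b x))\<^sup>2)"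
    using L2_integrable_sq[OF L(4)] by (intro Bochner_Integration.integral_sum) auto
  finally show ?thesis
    using pot_energy[OF d w] by (simp add: \<zeta>_def) (meson ennreal_leI mult_left_mono order_trans zero_le)
qed

section \<open>Representation of an eigenfunction\<close>

lemma cnj_ker: "cnj (ker \<zeta> d v) = ker (cnj \<zeta>) d v"
  by (simp add: ker_def expk_def exp_cnj)

lemma cnj_rho: "cnj (rho \<zeta> d v) = rho (cnj \<zeta>) d v"
  by (simp add: rho_def expk_def exp_cnj)

text \<open>
  The eigenvalue equation is tested with the conjugate of a translated kernel. Green's identity
  then eliminates the products of the kernel with \<open>\<psi>\<close> and \<open>\<Delta> \<psi>\<close> separately and leaves only
  \<open>z \<psi> - \<Delta> \<psi>\<close>. The last term vanishes when \<open>\<zeta>\<^sup>2 = - z\<close>.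
\<close>

lemma eigen_representation:
  assumes H: "(\<psi>, \<lambda>x. z\<^sup>2 * \<psi> x) \<in> H_op V" and d: "0 < d" "0 < Re \<zeta>"
  shows "(LINT y|lebesgue. rho \<zeta> d (y - x) * (z * \<psi> y - laplacian \<psi> y))
    = - (LINT y|lebesgue. V y * ker \<zeta> d (y - x) * \<psi> y)
      + (z + \<zeta>\<^sup>2) * (LINT y|lebesgue. ker \<zeta> d (y - x) * (z * \<psi> y - laplacian \<psi> y))"
proof -
  have \<psi>: "\<psi> \<in> Sobolev 2" and eq: "\<And>\<phi>. \<phi> \<in> Sobolev 2 \<Longrightarrow> form_h V \<phi> \<psi> = (LINT x|lebesgue. cnj (\<phi> x) * (z\<^sup>2 * \<psi> x))"
    using H by (auto simp: H_op_def)
  define k r where "k y = ker \<zeta> d (y - x)" and "r y = rho \<zeta> d (y - x)" for y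
  let ?\<phi> = "\<lambda>y. ker (cnj \<zeta>) d (y - x)"
  have d': "0 < Re (cnj \<zeta>)" using d by simp
  have S': "smooth_H2 ?\<phi>" using smooth_H2_translate[OF smooth_H2_ker[OF d(1) d']] .
  have S: "smooth_H2 k" unfolding k_def[abs_def] using smooth_H2_translate[OF smooth_H2_ker[OF d]] .
  have lk: "(\<Sum>b\<in>Basis. pd b (pd b k) y) = \<zeta>\<^sup>2 * k y - r y" for y
    unfolding k_def[abs_def] r_def by (rule laplacian_ker_translate[OF d])
  have L\<psi>: "\<psi> \<in> L2" "laplacian \<psi> \<in> L2" using Sobolev_L2[OF \<psi>] laplacian_L2[OF \<psi>] by auto
  have Lk: "k \<in> L2" "r \<in> L2"
    using L2_translate[OF decaying_integrable(2)[OF decaying_ker(1)[OF d]]]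
      L2_translate[OF decaying_integrable(2)[OF decaying_ker(4)[OF d]]] by (simp_all add: k_def[abs_def] r_def[abs_def])
  note I = L2_mult_integrable[OF Lk(1) L\<psi>(1)] L2_mult_integrable[OF Lk(1) L\<psi>(2)]
    L2_mult_integrable[OF Lk(2) L\<psi>(1)] L2_mult_integrable[OF Lk(2) L\<psi>(2)]
  define A where "A = (LINT y|lebesgue. k y * \<psi> y)"
  define B where "B = (LINT y|lebesgue. k y * laplacian \<psi> y)"
  define C where "C = (LINT y|lebesgue. r y * \<psi> y)"
  define E where "E = (LINT y|lebesgue. r y * laplacian \<psi> y)"
  define v where "v = (LINT y|lebesgue. V y * k y * \<psi> y)"
  have "AE y in lebesgue. cnj (laplacian ?\<phi> y) * laplacian \<psi> y = (\<zeta>\<^sup>2 * k y - r y) * laplacian \<psi> y"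
    using smooth_H2_laplacian[OF S'] unfolding laplacian_ker_translate[OF d(1) d']
    by eventually_elim (simp add: cnj_ker cnj_rho k_def r_def)
  then have "(LINT y|lebesgue. cnj (laplacian ?\<phi> y) * laplacian \<psi> y) = (LINT y|lebesgue. (\<zeta>\<^sup>2 * k y - r y) * laplacian \<psi> y)"
  proof (rule integral_cong_AE[rotated 2])
    have [measurable]: "laplacian ?\<phi> \<in> borel_measurable lebesgue"
      using L2_measurable[OF laplacian_L2[OF smooth_H2_Sobolev[OF S']]] .
    have [measurable]: "cnj \<in> borel_measurable borel"
      by (intro borel_measurable_continuous_onI continuous_intros)
    note [measurable] = L2_measurable[OF L\<psi>(2)] L2_measurable[OF Lk(1)] L2_measurable[OF Lk(2)]
    show "(\<lambda>y. cnj (laplacian ?\<phi> y) * laplacian \<psi> y) \<in> borel_measurable lebesgue"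
      "(\<lambda>y. (\<zeta>\<^sup>2 * k y - r y) * laplacian \<psi> y) \<in> borel_measurable lebesgue" by measurable
  qed
  also have "\<dots> = \<zeta>\<^sup>2 * B - E"
    using I by (simp add: B_def E_def left_diff_distrib mult.assoc)
  finally have "form_h V ?\<phi> \<psi> = \<zeta>\<^sup>2 * B - E + v"
    by (simp add: form_h_def v_def cnj_ker k_def)
  moreover have "(LINT y|lebesgue. cnj (?\<phi> y) * (z\<^sup>2 * \<psi> y)) = z\<^sup>2 * A"
    by (simp add: A_def cnj_ker k_def mult.left_commute)
  \<comment> \<open>The eigenvalue equation tested with the kernel.\<close>
  ultimately have 1: "\<zeta>\<^sup>2 * B - E + v = z\<^sup>2 * A"
    using eq[OF smooth_H2_Sobolev[OF S']] by simp
  have "(LINT y|lebesgue. \<psi> y * (\<zeta>\<^sup>2 * k y - r y)) = (LINT y|lebesgue. laplacian \<psi> y * k y)"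
    using laplacian_pairing[OF \<psi> S] by (simp only: lk)
  moreover have "(LINT y|lebesgue. \<psi> y * (\<zeta>\<^sup>2 * k y - r y)) = (LINT y|lebesgue. \<zeta>\<^sup>2 * (k y * \<psi> y) - r y * \<psi> y)"
    by (simp add: algebra_simps)
  moreover have "\<dots> = \<zeta>\<^sup>2 * A - C"
    using I by (simp add: A_def C_def)
  moreover have "(LINT y|lebesgue. laplacian \<psi> y * k y) = B" by (simp add: B_def mult.commute)
  ultimately have 2: "\<zeta>\<^sup>2 * A - C = B" by simp
  have "(LINT y|lebesgue. r y * (z * \<psi> y - laplacian \<psi> y)) = z * C - E"
    using I by (simp add: C_def E_def right_diff_distrib mult.left_commute)
  moreover have "(LINT y|lebesgue. k y * (z * \<psi> y - laplacian \<psi> y)) = z * A - B"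
    using I by (simp add: A_def B_def right_diff_distrib mult.left_commute)
  moreover have "z * C - E = - v + (z + \<zeta>\<^sup>2) * (z * A - B)"
    using 1 2 by algebra
  ultimately show ?thesis by (simp add: v_def k_def r_def)
qed

lemma cmod_ker_le:
  assumes "0 < t" "t \<le> Re \<zeta>"
  shows "cmod (ker \<zeta> t v) \<le> rker t t v"
proof -
  have s: "rad t v > 0" using rad_pos assms by auto
  then have "exp (- Re \<zeta> * rad t v) \<le> exp (- t * rad t v)" using assms by simp
  then show ?thesis using s mass_pos assms
    by (simp add: ker_def rker_def norm_divide cmod_expk divide_right_mono mult.commute[of mass])
qed

text \<open>
  A finite constant that bounds several integrals after scaling.
\<close>

definition decay_mass :: real where
  "decay_mass = (LINT x|lebesgue. 1 / ((norm (x::real^3))\<^sup>2 * (1 + norm x)\<^sup>2))"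

lemma integrable_decay: "integrable lebesgue (\<lambda>x::real^3. 1 / ((norm x)\<^sup>2 * (1 + norm x)\<^sup>2))"
  using integrable_inverse_sq_decay by (simp add: integrable_completion)

lemma AE_lebesgue_neq: "AE v in lebesgue. v \<noteq> (a::real^3)"
  by (rule AE_I'[of "{a}"]) auto

text \<open>
  Since \<open>exp (- t s) \<le> 1 / (1 + t r)\<close>, the square is bounded by a rescaled copy of the integrable
  model function; scaling by \<open>t\<close> in dimension three produces the factor \<open>1 / t\<close>.
\<close>

lemma rker_sq_integral:
  assumes t: "0 < t"
  shows "integrable lebesgue (\<lambda>v. (rker t t v)\<^sup>2)" "(LINT v|lebesgue. (rker t t v)\<^sup>2) \<le> decay_mass / mass\<^sup>2 / t"
proof -
  let ?q = "\<lambda>x::real^3. 1 / ((norm x)\<^sup>2 * (1 + norm x)\<^sup>2)"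
  have mq: "?q \<in> borel_measurable lebesgue" using integrable_decay by (rule borel_measurable_integrable)
  have int: "integrable lebesgue (\<lambda>v. ?q (0 + t *\<^sub>R v))"
    using integral_lebesgue_affine(1)[OF _ mq, of t 0] integrable_decay t by simp
  have val: "(LINT v|lebesgue. ?q (0 + t *\<^sub>R v)) = decay_mass / t ^ 3"
    using integral_lebesgue_affine(2)[OF _ mq, of t 0] t by (simp add: decay_mass_def field_simps power3_eq_cube)
  have le: "(rker t t v)\<^sup>2 \<le> t\<^sup>2 / mass\<^sup>2 * ?q (0 + t *\<^sub>R v)" if v: "v \<noteq> 0" for v
  proof -
    let ?s = "rad t v" and ?r = "norm v"
    have r: "0 < ?r" using v by simp
    have s: "?r \<le> ?s" using rad_ge by blast
    have "1 + t * ?r \<le> exp (t * ?r)" by (rule exp_ge_add_one_self)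
    also have "\<dots> \<le> exp (t * ?s)" using s t by simp
    finally have e: "exp (- t * ?s) \<le> 1 / (1 + t * ?r)"
      using divide_left_mono[of "1 + t * ?r" "exp (t * ?s)" 1] mult_pos_pos[OF t r]
      by (simp add: exp_minus inverse_eq_divide)
    have "rker t t v \<le> (1 / (1 + t * ?r)) / (mass * ?r)"
      unfolding rker_def using e s r t mass_pos by (intro frac_le) auto
    then have "(rker t t v)\<^sup>2 \<le> ((1 / (1 + t * ?r)) / (mass * ?r))\<^sup>2"
      using rker_nonneg[OF t] by (intro power_mono) auto
    also have "\<dots> = t\<^sup>2 / mass\<^sup>2 * ?q (0 + t *\<^sub>R v)"
      using t by (simp add: power_divide power_mult_distrib mult_ac)
    finally show ?thesis .
  qed
  have mk: "(\<lambda>v. (rker t t v)\<^sup>2) \<in> borel_measurable lebesgue"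
    by (intro borel_measurable_lebesgueI continuous_intros continuous_rker t)
  have AE: "AE v in lebesgue. (rker t t v)\<^sup>2 \<le> t\<^sup>2 / mass\<^sup>2 * ?q (0 + t *\<^sub>R v)"
    using AE_lebesgue_neq[of 0] by eventually_elim (rule le)
  show I: "integrable lebesgue (\<lambda>v. (rker t t v)\<^sup>2)"
  proof (rule Bochner_Integration.integrable_bound[OF integrable_mult_right[OF int] mk])
    show "AE v in lebesgue. norm ((rker t t v)\<^sup>2) \<le> norm (t\<^sup>2 / mass\<^sup>2 * ?q (0 + t *\<^sub>R v))"
      using AE by eventually_elim simp
  qed
  have "(LINT v|lebesgue. (rker t t v)\<^sup>2) \<le> (LINT v|lebesgue. t\<^sup>2 / mass\<^sup>2 * ?q (0 + t *\<^sub>R v))"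
    by (rule integral_mono_AE[OF I integrable_mult_right[OF int] AE])
  also have "\<dots> = t\<^sup>2 / mass\<^sup>2 * (decay_mass / t ^ 3)"
    unfolding val[symmetric] by (rule integral_mult_right_zero)
  also have "\<dots> = decay_mass / mass\<^sup>2 / t" using t by (simp add: power2_eq_square eval_nat_numeral)
  finally show "(LINT v|lebesgue. (rker t t v)\<^sup>2) \<le> decay_mass / mass\<^sup>2 / t" .
qed

text \<open>
  The kernel has \<open>L\<^sup>2\<close> norm of order \<open>t\<^sup>-\<^sup>1\<^sup>/\<^sup>2\<close>. A weighted arithmetic-geometric mean inequality
  replaces Cauchy-Schwarz.
\<close>

lemma resolvent_error:
  assumes f: "f \<in> L2" and t: "0 < t" "t \<le> Re \<zeta>"
  shows "cmod (LINT y|lebesgue. ker \<zeta> t (y - x) * f y)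
    \<le> (decay_mass / mass\<^sup>2 + (LINT y|lebesgue. (cmod (f y))\<^sup>2)) / sqrt t"
proof -
  have Re: "0 < Re \<zeta>" using t by linarith
  note T = rker_sq_integral[OF t(1)]
  have L: "(\<lambda>y. ker \<zeta> t (y - x)) \<in> L2"
    by (intro L2_translate decaying_integrable(2) decaying_ker t Re)
  have it: "integrable lebesgue (\<lambda>y. (rker t t (y - x))\<^sup>2)" using integrable_translate[OF T(1)] .
  have vt: "(LINT y|lebesgue. (rker t t (y - x))\<^sup>2) = (LINT v|lebesgue. (rker t t v)\<^sup>2)"
    using integral_lebesgue_affine(2)[of 1 "\<lambda>v. (rker t t v)\<^sup>2" "- x"] T(1) by (simp add: borel_measurable_integrable)
  have i2: "integrable lebesgue (\<lambda>y. sqrt t * (rker t t (y - x))\<^sup>2 + (cmod (f y))\<^sup>2 / sqrt t)"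
    using it L2_integrable_sq[OF f] by simp
  have "cmod (LINT y|lebesgue. ker \<zeta> t (y - x) * f y) \<le> (LINT y|lebesgue. norm (ker \<zeta> t (y - x) * f y))"
    by (rule integral_norm_bound)
  also have "\<dots> \<le> (LINT y|lebesgue. sqrt t * (rker t t (y - x))\<^sup>2 + (cmod (f y))\<^sup>2 / sqrt t)"
  proof (rule integral_mono[OF integrable_norm[OF L2_mult_integrable[OF L f]] i2])
    fix y
    let ?a = "rker t t (y - x)" and ?b = "cmod (f y)"
    have "norm (ker \<zeta> t (y - x) * f y) \<le> ?a * ?b"
      using cmod_ker_le[OF t] by (simp add: norm_mult mult_right_mono)
    \<comment> \<open>The weight balances the squared kernel, of order 1 / t, against the square of f.\<close>
    also have "\<dots> = (root 4 t * ?a) * (?b / root 4 t)" using t by simp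
    also have "\<dots> \<le> (root 4 t * ?a)\<^sup>2 + (?b / root 4 t)\<^sup>2" by (rule mult_le_sum_sq)
    also have "\<dots> = sqrt t * ?a\<^sup>2 + ?b\<^sup>2 / sqrt t"
    proof -
      have "(root 4 t)\<^sup>2 = sqrt t"
      proof (rule real_sqrt_unique[symmetric])
        show "((root 4 t)\<^sup>2)\<^sup>2 = t" using t real_root_pow_pos2[of 4 t] by (simp flip: power_mult)
      qed simp
      then show ?thesis by (simp add: power_mult_distrib power_divide)
    qed
    finally show "norm (ker \<zeta> t (y - x) * f y) \<le> sqrt t * ?a\<^sup>2 + ?b\<^sup>2 / sqrt t" .
  qed
  also have "\<dots> = sqrt t * (LINT v|lebesgue. (rker t t v)\<^sup>2) + (LINT y|lebesgue. (cmod (f y))\<^sup>2) / sqrt t"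
    using it L2_integrable_sq[OF f] by (simp add: vt)
  also have "\<dots> \<le> sqrt t * (decay_mass / mass\<^sup>2 / t) + (LINT y|lebesgue. (cmod (f y))\<^sup>2) / sqrt t"
    using T(2) t by (intro add_right_mono mult_left_mono) auto
  also have "sqrt t * (decay_mass / mass\<^sup>2 / t) = decay_mass / mass\<^sup>2 / sqrt t"
  proof -
    have "r * (D / m / (r * r)) = D / m / r" if "r > 0" for r D m :: real using that by simp
    from this[of "sqrt t"] t show ?thesis by simp
  qed
  finally show ?thesis by (simp add: add_divide_distrib)
qed

section \<open>Averages over boxes of mollified functions\<close>

lemma rho_minus: "rho \<zeta> d (x - y) = rho \<zeta> d (y - x)"
  by (simp add: rho_def expk_def rad_minus(2)[of d x y])

lemma mollified_box_Fubini:
  assumes f: "f \<in> L2" and d: "0 < d" "0 < Re \<zeta>"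
  shows "(LINT x|lebesgue. indicator (box l u) x * (LINT y|lebesgue. rho \<zeta> d (y - x) * f y))
    = (LINT y|lebesgue. (LINT x|lebesgue. rho \<zeta> d (x - y) * indicator (box l u) x) * f y)"
    "(\<lambda>x. LINT y|lebesgue. rho \<zeta> d (y - x) * f y) \<in> borel_measurable lebesgue"
proof -
  have D: "decaying (rho \<zeta> d)" by (rule decaying_ker[OF d])
  have L: "(\<lambda>y. rho \<zeta> d (x - y)) \<in> L2" for x
    unfolding rho_minus[of \<zeta> d x] by (rule L2_translate[OF decaying_integrable(2)[OF D]])
  have ind: "integrable lebesgue (indicator (box l u) :: real^3 \<Rightarrow> complex)"
  proof -
    have "integrable lebesgue (\<lambda>x. complex_of_real (indicator (box l u) x))"
      by (intro integrable_of_real integrable_real_indicator) (auto simp: emeasure_lborel_box_eq)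
    moreover have "(indicator (box l u) :: real^3 \<Rightarrow> complex) = (\<lambda>x. complex_of_real (indicator (box l u) x))"
      by (auto simp: indicator_def)
    ultimately show ?thesis by (simp only:)
  qed
  have int: "integrable lebesgue (\<lambda>y. rho \<zeta> d (x - y) * f y)" for x by (rule L2_mult_integrable[OF L f])
  have B: "(LINT y|lebesgue. norm (rho \<zeta> d (x - y) * f y)) \<le> (LINT v|lebesgue. (cmod (rho \<zeta> d v))\<^sup>2) + (LINT y|lebesgue. (cmod (f y))\<^sup>2)" for x
  proof -
    have "(LINT y|lebesgue. norm (rho \<zeta> d (x - y) * f y)) \<le> (LINT y|lebesgue. (cmod (rho \<zeta> d (x - y)))\<^sup>2 + (cmod (f y))\<^sup>2)"
      by (rule integral_mono[OF integrable_norm[OF int]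
            Bochner_Integration.integrable_add[OF L2_integrable_sq[OF L] L2_integrable_sq[OF f]]])
         (simp add: norm_mult mult_le_sum_sq)
    also have "\<dots> = (LINT y|lebesgue. (cmod (rho \<zeta> d (x - y)))\<^sup>2) + (LINT y|lebesgue. (cmod (f y))\<^sup>2)"
      using L2_integrable_sq[OF L] L2_integrable_sq[OF f] by simp
    also have "(LINT y|lebesgue. (cmod (rho \<zeta> d (x - y)))\<^sup>2) = (LINT v|lebesgue. (cmod (rho \<zeta> d v))\<^sup>2)"
      unfolding rho_minus[of \<zeta> d x]
      using integral_lebesgue_affine(2)[of 1 "\<lambda>v. (cmod (rho \<zeta> d v))\<^sup>2" "- x"] L2_integrable_sq[OF decaying_integrable(2)[OF D]]
      by (simp add: borel_measurable_integrable)
    finally show ?thesis .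
  qed
  have ck: "continuous_on UNIV (rho \<zeta> d)" using D by (simp add: decaying_def)
  note F = kernel_Fubini[OF ind L2_measurable[OF f] ck int B]
  from F(1) show "(LINT x|lebesgue. indicator (box l u) x * (LINT y|lebesgue. rho \<zeta> d (y - x) * f y))
    = (LINT y|lebesgue. (LINT x|lebesgue. rho \<zeta> d (x - y) * indicator (box l u) x) * f y)"
    unfolding rho_minus[of \<zeta> d _ "_::real^3"] by (simp only: mult.commute rho_minus)
  from F(2) show "(\<lambda>x. LINT y|lebesgue. rho \<zeta> d (y - x) * f y) \<in> borel_measurable lebesgue"
    by (simp only: rho_minus)
qed

lemma rad1_le_of_far:
  assumes "norm x \<le> R" "0 \<le> R" "2 * R + 1 \<le> norm y"
  shows "rad 1 y \<le> 4 * norm (x - y)"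
proof -
  have "norm y - norm x \<le> norm (x - y)" by (metis norm_minus_commute norm_triangle_ineq2)
  then have "norm y \<le> 2 * norm (x - y)" using assms by linarith
  moreover have "rad 1 y \<le> 2 * norm y"
  proof -
    have "1 \<le> (norm y)\<^sup>2" using assms by (intro one_le_power) linarith
    then have "(norm y)\<^sup>2 + 1\<^sup>2 \<le> (2 * norm y)\<^sup>2" by (simp add: power_mult_distrib)
    then show ?thesis unfolding rad_def by (intro real_le_lsqrt) auto
  qed
  ultimately show ?thesis by linarith
qed

text \<open>
  A bound on the mollified indicator that is uniform in the regularisation and square integrable.
  Far from the box the kernel itself is at most a constant times \<open>|y|\<^sup>-\<^sup>4\<close>; near the box the
  \<open>L\<^sup>1\<close> norm of the mollifier, which is scale invariant, suffices.
\<close>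

lemma mollified_box_decay:
  assumes M: "0 \<le> M"
  obtains D where "\<And>d \<zeta> y. \<lbrakk>0 < d; d \<le> 1; d \<le> Re \<zeta>; cmod \<zeta> \<le> M\<rbrakk> \<Longrightarrow>
    cmod (LINT x|lebesgue. rho \<zeta> d (x - y) * indicator (box l u) x) \<le> D / rad 1 y ^ 4"
proof -
  obtain R where R: "0 \<le> R" "\<And>x. x \<in> box l u \<Longrightarrow> norm x \<le> R"
    using bounded_box[of l u] unfolding bounded_pos by (meson less_imp_le)
  define K where "K = (3 + 3 * M + M\<^sup>2) / mass"
  have K0: "K \<ge> 0" using M mass_pos by (auto simp: K_def)
  let ?p = "\<lambda>u::real^3. 1 / rad 1 u ^ 4"
  have mp: "?p \<in> borel_measurable lebesgue"
    by (intro borel_measurable_lebesgueI continuous_intros) (use rad_ne_0[of 1] in auto)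
  have ip: "integrable lebesgue ?p"
    by (rule integrable_of_decay[OF zero_less_one mp, where C=1]) simp
  define P where "P = (LINT u|lebesgue. ?p u)"
  have P0: "P \<ge> 0" unfolding P_def by (intro integral_nonneg_AE) simp
  define vol where "vol = measure lebesgue (box l u)"
  have iv: "integrable lebesgue (\<lambda>x. indicator (box l u) x :: real)"
    by (rule integrable_real_indicator) (auto simp: emeasure_lborel_box_eq)
  define D where "D = K * P * (2 * R + 2) ^ 4 + 256 * K * vol"
  have "cmod (LINT x|lebesgue. rho \<zeta> d (x - y) * indicator (box l u) x) \<le> D / rad 1 y ^ 4"
    if d: "0 < d" "d \<le> 1" "d \<le> Re \<zeta>" "cmod \<zeta> \<le> M" for d \<zeta> y
  proof -
    have Re: "0 < Re \<zeta>" using d by linarith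
    have s1: "rad 1 y > 0" by (rule rad_pos) simp
    have ir: "integrable lebesgue (\<lambda>x. rho \<zeta> d (x - y))"
      by (rule integrable_translate[OF decaying_integrable(1)[OF decaying_ker(4)[OF d(1) Re]]])
    have ri: "integrable lebesgue (\<lambda>x. norm (rho \<zeta> d (x - y) * indicator (box l u) x))"
    proof (rule integrable_norm)
      have "integrable lebesgue (\<lambda>x. indicator (box l u) x *\<^sub>R rho \<zeta> d (x - y))"
        by (rule integrable_mult_indicator[OF _ ir]) simp
      moreover have "indicator (box l u) x *\<^sub>R rho \<zeta> d (x - y) = rho \<zeta> d (x - y) * indicator (box l u) x" for x
        by (simp add: indicator_def)
      ultimately show "integrable lebesgue (\<lambda>x. rho \<zeta> d (x - y) * indicator (box l u) x)" by (simp only:)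
    qed
    have 0: "cmod (LINT x|lebesgue. rho \<zeta> d (x - y) * indicator (box l u) x)
      \<le> (LINT x|lebesgue. norm (rho \<zeta> d (x - y) * indicator (box l u) x))"
      by (rule integral_norm_bound)
    have rb: "cmod (rho \<zeta> d v) \<le> K * d / rad d v ^ 4" for v
      unfolding K_def by (rule rho_bound[OF d])
    show ?thesis
    proof (cases "2 * R + 1 \<le> norm y")
      case True
      have "(LINT x|lebesgue. norm (rho \<zeta> d (x - y) * indicator (box l u) x)) \<le> (LINT x|lebesgue. (256 * K / rad 1 y ^ 4) * indicator (box l u) x)"
      proof (rule integral_mono[OF ri integrable_mult_right[OF iv]])
        fix x
        show "norm (rho \<zeta> d (x - y) * indicator (box l u) x) \<le> (256 * K / rad 1 y ^ 4) * indicator (box l u) x"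
        proof (cases "x \<in> box l u")
          case x: True
          have "rad 1 y \<le> 4 * norm (x - y)" by (rule rad1_le_of_far[OF R(2)[OF x] R(1) True])
          also have "\<dots> \<le> 4 * rad d (x - y)" using rad_ge(1)[of "x - y" d] by simp
          finally have "rad 1 y ^ 4 \<le> (4 * rad d (x - y)) ^ 4" using s1 by (intro power_mono) auto
          then have "K * d * rad 1 y ^ 4 \<le> K * 1 * (4 * rad d (x - y)) ^ 4"
            using K0 d s1 by (intro mult_mono) auto
          then have "K * d / rad d (x - y) ^ 4 \<le> 256 * K / rad 1 y ^ 4"
            using s1 rad_pos[OF d(1), of "x - y"] by (simp add: divide_le_eq le_divide_eq power_mult_distrib mult_ac)
          then show ?thesis using x rb[of "x - y"] by simp
        qed simp
      qed
      also have "\<dots> = 256 * K * vol / rad 1 y ^ 4" by (simp add: vol_def)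
      also have "\<dots> \<le> D / rad 1 y ^ 4"
        using s1 K0 P0 R(1) by (intro divide_right_mono) (auto simp: D_def)
      finally show ?thesis using 0 by linarith
    next
      case False
      have is1: "integrable lebesgue (\<lambda>x. K * d / rad d (x - y) ^ 4)"
      proof (rule integrable_translate[where f="\<lambda>v. K * d / rad d v ^ 4"])
        have "(\<lambda>v. K * d / rad d v ^ 4) \<in> borel_measurable lebesgue"
          by (intro borel_measurable_lebesgueI continuous_intros) (use rad_ne_0[OF d(1)] in auto)
        then show "integrable lebesgue (\<lambda>v. K * d / rad d v ^ 4)"
          by (rule integrable_of_decay[OF d(1), where C="K * d"]) (use K0 d rad_pos[OF d(1)] in simp)
      qed
      have m: "(\<lambda>x. K * d / rad d (x - y) ^ 4) \<in> borel_measurable lebesgue"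
        using is1 by (rule borel_measurable_integrable)
      have "(LINT x|lebesgue. norm (rho \<zeta> d (x - y) * indicator (box l u) x)) \<le> (LINT x|lebesgue. K * d / rad d (x - y) ^ 4)"
        using rb K0 d rad_pos[OF d(1)] by (intro integral_mono[OF ri is1]) (auto simp: indicator_def)
      also have "\<dots> = d ^ 3 *\<^sub>R (LINT v|lebesgue. K * d / rad d (d *\<^sub>R v) ^ 4)"
        using integral_lebesgue_affine(2)[OF _ m, of d y] d by simp
      also have "(LINT v|lebesgue. K * d / rad d (d *\<^sub>R v) ^ 4) = (LINT v|lebesgue. K / d ^ 3 * ?p v)"
        using d rad_pos[of 1] by (intro Bochner_Integration.integral_cong refl)
          (simp add: rad_scale power_mult_distrib eval_nat_numeral)
      also have "\<dots> = K / d ^ 3 * P" unfolding P_def by (rule integral_mult_right_zero)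
      also have "d ^ 3 *\<^sub>R (K / d ^ 3 * P) = K * P" using d by simp
      also have "\<dots> \<le> D / rad 1 y ^ 4"
      proof -
        have "rad 1 y \<le> rad 1 0 + norm y" using rad1_shift[of y y] by simp
        then have "rad 1 y \<le> 2 * R + 2" using False by (simp add: rad_def)
        then have "rad 1 y ^ 4 \<le> (2 * R + 2) ^ 4" using s1 by (intro power_mono) auto
        then have "K * P * rad 1 y ^ 4 \<le> K * P * (2 * R + 2) ^ 4 + 256 * K * vol"
          using K0 P0 by (intro add_increasing2 mult_left_mono) (auto simp: vol_def)
        then show ?thesis using s1 by (simp add: le_divide_eq D_def)
      qed
      finally show ?thesis using 0 by linarith
    qed
  qed
  then show ?thesis by (rule that)
qed

text \<open>
  Moving the mollifier from \<open>f\<close> to the indicator by Fubini, where it converges pointwise off the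
  frontier of the box, gives weak convergence without any regularity of \<open>f\<close>.
\<close>

lemma mollified_box_tendsto:
  assumes f: "f \<in> L2"
    and d: "\<And>n. 0 < d n" "\<And>n. d n \<le> 1" "d \<longlonglongrightarrow> 0"
    and \<zeta>: "\<And>n. d n \<le> Re (\<zeta> n)" "\<And>n. cmod (\<zeta> n) \<le> M"
  shows "(\<lambda>n. LINT x|lebesgue. indicator (box l u) x * (LINT y|lebesgue. rho (\<zeta> n) (d n) (y - x) * f y))
     \<longlonglongrightarrow> (LINT x|lebesgue. indicator (box l u) x * f x)"
proof -
  have M0: "M \<ge> 0" using norm_ge_zero \<zeta>(2) order_trans by blast
  have Re: "Re (\<zeta> n) > 0" for n using d(1) \<zeta>(1) by (rule less_le_trans)
  obtain D where D: "\<And>d \<zeta> y. \<lbrakk>0 < d; d \<le> 1; d \<le> Re \<zeta>; cmod \<zeta> \<le> M\<rbrakk> \<Longrightarrow>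
    cmod (LINT x|lebesgue. rho \<zeta> d (x - y) * indicator (box l u) x) \<le> D / rad 1 y ^ 4"
    using mollified_box_decay[OF M0, of l u] by blast
  let ?m = "\<lambda>n y. LINT x|lebesgue. rho (\<zeta> n) (d n) (x - y) * indicator (box l u) x"
  have mi: "(indicator (box l u) :: real^3 \<Rightarrow> complex) \<in> borel_measurable lebesgue"
    by (rule borel_measurable_indicator) simp
  have mm: "?m n \<in> borel_measurable lebesgue" for n
  proof -
    have "decaying (rho (\<zeta> n) (d n))" by (rule decaying_ker[OF d(1) Re])
    note k = this
    have c: "continuous_on UNIV (rho (\<zeta> n) (d n))" using k by (simp add: decaying_def)
    from conv_decay(3)[OF k bdd_density_indicator_box[of l u]]
    have "(\<lambda>x. LINT y|lebesgue. rho (\<zeta> n) (d n) (x - y) * of_real (indicator (box l u) y)) \<in> borel_measurable lebesgue"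
      by (simp add: conv_def[abs_def])
    moreover have "complex_of_real (indicator (box l u) y) = indicator (box l u) y" for y :: "real^3"
      by (simp add: indicator_def)
    ultimately show ?thesis by (simp only: rho_minus)
  qed
  have "(\<lambda>y. complex_of_real (D / rad 1 y ^ 4)) \<in> L2"
  proof (rule decay_integrable_L2(2))
    show "(\<lambda>y. complex_of_real (D / rad 1 y ^ 4)) \<in> borel_measurable lebesgue"
      by (intro borel_measurable_lebesgueI continuous_intros) (use rad_ne_0[of 1] in auto)
    show "cmod (complex_of_real (D / rad 1 y ^ 4)) \<le> \<bar>D\<bar> / rad 1 y ^ 4" for y
      using rad_pos[of 1 y] by (simp add: norm_divide norm_power)
  qed
  from integrable_norm[OF L2_mult_integrable[OF this f]]
  have iw: "integrable lebesgue (\<lambda>y. norm (complex_of_real (D / rad 1 y ^ 4) * f y))" .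
  have lim: "(\<lambda>n. LINT y|lebesgue. ?m n y * f y) \<longlonglongrightarrow> (LINT y|lebesgue. indicator (box l u) y * f y)"
  proof (rule integral_dominated_convergence[OF _ _ iw])
    show "(\<lambda>y. indicator (box l u) y * f y) \<in> borel_measurable lebesgue"
      using mi L2_measurable[OF f] by measurable
    show "(\<lambda>y. ?m n y * f y) \<in> borel_measurable lebesgue" for n
      using mm L2_measurable[OF f] by measurable
    show "AE y in lebesgue. norm (?m n y * f y) \<le> norm (complex_of_real (D / rad 1 y ^ 4) * f y)" for n
    proof (rule AE_I2)
      fix y
      have b: "cmod (?m n y) \<le> D / rad 1 y ^ 4" by (rule D[OF d(1,2) \<zeta>])
      have "norm (?m n y * f y) = cmod (?m n y) * cmod (f y)" by (rule norm_mult)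
      also have "\<dots> \<le> D / rad 1 y ^ 4 * cmod (f y)" by (rule mult_right_mono[OF b]) simp
      also have "\<dots> \<le> \<bar>D / rad 1 y ^ 4\<bar> * cmod (f y)" by (intro mult_right_mono abs_ge_self) simp
      also have "\<dots> = norm (complex_of_real (D / rad 1 y ^ 4) * f y)" by (simp only: norm_mult norm_of_real)
      finally show "norm (?m n y * f y) \<le> norm (complex_of_real (D / rad 1 y ^ 4) * f y)" .
    qed
    have "AE y in lebesgue. y \<notin> frontier (box l u)"
      by (rule AE_I'[of "frontier (box l u)"]) (auto simp: negligible_iff_null_sets[symmetric] negligible_convex_frontier)
    then show "AE y in lebesgue. (\<lambda>n. ?m n y * f y) \<longlonglongrightarrow> indicator (box l u) y * f y"
    proof eventually_elim
      case (elim y)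
      have "isCont (indicator (box l u) :: real^3 \<Rightarrow> complex) y"
      proof -
        have "isCont (\<lambda>y. complex_of_real (indicator (box l u) y)) y"
          by (rule continuous_of_real) (use elim isCont_indicator[of y "box l u"] in blast)
        moreover have "(\<lambda>y. complex_of_real (indicator (box l u) y)) = (indicator (box l u) :: real^3 \<Rightarrow> complex)"
          by (auto simp: indicator_def)
        ultimately show ?thesis by (simp only:)
      qed
      then have "(\<lambda>n. ?m n y) \<longlonglongrightarrow> indicator (box l u) y"
        by (rule rho_approximates_identity[where B=1 and M=M, OF mi _ _ d \<zeta>, rotated]) (simp add: indicator_def)
      then show ?case by (intro tendsto_intros)
    qed
  qed
  show ?thesis
    unfolding mollified_box_Fubini(1)[OF f d(1) Re] by (rule lim)
qed

section \<open>Domination by the potential\<close>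

text \<open>
  The potential of a nonnegative function that need not be integrable, with the regularisation and the
  shift of \<open>\<zeta>\<close> coupled to the same parameter. It increases to the Newtonian potential as \<open>t\<close>
  decreases to \<open>0\<close>.
\<close>

definition epot :: "real \<Rightarrow> (real^3 \<Rightarrow> real) \<Rightarrow> real^3 \<Rightarrow> ennreal" where
  "epot t g x = (\<integral>\<^sup>+ y. ennreal (rker t t (x - y) * g y) \<partial>lebesgue)"

lemma rker_measurable_pair:
  assumes "0 < t" "g \<in> borel_measurable lebesgue"
  shows "(\<lambda>(x, y). ennreal (rker t t (x - y) * g y)) \<in> borel_measurable (lebesgue \<Otimes>\<^sub>M lebesgue)"
proof -
  note [measurable] = assms(2) measurable_difference_kernel[OF borel_measurable_continuous_onI[OF continuous_rker[OF assms(1)]], of t]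
  show ?thesis by measurable
qed

lemma epot_measurable: "0 < t \<Longrightarrow> g \<in> borel_measurable lebesgue \<Longrightarrow> epot t g \<in> borel_measurable lebesgue"
  unfolding epot_def[abs_def] using leb.borel_measurable_nn_integral[OF rker_measurable_pair] by simp

lemma epot_mono:
  assumes "0 < t" "t \<le> t'" "\<And>y. 0 \<le> g y"
  shows "epot t' g x \<le> epot t g x"
  unfolding epot_def using assms by (intro nn_integral_mono ennreal_leI mult_right_mono rker_mono) auto

lemma epot_pairing:
  assumes t: "0 < t" and g: "g \<in> borel_measurable lebesgue" "\<And>y. 0 \<le> g y" and w: "bdd_density w"
  shows "(\<integral>\<^sup>+ x. ennreal (w x) * epot t g x \<partial>lebesgue) = (\<integral>\<^sup>+ y. ennreal (g y * pot t t w y) \<partial>lebesgue)"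
proof -
  have w0: "0 \<le> w x" and mw: "w \<in> borel_measurable lebesgue" for x using w by (auto simp: bdd_density_def)
  have k0: "0 \<le> rker t t v" for v by (rule rker_nonneg[OF t])
  have m: "(\<lambda>(x, y). ennreal (rker t t (x - y) * g y * w x)) \<in> borel_measurable (lebesgue \<Otimes>\<^sub>M lebesgue)"
  proof -
    note [measurable] = g(1) mw measurable_difference_kernel[OF borel_measurable_continuous_onI[OF continuous_rker[OF t]], of t]
    show ?thesis by measurable
  qed
  have "(\<integral>\<^sup>+ x. ennreal (w x) * epot t g x \<partial>lebesgue) = (\<integral>\<^sup>+ x. \<integral>\<^sup>+ y. ennreal (rker t t (x - y) * g y * w x) \<partial>lebesgue \<partial>lebesgue)"
  proof (rule nn_integral_cong)
    fix x
    have "(\<lambda>y. ennreal (rker t t (x - y) * g y)) \<in> borel_measurable lebesgue"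
      using measurable_compose[OF measurable_Pair1' rker_measurable_pair[OF t g(1)], of x] by simp
    then have "ennreal (w x) * epot t g x = (\<integral>\<^sup>+ y. ennreal (w x) * ennreal (rker t t (x - y) * g y) \<partial>lebesgue)"
      unfolding epot_def by (rule nn_integral_cmult[symmetric])
    also have "\<dots> = (\<integral>\<^sup>+ y. ennreal (rker t t (x - y) * g y * w x) \<partial>lebesgue)"
      using w0 k0 g(2) by (intro nn_integral_cong) (simp add: ennreal_mult[symmetric] mult.commute)
    finally show "ennreal (w x) * epot t g x = \<dots>" .
  qed
  also have "\<dots> = (\<integral>\<^sup>+ y. \<integral>\<^sup>+ x. ennreal (rker t t (x - y) * g y * w x) \<partial>lebesgue \<partial>lebesgue)"
    using leb2.Fubini'[OF m] by simp
  also have "\<dots> = (\<integral>\<^sup>+ y. ennreal (g y * pot t t w y) \<partial>lebesgue)"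
  proof (rule nn_integral_cong)
    fix y
    have "(\<integral>\<^sup>+ x. ennreal (rker t t (x - y) * g y * w x) \<partial>lebesgue) = (\<integral>\<^sup>+ x. ennreal (g y * (rker t t (y - x) * w x)) \<partial>lebesgue)"
      by (simp add: rker_minus[of t t y] mult_ac)
    also have "\<dots> = ennreal (LINT x|lebesgue. g y * (rker t t (y - x) * w x))"
      using g(2) k0 w0 by (intro nn_integral_eq_integral integrable_mult_right pot_integrable[OF t t w]) auto
    also have "\<dots> = ennreal (g y * pot t t w y)" by (simp add: pot_def)
    finally show "(\<integral>\<^sup>+ x. ennreal (rker t t (x - y) * g y * w x) \<partial>lebesgue) = \<dots>" .
  qed
  finally show ?thesis .
qed

text \<open>
  The duality behind the theorem: \<open>\<integral> w N g = \<integral> g N w\<close> by symmetry of the kernel, \<open>g\<close> is split as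
  \<open>|V|\<^bsup>1/2\<^esup> |\<psi>|\<close> times \<open>|V|\<^bsup>1/2\<^esup>\<close>, and the form bound controls \<open>\<integral> |V| (N w)\<^sup>2\<close> by the energy of \<open>w\<close>.
\<close>

lemma epot_Cauchy_Schwarz:
  assumes V: "V \<in> borel_measurable lebesgue" "form_bound V S" and \<psi>: "\<psi> \<in> borel_measurable lebesgue"
    and t: "0 < t" and w: "bdd_density w"
  shows "(\<integral>\<^sup>+ x. ennreal (w x) * epot t (\<lambda>y. cmod (V y) * cmod (\<psi> y)) x \<partial>lebesgue)\<^sup>2
    \<le> (\<integral>\<^sup>+ x. ennreal (cmod (V x) * (cmod (\<psi> x))\<^sup>2) \<partial>lebesgue) * (S * ennreal (LINT y|lebesgue. w y * pot t t w y))"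
proof -
  note [measurable] = V(1) \<psi> pot_integrable(2)[OF t t w]
  have p0: "0 \<le> pot t t w y" for y by (rule pot_nonneg[OF t w])
  have "(\<integral>\<^sup>+ x. ennreal (w x) * epot t (\<lambda>y. cmod (V y) * cmod (\<psi> y)) x \<partial>lebesgue)
    = (\<integral>\<^sup>+ y. ennreal (cmod (V y) * cmod (\<psi> y) * pot t t w y) \<partial>lebesgue)"
    by (rule epot_pairing[OF t _ _ w]) auto
  also have "\<dots> = (\<integral>\<^sup>+ y. ennreal (sqrt (cmod (V y)) * cmod (\<psi> y)) * ennreal (sqrt (cmod (V y)) * pot t t w y) \<partial>lebesgue)"
  proof (rule nn_integral_cong)
    fix y
    have "(s * a) * (s * p) = (s * s) * a * p" for s a p :: real by (simp only: mult_ac)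
    from this[of "sqrt (cmod (V y))" "cmod (\<psi> y)" "pot t t w y"]
    have "cmod (V y) * cmod (\<psi> y) * pot t t w y = (sqrt (cmod (V y)) * cmod (\<psi> y)) * (sqrt (cmod (V y)) * pot t t w y)"
      by simp
    then show "ennreal (cmod (V y) * cmod (\<psi> y) * pot t t w y) = ennreal (sqrt (cmod (V y)) * cmod (\<psi> y)) * ennreal (sqrt (cmod (V y)) * pot t t w y)"
      using p0[of y] by (subst ennreal_mult[symmetric]) auto
  qed
  also have "\<dots>\<^sup>2 \<le> (\<integral>\<^sup>+ y. ennreal (sqrt (cmod (V y)) * cmod (\<psi> y)) ^ 2 \<partial>lebesgue) *
      (\<integral>\<^sup>+ y. ennreal (sqrt (cmod (V y)) * pot t t w y) ^ 2 \<partial>lebesgue)"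
    by (rule Cauchy_Schwarz_nn_integral) measurable
  also have "(\<integral>\<^sup>+ y. ennreal (sqrt (cmod (V y)) * cmod (\<psi> y)) ^ 2 \<partial>lebesgue) = (\<integral>\<^sup>+ y. ennreal (cmod (V y) * (cmod (\<psi> y))\<^sup>2) \<partial>lebesgue)"
    by (intro nn_integral_cong) (simp add: ennreal_power power_mult_distrib)
  also have "(\<integral>\<^sup>+ y. ennreal (sqrt (cmod (V y)) * pot t t w y) ^ 2 \<partial>lebesgue) = (\<integral>\<^sup>+ y. ennreal (cmod (V y) * (pot t t w y)\<^sup>2) \<partial>lebesgue)"
    using p0 by (intro nn_integral_cong) (simp add: ennreal_power power_mult_distrib)
  also have "\<dots> \<le> S * ennreal (LINT y|lebesgue. w y * pot t t w y)"
    by (rule form_bound_pot[OF V(2) t t w])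
  finally show ?thesis by (simp add: mult_left_mono)
qed

lemma ennreal_norm_integral_le:
  fixes f :: "'a \<Rightarrow> 'b::{banach, second_countable_topology}"
  shows "ennreal (norm (integral\<^sup>L M f)) \<le> (\<integral>\<^sup>+ x. ennreal (norm (f x)) \<partial>M)"
  by (cases "integrable M f") (auto intro: integral_norm_bound_ennreal simp: not_integrable_integral_eq)

text \<open>
  In the representation formula the kernel is estimated by its modulus, where the oscillation of
  \<open>exp (- \<zeta> s)\<close> is lost and only \<open>exp (- t s) / s\<close> remains. The error is controlled by
  \<open>|z + (\<zeta>\<^sub>0 + t)\<^sup>2| \<le> (2 |\<zeta>\<^sub>0| + 1) t\<close>.
\<close>

lemma mollified_eigenfunction_le:
  assumes H: "(\<psi>, \<lambda>x. z\<^sup>2 * \<psi> x) \<in> H_op V" and t: "0 < t" "t \<le> 1"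
    and \<zeta>0: "\<zeta>0\<^sup>2 = - z" "0 \<le> Re \<zeta>0"
  defines "f \<equiv> \<lambda>y. z * \<psi> y - laplacian \<psi> y"
  shows "ennreal (cmod (LINT y|lebesgue. rho (\<zeta>0 + of_real t) t (y - x) * f y))
    \<le> epot t (\<lambda>y. cmod (V y) * cmod (\<psi> y)) x
      + ennreal ((2 * cmod \<zeta>0 + 1) * (decay_mass / mass\<^sup>2 + (LINT y|lebesgue. (cmod (f y))\<^sup>2)) * sqrt t)"
proof -
  define \<zeta> where "\<zeta> = \<zeta>0 + of_real t"
  have Re: "t \<le> Re \<zeta>" "0 < Re \<zeta>" using \<zeta>0 t by (auto simp: \<zeta>_def)
  have \<psi>: "\<psi> \<in> Sobolev 2" using H by (auto simp: H_op_def)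
  have f: "f \<in> L2" unfolding f_def by (rule shifted_laplacian_L2[OF \<psi>])
  let ?E = "decay_mass / mass\<^sup>2 + (LINT y|lebesgue. (cmod (f y))\<^sup>2)"
  define a where "a = (LINT y|lebesgue. V y * ker \<zeta> t (y - x) * \<psi> y)"
  define b where "b = (LINT y|lebesgue. ker \<zeta> t (y - x) * f y)"
  have eq: "(LINT y|lebesgue. rho \<zeta> t (y - x) * f y) = - a + (z + \<zeta>\<^sup>2) * b"
    unfolding a_def b_def f_def by (rule eigen_representation[OF H t(1) Re(2)])
  have E0: "?E \<ge> 0"
    by (intro add_nonneg_nonneg divide_nonneg_nonneg integral_nonneg_AE) (auto simp: decay_mass_def intro!: integral_nonneg_AE)
  have "z + \<zeta>\<^sup>2 = of_real t * (2 * \<zeta>0 + of_real t)"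
    using \<zeta>0(1) by (simp add: \<zeta>_def power2_eq_square algebra_simps)
  then have "cmod (z + \<zeta>\<^sup>2) = t * cmod (2 * \<zeta>0 + of_real t)" using t by (simp add: norm_mult)
  also have "\<dots> \<le> t * (2 * cmod \<zeta>0 + 1)"
    using t norm_triangle_ineq[of "2 * \<zeta>0" "of_real t"] by (intro mult_left_mono) (auto simp: norm_mult)
  finally have 1: "cmod (z + \<zeta>\<^sup>2) \<le> t * (2 * cmod \<zeta>0 + 1)" .
  have "cmod ((z + \<zeta>\<^sup>2) * b) \<le> (t * (2 * cmod \<zeta>0 + 1)) * (?E / sqrt t)"
    unfolding norm_mult b_def using 1 t by (intro mult_mono resolvent_error[OF f t(1) Re(1)]) auto
  also have "\<dots> = (2 * cmod \<zeta>0 + 1) * ?E * sqrt t"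
  proof -
    have "r * r * q * (e / r) = q * e * r" if "r > 0" for r q e :: real using that by simp
    from this[of "sqrt t" "2 * cmod \<zeta>0 + 1" ?E] t show ?thesis by simp
  qed
  finally have 2: "cmod ((z + \<zeta>\<^sup>2) * b) \<le> (2 * cmod \<zeta>0 + 1) * ?E * sqrt t" .
  have "ennreal (cmod (LINT y|lebesgue. rho \<zeta> t (y - x) * f y)) \<le> ennreal (cmod a + (2 * cmod \<zeta>0 + 1) * ?E * sqrt t)"
    unfolding eq using norm_triangle_ineq[of "- a" "(z + \<zeta>\<^sup>2) * b"] 2 by (intro ennreal_leI) auto
  also have "\<dots> = ennreal (cmod a) + ennreal ((2 * cmod \<zeta>0 + 1) * ?E * sqrt t)"
    using E0 t by (intro ennreal_plus mult_nonneg_nonneg) auto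
  also have "ennreal (cmod a) \<le> (\<integral>\<^sup>+ y. ennreal (cmod (V y * ker \<zeta> t (y - x) * \<psi> y)) \<partial>lebesgue)"
    unfolding a_def by (rule ennreal_norm_integral_le)
  also have "\<dots> \<le> epot t (\<lambda>y. cmod (V y) * cmod (\<psi> y)) x"
    unfolding epot_def
  proof (intro nn_integral_mono ennreal_leI)
    fix y
    have "cmod (V y * ker \<zeta> t (y - x) * \<psi> y) = cmod (ker \<zeta> t (y - x)) * (cmod (V y) * cmod (\<psi> y))"
      by (simp add: norm_mult)
    also have "\<dots> \<le> rker t t (x - y) * (cmod (V y) * cmod (\<psi> y))"
      using cmod_ker_le[OF t(1) Re(1), of "y - x"] by (intro mult_right_mono) (simp_all add: rker_minus[of t t x])
    finally show "cmod (V y * ker \<zeta> t (y - x) * \<psi> y) \<le> rker t t (x - y) * (cmod (V y) * cmod (\<psi> y))" .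
  qed
  finally show ?thesis by (simp add: \<zeta>_def add_right_mono)
qed

text \<open>
  A sequence along which regularisation and shift tend to \<open>0\<close> simultaneously.
\<close>

definition step :: "nat \<Rightarrow> real" where "step n = inverse (real (Suc n))"

lemma step: "0 < step n" "step n \<le> 1" "step \<longlonglongrightarrow> 0" "m \<le> n \<Longrightarrow> step n \<le> step m"
  using LIMSEQ_inverse_real_of_nat by (auto simp: step_def[abs_def] field_simps)

lemma epot_incseq: "(\<And>y. 0 \<le> g y) \<Longrightarrow> incseq (\<lambda>n. epot (step n) g x)"
  using epot_mono[OF step(1) step(4)] by (auto simp: incseq_def)

text \<open>
  Integrating over a box makes the mollification on the left converge; on the right the potentials
  increase to their supremum and the error vanishes.
\<close>

lemma box_integral_le_epot:
  assumes H: "(\<psi>, \<lambda>x. z\<^sup>2 * \<psi> x) \<in> H_op V" and V: "V \<in> borel_measurable lebesgue"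
  shows "ennreal (cmod (LINT x|lebesgue. indicator (box l u) x * (z * \<psi> x - laplacian \<psi> x)))
    \<le> (\<integral>\<^sup>+ x. (SUP n. epot (step n) (\<lambda>y. cmod (V y) * cmod (\<psi> y)) x) * indicator (box l u) x \<partial>lebesgue)"
proof -
  define f where "f y = z * \<psi> y - laplacian \<psi> y" for y
  define g where "g y = cmod (V y) * cmod (\<psi> y)" for y
  define \<zeta>0 where "\<zeta>0 = csqrt (- z)"
  have \<zeta>0: "\<zeta>0\<^sup>2 = - z" "0 \<le> Re \<zeta>0"
    using csqrt_principal[of "- z"] by (auto simp: \<zeta>0_def)
  have \<psi>: "\<psi> \<in> Sobolev 2" using H by (auto simp: H_op_def)
  have f: "f \<in> L2" unfolding f_def[abs_def] by (rule shifted_laplacian_L2[OF \<psi>])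
  have mg: "g \<in> borel_measurable lebesgue"
    using V L2_measurable[OF Sobolev_L2[OF \<psi>]] unfolding g_def[abs_def] by measurable
  define C where "C = (2 * cmod \<zeta>0 + 1) * (decay_mass / mass\<^sup>2 + (LINT y|lebesgue. (cmod (f y))\<^sup>2))"
  let ?X = "\<integral>\<^sup>+ x. (SUP n. epot (step n) g x) * indicator (box l u) x \<partial>lebesgue"
  let ?vol = "emeasure lebesgue (box l u)"
  let ?F = "\<lambda>n x. LINT y|lebesgue. rho (\<zeta>0 + of_real (step n)) (step n) (y - x) * f y"
  have mP: "(\<lambda>x. SUP n. epot (step n) g x) \<in> borel_measurable lebesgue"
    using epot_measurable[OF step(1) mg] by measurable
  have le: "ennreal (cmod (LINT x|lebesgue. indicator (box l u) x * ?F n x)) \<le> ?X + ennreal (C * sqrt (step n)) * ?vol" for n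
  proof -
    have "ennreal (cmod (LINT x|lebesgue. indicator (box l u) x * ?F n x)) \<le> (\<integral>\<^sup>+ x. ennreal (cmod (indicator (box l u) x * ?F n x)) \<partial>lebesgue)"
      by (rule ennreal_norm_integral_le)
    also have "\<dots> \<le> (\<integral>\<^sup>+ x. (SUP n. epot (step n) g x) * indicator (box l u) x + ennreal (C * sqrt (step n)) * indicator (box l u) x \<partial>lebesgue)"
    proof (rule nn_integral_mono)
      fix x
      have "ennreal (cmod (?F n x)) \<le> epot (step n) g x + ennreal (C * sqrt (step n))"
        unfolding C_def f_def g_def by (rule mollified_eigenfunction_le[OF H step(1,2) \<zeta>0])
      also have "\<dots> \<le> (SUP n. epot (step n) g x) + ennreal (C * sqrt (step n))"
        by (intro add_right_mono SUP_upper) simp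
      finally show "ennreal (cmod (indicator (box l u) x * ?F n x))
        \<le> (SUP n. epot (step n) g x) * indicator (box l u) x + ennreal (C * sqrt (step n)) * indicator (box l u) x"
        by (cases "x \<in> box l u") auto
    qed
    also have "\<dots> = ?X + ennreal (C * sqrt (step n)) * ?vol"
    proof (subst nn_integral_add)
      show "(\<lambda>x. (SUP n. epot (step n) g x) * indicator (box l u) x) \<in> borel_measurable lebesgue"
        by (intro borel_measurable_times_ennreal mP borel_measurable_indicator) simp
      show "(\<lambda>x. ennreal (C * sqrt (step n)) * indicator (box l u) x :: ennreal) \<in> borel_measurable lebesgue"
        by (intro borel_measurable_times_ennreal borel_measurable_const borel_measurable_indicator) simp
    qed (simp add: nn_integral_cmult_indicator)
    finally show ?thesis .
  qed
  have A: "(\<lambda>n. ennreal (cmod (LINT x|lebesgue. indicator (box l u) x * ?F n x))) \<longlonglongrightarrow> ennreal (cmod (LINT x|lebesgue. indicator (box l u) x * f x))"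
  proof (intro tendsto_ennrealI tendsto_norm mollified_box_tendsto[OF f step(1,2,3), where M="cmod \<zeta>0 + 1"])
    fix n
    show "step n \<le> Re (\<zeta>0 + of_real (step n))" using \<zeta>0(2) by simp
    show "cmod (\<zeta>0 + of_real (step n)) \<le> cmod \<zeta>0 + 1"
      using norm_triangle_ineq[of \<zeta>0 "of_real (step n)"] step(1,2)[of n] by simp
  qed
  have vol: "?vol < \<infinity>" by (auto simp: emeasure_lborel_box_eq)
  have "(\<lambda>n. C * sqrt (step n)) \<longlonglongrightarrow> C * sqrt 0" by (intro tendsto_intros step(3))
  then have "(\<lambda>n. ennreal (C * sqrt (step n))) \<longlonglongrightarrow> ennreal 0" by (intro tendsto_ennrealI) simp
  then have "(\<lambda>n. ?X + ennreal (C * sqrt (step n)) * ?vol) \<longlonglongrightarrow> ?X + ennreal 0 * ?vol"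
    using vol by (intro tendsto_add tendsto_const tendsto_mult_ennreal) auto
  from LIMSEQ_le[OF A this] le show ?thesis by (simp add: f_def g_def[abs_def])
qed

section \<open>The eigenvalue bound\<close>

text \<open>
  Local integrability of the Newtonian kernel, uniformly in the regularisation.
\<close>

lemma rker_le_decay:
  assumes t: "0 < t" and v: "v \<noteq> 0" "norm v \<le> R"
  shows "rker t t v \<le> R * (1 + R)\<^sup>2 / mass * (1 / ((norm v)\<^sup>2 * (1 + norm v)\<^sup>2))"
proof -
  have r: "0 < norm v" using v by simp
  have "rker t t v \<le> 1 / (mass * norm v)"
    unfolding rker_def using t r mass_pos rad_ge(1)[of v t] rad_pos[OF t, of v]
    by (intro frac_le) auto
  also have "\<dots> = norm v * (1 + norm v)\<^sup>2 / mass * (1 / ((norm v)\<^sup>2 * (1 + norm v)\<^sup>2))"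
  proof -
    have "1 / (m * r) = r * q / m * (1 / (r\<^sup>2 * q))" if "r > 0" "q > 0" for m r q :: real
      using that by (simp add: power2_eq_square)
    moreover have "0 < (1 + norm v)\<^sup>2" using r by (intro zero_less_power) linarith
    ultimately show ?thesis using r by blast
  qed
  also have "\<dots> \<le> R * (1 + R)\<^sup>2 / mass * (1 / ((norm v)\<^sup>2 * (1 + norm v)\<^sup>2))"
    using v(2) r mass_pos order.trans[OF norm_ge_zero v(2)]
    by (intro mult_right_mono divide_right_mono mult_mono power_mono) auto
  finally show ?thesis .
qed

lemma box_energy_bounded:
  obtains E where "\<And>t. 0 < t \<Longrightarrow> (LINT y|lebesgue. indicator (box l u) y * pot t t (indicator (box l u)) y) \<le> E"
proof -
  let ?w = "indicat_real (box l u)"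
  obtain R where R: "0 \<le> R" "\<And>x. x \<in> box l u \<Longrightarrow> norm x \<le> R"
    using bounded_box[of l u] unfolding bounded_pos by (meson less_imp_le)
  let ?q = "\<lambda>x::real^3. 1 / ((norm x)\<^sup>2 * (1 + norm x)\<^sup>2)"
  define K where "K = 2 * R * (1 + 2 * R)\<^sup>2 / mass"
  have K0: "0 \<le> K" using R mass_pos by (simp add: K_def)
  have w: "bdd_density ?w" by (rule bdd_density_indicator_box)
  have iw: "integrable lebesgue ?w" by (rule bdd_density_integrable[OF w])
  have q0: "0 \<le> decay_mass" unfolding decay_mass_def by (intro integral_nonneg_AE) simp
  have "(LINT y|lebesgue. ?w y * pot t t ?w y) \<le> (LINT y|lebesgue. K * decay_mass * ?w y)" if t: "0 < t" for t
  proof (rule integral_mono[OF pot_integrable(5)[OF t t w] integrable_mult_right[OF iw]])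
    fix x
    have iq: "integrable lebesgue (\<lambda>y. ?q (y - x))" by (rule integrable_translate[OF integrable_decay])
    have "pot t t ?w x \<le> K * decay_mass" if x: "x \<in> box l u"
    proof -
      have "pot t t ?w x \<le> (LINT y|lebesgue. K * ?q (y - x))"
        unfolding pot_def
      proof (rule integral_mono_AE[OF pot_integrable(1)[OF t t w] integrable_mult_right[OF iq]])
        show "AE y in lebesgue. rker t t (x - y) * ?w y \<le> K * ?q (y - x)"
          using AE_lebesgue_neq[of x]
        proof eventually_elim
          case (elim y)
          show ?case
          proof (cases "y \<in> box l u")
            case True
            have "norm (y - x) \<le> 2 * R" using norm_triangle_ineq4[of y x] R(2)[OF x] R(2)[OF True] by linarith
            then have "rker t t (y - x) \<le> K * ?q (y - x)"
              unfolding K_def using elim by (intro rker_le_decay[OF t]) auto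
            then show ?thesis using True by (simp add: rker_minus[of t t x])
          next
            case False
            then show ?thesis using K0 by simp
          qed
        qed
      qed
      also have "\<dots> = K * (LINT y|lebesgue. ?q (y - x))" by (rule integral_mult_right_zero)
      also have "(LINT y|lebesgue. ?q (y - x)) = decay_mass"
        using integral_lebesgue_affine(2)[of 1 ?q "- x"] borel_measurable_integrable[OF integrable_decay]
        by (simp add: decay_mass_def)
      finally show ?thesis .
    qed
    then show "?w x * pot t t ?w x \<le> K * decay_mass * ?w x"
      by (cases "x \<in> box l u") auto
  qed
  then show ?thesis by (rule that)
qed

lemma ennreal_cancel_square:
  fixes I c :: ennreal
  assumes "I\<^sup>2 \<le> c * I" "I < \<infinity>"
  shows "I \<le> c"
proof (cases "I = 0")
  case False
  have "I * I \<le> I * c" using assms(1) by (simp add: power2_eq_square mult.commute)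
  then show ?thesis using False assms(2) by (subst (asm) ennreal_mult_le_mult_iff) auto
qed simp

lemma ennreal_finite_of_square: "(I :: ennreal)\<^sup>2 < \<infinity> \<Longrightarrow> I < \<infinity>"
  by (cases I) (auto simp: power2_eq_square)

text \<open>
  The quotient of the theorem is turned into a product. A vanishing denominator with a positive
  numerator would make the quotient, and hence the supremum, infinite.
\<close>

lemma form_bound_SUP:
  assumes "S = (SUP \<psi>\<in>{\<psi> \<in> Sobolev 1. \<not> (AE x in lebesgue. \<psi> x = 0)}.
      (\<integral>\<^sup>+ x. ennreal (cmod (V x) * (cmod (\<psi> x))\<^sup>2) \<partial>lebesgue)
      / (\<integral>\<^sup>+ x. ennreal (grad_norm_sq \<psi> x) \<partial>lebesgue))" and "S < \<infinity>"
  shows "form_bound V S"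
  unfolding form_bound_def
proof
  fix f :: "real^3 \<Rightarrow> complex" assume f: "f \<in> Sobolev 1"
  let ?N = "\<integral>\<^sup>+ x. ennreal (cmod (V x) * (cmod (f x))\<^sup>2) \<partial>lebesgue"
  let ?D = "\<integral>\<^sup>+ x. ennreal (grad_norm_sq f x) \<partial>lebesgue"
  show "?N \<le> S * ?D"
  proof (cases "AE x in lebesgue. f x = 0")
    case True
    then have "?N = (\<integral>\<^sup>+ x. 0 \<partial>(lebesgue :: (real^3) measure))"
      by (intro nn_integral_cong_AE) auto
    then show ?thesis by simp
  next
    case False
    then have le: "?N / ?D \<le> S" unfolding assms(1) using f by (intro SUP_upper) auto
    have "weak_deriv b f \<in> L2" if "b \<in> Basis" for b
      using f that weak_deriv_works(1)[of b f] by auto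
    then have "integrable lebesgue (grad_norm_sq f)"
      unfolding grad_norm_sq_def[abs_def] by (intro Bochner_Integration.integrable_sum L2_integrable_sq)
    then have D: "?D < \<infinity>"
      unfolding integrable_iff_bounded by (auto simp: grad_norm_sq_def sum_nonneg)
    show ?thesis
    proof (cases "?D = 0")
      case True
      have "?N = 0"
      proof (rule ccontr)
        assume "?N \<noteq> 0"
        then have "?N / ?D = top" by (simp add: True divide_ennreal_def ennreal_mult_top)
        with le assms(2) show False by (simp add: top_unique)
      qed
      then show ?thesis by simp
    next
      case False
      have "?N = ?N / ?D * ?D" using False D by (simp add: ennreal_divide_times ennreal_times_divide[symmetric] mult_divide_eq_ennreal)
      also have "\<dots> \<le> S * ?D" using le by (intro mult_right_mono) auto
      finally show ?thesis .
    qed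
  qed
qed

text \<open>
  For a truncation \<open>w\<close> of \<open>g\<close> the energy \<open>\<integral> w N w\<close> is at most \<open>I = \<integral> w N g\<close>, so that the Cauchy-Schwarz
  estimate becomes \<open>I\<^sup>2 \<le> A S I\<close>. The truncation ensures that \<open>I\<close> is finite and can be cancelled; both the
  truncation and the regularisation are then removed by monotone convergence.
\<close>

lemma epot_energy:
  assumes V: "V \<in> borel_measurable lebesgue" "form_bound V S" "S < \<infinity>" and \<psi>: "\<psi> \<in> borel_measurable lebesgue"
    and A: "A = (\<integral>\<^sup>+ x. ennreal (cmod (V x) * (cmod (\<psi> x))\<^sup>2) \<partial>lebesgue)" "A < \<infinity>"
    and g: "g = (\<lambda>y. cmod (V y) * cmod (\<psi> y))"
  shows "(\<integral>\<^sup>+ x. ennreal (g x) * (SUP n. epot (step n) g x) \<partial>lebesgue) \<le> A * S"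
proof -
  have mg: "g \<in> borel_measurable lebesgue" unfolding g using V(1) \<psi> by measurable
  have g0: "0 \<le> g x" for x by (simp add: g)
  note mP = epot_measurable[OF step(1) mg]
  note inc = epot_incseq[OF g0]
  define w where "w N x = (if norm x \<le> real N \<and> g x \<le> real N then g x else 0)" for N :: nat and x
  have mw: "w N \<in> borel_measurable lebesgue" for N
  proof -
    have [measurable]: "norm \<in> borel_measurable (lebesgue :: (real^3) measure)"
      by (intro borel_measurable_lebesgueI continuous_intros)
    note [measurable] = mg
    show ?thesis unfolding w_def[abs_def] by measurable
  qed
  have wg: "0 \<le> w N x" "w N x \<le> g x" for N x using g0 by (auto simp: w_def)
  have w: "bdd_density (w N)" for N
    unfolding bdd_density_def
    by (intro conjI mw allI wg exI[of _ "real N"]) (auto simp: w_def split: if_splits)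
  have trunc: "(\<integral>\<^sup>+ x. ennreal (w N x) * epot (step n) g x \<partial>lebesgue) \<le> A * S" for N n
  proof -
    let ?t = "step n"
    let ?I = "\<integral>\<^sup>+ x. ennreal (w N x) * epot ?t g x \<partial>lebesgue"
    have CS: "?I\<^sup>2 \<le> A * (S * ennreal (LINT y|lebesgue. w N y * pot ?t ?t (w N) y))"
      unfolding A g by (rule epot_Cauchy_Schwarz[OF V(1,2) \<psi> step(1) w])
    have "ennreal (LINT y|lebesgue. w N y * pot ?t ?t (w N) y) = (\<integral>\<^sup>+ y. ennreal (w N y * pot ?t ?t (w N) y) \<partial>lebesgue)"
      using wg pot_nonneg[OF step(1) w]
      by (intro nn_integral_eq_integral[symmetric] pot_integrable(5)[OF step(1) step(1) w]) auto
    also have "\<dots> \<le> (\<integral>\<^sup>+ y. ennreal (g y * pot ?t ?t (w N) y) \<partial>lebesgue)"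
      using wg pot_nonneg[OF step(1) w] by (intro nn_integral_mono ennreal_leI mult_right_mono) auto
    also have "\<dots> = ?I" by (rule epot_pairing[OF step(1) mg g0 w, symmetric])
    finally have E: "ennreal (LINT y|lebesgue. w N y * pot ?t ?t (w N) y) \<le> ?I" .
    have "A * (S * ennreal (LINT y|lebesgue. w N y * pot ?t ?t (w N) y)) < \<infinity>"
      using A(2) V(3) by (simp add: ennreal_mult_less_top)
    with CS have "?I\<^sup>2 < \<infinity>" by (rule le_less_trans)
    then have fin: "?I < \<infinity>" by (rule ennreal_finite_of_square)
    have "?I\<^sup>2 \<le> (A * S) * ?I"
      using CS mult_left_mono[OF E, of "A * S"] by (simp add: mult.assoc)
    then show ?thesis using fin by (rule ennreal_cancel_square)
  qed
  have wsup: "ennreal (g x) * c = (SUP N. ennreal (w N x) * c)" for x c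
  proof (rule antisym)
    obtain N where N: "max (norm x) (g x) \<le> real N" using real_arch_simple by blast
    then have "w N x = g x" by (auto simp: w_def)
    then show "ennreal (g x) * c \<le> (SUP N. ennreal (w N x) * c)" by (intro SUP_upper2[of N]) auto
    show "(SUP N. ennreal (w N x) * c) \<le> ennreal (g x) * c"
      using wg by (intro SUP_least mult_right_mono ennreal_leI) auto
  qed
  have full: "(\<integral>\<^sup>+ x. ennreal (g x) * epot (step n) g x \<partial>lebesgue) \<le> A * S" for n
  proof -
    have "(\<integral>\<^sup>+ x. ennreal (g x) * epot (step n) g x \<partial>lebesgue) = (\<integral>\<^sup>+ x. (SUP N. ennreal (w N x) * epot (step n) g x) \<partial>lebesgue)"
      by (simp only: wsup)
    also have "\<dots> = (SUP N. \<integral>\<^sup>+ x. ennreal (w N x) * epot (step n) g x \<partial>lebesgue)"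
    proof (rule nn_integral_monotone_convergence_SUP)
      have "w N x \<le> w M x" if "N \<le> M" for N M x
        using that g0[of x] by (auto simp: w_def)
      then show "incseq (\<lambda>N x. ennreal (w N x) * epot (step n) g x)"
        by (auto simp: incseq_def le_fun_def intro!: mult_right_mono ennreal_leI)
      show "(\<lambda>x. ennreal (w N x) * epot (step n) g x) \<in> borel_measurable lebesgue" for N
        using mw[of N] mP[of n] by measurable
    qed
    also have "\<dots> \<le> A * S" by (intro SUP_least trunc)
    finally show ?thesis .
  qed
  have "(\<integral>\<^sup>+ x. ennreal (g x) * (SUP n. epot (step n) g x) \<partial>lebesgue) = (\<integral>\<^sup>+ x. (SUP n. ennreal (g x) * epot (step n) g x) \<partial>lebesgue)"
    by (simp add: SUP_mult_left_ennreal)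
  also have "\<dots> = (SUP n. \<integral>\<^sup>+ x. ennreal (g x) * epot (step n) g x \<partial>lebesgue)"
  proof (rule nn_integral_monotone_convergence_SUP)
    show "incseq (\<lambda>n x. ennreal (g x) * epot (step n) g x)"
      using inc by (auto simp: incseq_def le_fun_def intro!: mult_left_mono)
    show "(\<lambda>x. ennreal (g x) * epot (step n) g x) \<in> borel_measurable lebesgue" for n
      using mg mP[of n] by measurable
  qed
  also have "\<dots> \<le> A * S" by (intro SUP_least full)
  finally show ?thesis .
qed

text \<open>
  The same Cauchy-Schwarz estimate with the indicator of a box in place of a truncation of \<open>g\<close>. This
  local integrability is what Lebesgue differentiation requires of the majorant.
\<close>

lemma epot_box_finite:
  assumes V: "V \<in> borel_measurable lebesgue" "form_bound V S" "S < \<infinity>" and \<psi>: "\<psi> \<in> borel_measurable lebesgue"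
    and A: "(\<integral>\<^sup>+ x. ennreal (cmod (V x) * (cmod (\<psi> x))\<^sup>2) \<partial>lebesgue) < \<infinity>"
    and g: "g = (\<lambda>y. cmod (V y) * cmod (\<psi> y))"
  shows "(\<integral>\<^sup>+ x. (SUP n. epot (step n) g x) * indicator (box l u) x \<partial>lebesgue) < \<infinity>"
proof -
  have mg: "g \<in> borel_measurable lebesgue" unfolding g using V(1) \<psi> by measurable
  have g0: "0 \<le> g x" for x by (simp add: g)
  note mP = epot_measurable[OF step(1) mg]
  note inc = epot_incseq[OF g0]
  let ?w = "indicat_real (box l u)"
  have w: "bdd_density ?w" by (rule bdd_density_indicator_box)
  have ew: "ennreal (?w x) = indicator (box l u) x" for x by (simp add: indicator_def)
  have mi: "(indicator (box l u) :: real^3 \<Rightarrow> ennreal) \<in> borel_measurable lebesgue"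
    by (rule borel_measurable_indicator) simp
  obtain E where E: "\<And>t. 0 < t \<Longrightarrow> (LINT y|lebesgue. ?w y * pot t t ?w y) \<le> E"
    using box_energy_bounded[of l u] by blast
  let ?A = "\<integral>\<^sup>+ x. ennreal (cmod (V x) * (cmod (\<psi> x))\<^sup>2) \<partial>lebesgue"
  let ?c = "?A * (S * ennreal E)"
  have c: "?c < \<infinity>" using A V(3) by (simp add: ennreal_mult_less_top)
  \<comment> \<open>A square root is avoided: a number whose square is at most c is at most c + 1.\<close>
  have "(\<integral>\<^sup>+ x. indicator (box l u) x * epot (step n) g x \<partial>lebesgue) \<le> ?c + 1" for n
  proof -
    let ?I = "\<integral>\<^sup>+ x. indicator (box l u) x * epot (step n) g x \<partial>lebesgue"
    have "?I\<^sup>2 \<le> ?A * (S * ennreal (LINT y|lebesgue. ?w y * pot (step n) (step n) ?w y))"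
      using epot_Cauchy_Schwarz[OF V(1,2) \<psi> step(1) w, of n] unfolding ew g .
    also have "\<dots> \<le> ?c" by (intro mult_left_mono ennreal_leI E step(1)) auto
    finally have I: "?I\<^sup>2 \<le> ?c" .
    show ?thesis
    proof (cases "?I \<le> 1")
      case True
      then show ?thesis by (simp add: add_increasing)
    next
      case False
      then have "1 * ?I \<le> ?I * ?I" by (intro mult_right_mono) auto
      then have "?I \<le> ?c" using I by (simp add: power2_eq_square)
      then show ?thesis by (simp add: add_increasing2)
    qed
  qed
  then have "(SUP n. \<integral>\<^sup>+ x. indicator (box l u) x * epot (step n) g x \<partial>lebesgue) \<le> ?c + 1"
    by (rule SUP_least)
  also have "(SUP n. \<integral>\<^sup>+ x. indicator (box l u) x * epot (step n) g x \<partial>lebesgue)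
    = (\<integral>\<^sup>+ x. (SUP n. indicator (box l u) x * epot (step n) g x) \<partial>lebesgue)"
  proof (rule nn_integral_monotone_convergence_SUP[symmetric])
    show "incseq (\<lambda>n x. indicator (box l u) x * epot (step n) g x)"
      using inc by (auto simp: incseq_def le_fun_def intro!: mult_left_mono)
    show "(\<lambda>x. indicator (box l u) x * epot (step n) g x) \<in> borel_measurable lebesgue" for n
      by (intro borel_measurable_times_ennreal mi mP)
  qed
  also have "\<dots> = (\<integral>\<^sup>+ x. (SUP n. epot (step n) g x) * indicator (box l u) x \<partial>lebesgue)"
    by (simp add: SUP_mult_left_ennreal[symmetric] mult.commute)
  finally show ?thesis using c by (simp add: le_less_trans)
qed

text \<open>
  The two square roots \<open>\<plusminus> z\<close> of the eigenvalue give two functions \<open>\<plusminus> z \<psi> - \<Delta> \<psi>\<close>, each bounded by the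
  potential on average over boxes; their difference is \<open>2 z \<psi>\<close>.
\<close>

lemma eigenfunction_le_epot:
  assumes H: "(\<psi>, \<lambda>x. z\<^sup>2 * \<psi> x) \<in> H_op V" and V: "V \<in> borel_measurable lebesgue"
    and g: "g = (\<lambda>y. cmod (V y) * cmod (\<psi> y))"
    and fin: "\<And>l u. (\<integral>\<^sup>+ x. (SUP n. epot (step n) g x) * indicator (box l u) x \<partial>lebesgue) < \<infinity>"
  shows "AE x in lebesgue. ennreal (cmod z * cmod (\<psi> x)) \<le> (SUP n. epot (step n) g x)"
proof -
  define P where "P x = (SUP n. epot (step n) g x)" for x
  have \<psi>: "\<psi> \<in> Sobolev 2" using H by (auto simp: H_op_def)
  note L = Sobolev_L2[OF \<psi>] laplacian_L2[OF \<psi>]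
  have mg: "g \<in> borel_measurable lebesgue" unfolding g using V L2_measurable[OF L(1)] by measurable
  have mP: "P \<in> borel_measurable lebesgue"
    unfolding P_def[abs_def] using epot_measurable[OF step(1) mg] by measurable
  define h where "h x = 2 * enn2real (P x)" for x
  have h0: "0 \<le> h x" for x by (simp add: h_def)
  have mh: "h \<in> borel_measurable lebesgue" unfolding h_def[abs_def] using mP by measurable
  have mi: "(indicator (box l u) :: real^3 \<Rightarrow> ennreal) \<in> borel_measurable lebesgue" for l u :: "real^3"
    by (rule borel_measurable_indicator) simp
  have hi: "(\<integral>\<^sup>+ x. ennreal (indicator (box l u) x *\<^sub>R h x) \<partial>lebesgue) = 2 * (\<integral>\<^sup>+ x. P x * indicator (box l u) x \<partial>lebesgue)" for l u
  proof -
    have m: "(\<lambda>x. P x * indicator (box l u) x) \<in> borel_measurable lebesgue"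
      by (intro borel_measurable_times_ennreal mP mi)
    have "AE x in lebesgue. P x * indicator (box l u) x \<noteq> \<infinity>"
      by (rule nn_integral_noteq_infinite[OF m]) (use fin[of l u] in \<open>simp add: P_def less_top\<close>)
    then have "AE x in lebesgue. ennreal (indicator (box l u) x *\<^sub>R h x) = 2 * (P x * indicator (box l u) x)"
    proof eventually_elim
      case (elim x)
      then show ?case
        by (cases "x \<in> box l u") (auto simp: h_def ennreal_mult less_top)
    qed
    then have "(\<integral>\<^sup>+ x. ennreal (indicator (box l u) x *\<^sub>R h x) \<partial>lebesgue) = (\<integral>\<^sup>+ x. 2 * (P x * indicator (box l u) x) \<partial>lebesgue)"
      by (rule nn_integral_cong_AE)
    also have "\<dots> = 2 * (\<integral>\<^sup>+ x. P x * indicator (box l u) x \<partial>lebesgue)" by (rule nn_integral_cmult[OF m])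
    finally show ?thesis .
  qed
  have sh: "set_integrable lebesgue (box l u) h" for l u
    unfolding set_integrable_def
  proof (rule integrableI_nonneg)
    show "(\<lambda>x. indicat_real (box l u) x *\<^sub>R h x) \<in> borel_measurable lebesgue"
      by (intro borel_measurable_scaleR borel_measurable_indicator mh) simp
    show "AE x in lebesgue. 0 \<le> indicat_real (box l u) x *\<^sub>R h x" using h0 by simp
    show "(\<integral>\<^sup>+ x. ennreal (indicator (box l u) x *\<^sub>R h x) \<partial>lebesgue) < \<infinity>"
      unfolding hi using fin[of l u] by (simp add: P_def ennreal_mult_less_top)
  qed
  have L2z: "(\<lambda>x. 2 * z * \<psi> x) \<in> L2" by (intro L2_cmult L)
  have bound: "cmod (LINT x:box l u|lebesgue. 2 * z * \<psi> x) \<le> (LINT x:box l u|lebesgue. h x)" for l u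
  proof -
    have i: "integrable lebesgue (\<lambda>x. indicator (box l u) x * (c * \<psi> x - laplacian \<psi> x))" for c
      by (rule L2_mult_integrable[OF L2_indicator_box shifted_laplacian_L2[OF \<psi>]])
    have H': "(\<psi>, \<lambda>x. (- z)\<^sup>2 * \<psi> x) \<in> H_op V" using H by simp
    have e: "(LINT x:box l u|lebesgue. 2 * z * \<psi> x)
      = (LINT x|lebesgue. indicator (box l u) x * (z * \<psi> x - laplacian \<psi> x)) - (LINT x|lebesgue. indicator (box l u) x * (- z * \<psi> x - laplacian \<psi> x))"
      unfolding set_lebesgue_integral_def Bochner_Integration.integral_diff[OF i i, symmetric]
      by (intro Bochner_Integration.integral_cong refl) (simp add: indicator_def)
    have "ennreal (cmod (LINT x:box l u|lebesgue. 2 * z * \<psi> x))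
      \<le> ennreal (cmod (LINT x|lebesgue. indicator (box l u) x * (z * \<psi> x - laplacian \<psi> x)))
       + ennreal (cmod (LINT x|lebesgue. indicator (box l u) x * (- z * \<psi> x - laplacian \<psi> x)))"
    proof -
      have "ennreal (cmod (p - q)) \<le> ennreal (cmod p) + ennreal (cmod q)" for p q :: complex
        using ennreal_leI[OF norm_triangle_ineq4[of p q]] by (simp only: ennreal_plus norm_ge_zero)
      then show ?thesis unfolding e .
    qed
    also have "\<dots> \<le> (\<integral>\<^sup>+ x. P x * indicator (box l u) x \<partial>lebesgue) + (\<integral>\<^sup>+ x. P x * indicator (box l u) x \<partial>lebesgue)"
      using box_integral_le_epot[OF H V, of l u] box_integral_le_epot[OF H' V, of l u]
      unfolding P_def g by (intro add_mono)
    also have "\<dots> = (\<integral>\<^sup>+ x. ennreal (indicator (box l u) x *\<^sub>R h x) \<partial>lebesgue)"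
      unfolding hi by (simp add: mult_2)
    also have "\<dots> = ennreal (LINT x:box l u|lebesgue. h x)"
      unfolding set_lebesgue_integral_def
      using sh[of l u] h0 by (intro nn_integral_eq_integral) (auto simp: set_integrable_def)
    finally show ?thesis
      using h0 by (subst (asm) ennreal_le_iff) (auto simp: set_lebesgue_integral_def intro!: integral_nonneg_AE)
  qed
  have "AE x in lebesgue. cmod (2 * z * \<psi> x) \<le> h x"
    by (rule AE_norm_le_of_box_integrals[OF L2_box_integrable[OF L2z] sh bound])
  then show ?thesis
  proof eventually_elim
    case (elim x)
    then have "cmod z * cmod (\<psi> x) \<le> enn2real (P x)" by (simp add: h_def norm_mult)
    then have "ennreal (cmod z * cmod (\<psi> x)) \<le> ennreal (enn2real (P x))" by (rule ennreal_leI)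
    also have "\<dots> \<le> P x" by (cases "P x") auto
    finally show ?case by (simp add: P_def)
  qed
qed

theorem theorem3:
  fixes V :: "real^3 \<Rightarrow> complex" and a b :: real
  assumes "V \<in> borel_measurable lebesgue"
    and "0 < a" and "a < 1"
    and "\<And>\<psi>. \<psi> \<in> Sobolev 2 \<Longrightarrow>
      integrable lebesgue (\<lambda>x. cmod (V x) * (cmod (\<psi> x))\<^sup>2) \<and>
      (LINT x|lebesgue. cmod (V x) * (cmod (\<psi> x))\<^sup>2)
        \<le> a * (LINT x|lebesgue. (cmod (laplacian \<psi> x))\<^sup>2)
          + b * (LINT x|lebesgue. (cmod (\<psi> x))\<^sup>2)"
  shows "point_spectrum (H_op V) \<subseteq>
    {\<mu>. ennreal (cmod \<mu>) \<le>
       (SUP \<psi>\<in>{\<psi> \<in> Sobolev 1. \<not> (AE x in lebesgue. \<psi> x = 0)}.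
          (\<integral>\<^sup>+ x. ennreal (cmod (V x) * (cmod (\<psi> x))\<^sup>2) \<partial>lebesgue)
          / (\<integral>\<^sup>+ x. ennreal (grad_norm_sq \<psi> x) \<partial>lebesgue))\<^sup>2}"
proof -
  define S where "S = (SUP \<psi>\<in>{\<psi> \<in> Sobolev 1. \<not> (AE x in lebesgue. \<psi> x = 0)}.
          (\<integral>\<^sup>+ x. ennreal (cmod (V x) * (cmod (\<psi> x))\<^sup>2) \<partial>lebesgue)
          / (\<integral>\<^sup>+ x. ennreal (grad_norm_sq \<psi> x) \<partial>lebesgue))"
  have "ennreal (cmod \<mu>) \<le> S\<^sup>2" if mu: "\<mu> \<in> point_spectrum (H_op V)" for \<mu>
  proof (cases "S = \<infinity>")
    case True
    then show ?thesis by (simp add: power2_eq_square ennreal_top_mult)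
  next
    case False
    then have S: "S < \<infinity>" by (simp add: less_top)
    have V: "V \<in> borel_measurable lebesgue" by fact
    have fb: "form_bound V S" by (rule form_bound_SUP[OF S_def S])
    obtain \<psi> where \<psi>0: "\<not> (AE x in lebesgue. \<psi> x = 0)" and H: "(\<psi>, \<lambda>x. \<mu> * \<psi> x) \<in> H_op V"
      using mu unfolding point_spectrum_def by blast
    define z where "z = csqrt \<mu>"
    have z2: "z\<^sup>2 = \<mu>" by (simp add: z_def)
    have Hz: "(\<psi>, \<lambda>x. z\<^sup>2 * \<psi> x) \<in> H_op V" using H z2 by simp
    have \<psi>: "\<psi> \<in> Sobolev 2" using H by (auto simp: H_op_def)
    have m\<psi>: "\<psi> \<in> borel_measurable lebesgue" using L2_measurable[OF Sobolev_L2[OF \<psi>]] .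
    define g where "g = (\<lambda>y. cmod (V y) * cmod (\<psi> y))"
    define P where "P x = (SUP n. epot (step n) g x)" for x
    define A where "A = (\<integral>\<^sup>+ x. ennreal (cmod (V x) * (cmod (\<psi> x))\<^sup>2) \<partial>lebesgue)"
    have A: "A < \<infinity>"
    proof -
      have "integrable lebesgue (\<lambda>x. cmod (V x) * (cmod (\<psi> x))\<^sup>2)" using assms(4)[OF \<psi>] by blast
      then show ?thesis unfolding A_def integrable_iff_bounded by simp
    qed
    have le: "AE x in lebesgue. ennreal (cmod z * cmod (\<psi> x)) \<le> P x"
      unfolding P_def using A epot_box_finite[OF V fb S m\<psi> _ g_def]
      by (intro eigenfunction_le_epot[OF Hz V g_def]) (simp add: A_def)
    have mz: "(\<lambda>x. ennreal (cmod (V x) * (cmod (\<psi> x))\<^sup>2)) \<in> borel_measurable lebesgue"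
      using V m\<psi> by measurable
    have "ennreal (cmod z) * A = (\<integral>\<^sup>+ x. ennreal (g x) * ennreal (cmod z * cmod (\<psi> x)) \<partial>lebesgue)"
      unfolding A_def nn_integral_cmult[OF mz, symmetric]
      by (intro nn_integral_cong) (simp add: g_def ennreal_mult[symmetric] power2_eq_square mult_ac)
    also have "\<dots> \<le> (\<integral>\<^sup>+ x. ennreal (g x) * P x \<partial>lebesgue)"
      by (rule nn_integral_mono_AE) (use le in eventually_elim, auto intro: mult_left_mono)
    also have "\<dots> \<le> A * S"
      unfolding P_def by (rule epot_energy[OF V fb S m\<psi> A_def A g_def])
    finally have main: "A * ennreal (cmod z) \<le> A * S" by (simp add: mult.commute)
    show ?thesis
    proof (cases "z = 0")
      case True
      then show ?thesis using z2 by auto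
    next
      case z: False
      \<comment> \<open>If A vanished, so would the source V \<open>\<psi>\<close> and with it the potential that dominates \<open>\<psi>\<close>.\<close>
      have "A \<noteq> 0"
      proof
        assume "A = 0"
        then have "AE x in lebesgue. ennreal (cmod (V x) * (cmod (\<psi> x))\<^sup>2) = 0"
          unfolding A_def using nn_integral_0_iff_AE[OF mz] by simp
        then have g0: "AE x in lebesgue. g x = 0"
          by eventually_elim (auto simp: g_def ennreal_eq_0_iff mult_le_0_iff)
        have "epot (step n) g x = (\<integral>\<^sup>+ y. 0 \<partial>(lebesgue :: (real^3) measure))" for n x
          unfolding epot_def by (rule nn_integral_cong_AE) (use g0 in eventually_elim, simp)
        then have P0: "P x = 0" for x by (simp add: P_def)
        from le have "AE x in lebesgue. \<psi> x = 0"
        proof eventually_elim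
          case (elim x)
          then show ?case using z P0[of x] by (auto simp: ennreal_eq_0_iff mult_le_0_iff)
        qed
        with \<psi>0 show False by simp
      qed
      with main A have "ennreal (cmod z) \<le> S"
        by (subst (asm) ennreal_mult_le_mult_iff) auto
      then have "(ennreal (cmod z))\<^sup>2 \<le> S\<^sup>2" by (intro power_mono) auto
      then show ?thesis by (simp add: ennreal_power norm_power[symmetric] z2)
    qed
  qed
  then show ?thesis unfolding S_def by blast
qed

end
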